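(* Let $A_n$ and $B_n$, for $n\in\mathbb N$, be unital, separable $C^*$-algebras with no nontrivial central projections, and suppose that each $A_n$ has the metric approximation property. Then all topologically trivial isomorphisms between $\prod A_n/\bigoplus A_n$ and $\prod B_n/\bigoplus B_n$ are asymptotically algebraic.
   Context: $\prod A_n$ is the $C^*$-algebra of bounded sequences $(a_n)$ with $a_n\in A_n$, and $\bigoplus A_n$ the ideal of sequences with $\|a_n\|\to0$. For unital $A_n$, $\mathcal M(\bigoplus A_n)=\prod A_n$, so the reduced product $\prod A_n/\bigoplus A_n$ is the corona algebra of $\bigoplus A_n$; let $\pi_A,\pi_B$ denote the quotient maps from $\prod A_n$, $\prod B_n$. The strict topology on $\prod A_n$ is generated by the seminorms $x\mapsto\|xa\|,\ x\mapsto\|ax\|$ for $a\in\bigoplus A_n$. A central projection is nontrivial if it is neither $0$ nor $1$. An isomorphism $\Lambda\colon\prod A_n/\bigoplus A_n\to\prod B_n/\bigoplus B_n$ is topologically trivial if $\{(a,b) : a\in\prod A_n,\ b\in\prod B_n,\ \|a\|,\|b\|\le1,\ \Lambda(\pi_A(a))=\pi_B(b)\}$ is Borel in the product of the strict topologies on the unit balls. $\Lambda$ is asymptotically algebraic if there are finite $F_1,F_2\subseteq\mathbb N$, a bijection $g\colon\mathbb N\setminus F_1\to\mathbb N\setminus F_2$ and maps $\varphi_n\colon A_n\to B_{g(n)}$ (arbitrary functions) such that the map $\Phi\colon\prod A_n\to\prod B_n$ given by $\Phi(x)_m=\varphi_n(x_n)$ if $m=g(n)$, and $\Phi(x)_m=0$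 if $m\in F_2$, is a lift of $\Lambda$, i.e. $\pi_B(\Phi(x))=\Lambda(\pi_A(x))$ for all $x\in\prod A_n$. Metric approximation property of a unital $C^*$-algebra $A$: for every finite $F\subseteq A$ and $\varepsilon>0$ there are a finite-dimensional operator system $E$ (a unital $^*$-closed linear subspace of some $\mathcal B(H)$) and unital linear contractions $\varphi\colon A\to E$, $\psi\colon E\to A$ with $\|\psi(\varphi(a))-a\|<\varepsilon$ for all $a\in F$. *)

theory Defs
  imports
    "HOL-Analysis.Analysis"
    "HOL-Algebra.QuotRing"
    "HOL-Algebra.Module"
    "HOL-Algebra.Algebraic_Closure_Type"
begin

section \<open>Unital \<open>C\<^sup>*\<close>-algebras with explicit carriers\<close>

text \<open>
  The algebras \<open>A\<^sub>n\<close> of a sequence are unrelated to each other, so a \<open>C\<^sup>*\<close>-algebra is a record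
  with a carrier, extending the rings and modules of HOL-Algebra; a sequence of algebras is a
  function \<open>nat \<Rightarrow> 'a cstar\<close>.  Any sequence of algebras can be placed on subsets of one type.
\<close>

abbreviation complex_ring :: "complex ring"
  where "complex_ring \<equiv> ring_of_type_algebra"

record 'a cstar = "(complex, 'a) module" +
  adj :: "'a \<Rightarrow> 'a"
  nrm :: "'a \<Rightarrow> real"

text \<open>
  The case distinction makes this a metric in the sense of \<^locale>\<open>Metric_space\<close>, which asks for
  symmetry and nonnegativity also outside of the carrier.
\<close>

definition carrier_dist :: "('a, 'm) ring_scheme \<Rightarrow> ('a \<Rightarrow> real) \<Rightarrow> 'a \<Rightarrow> 'a \<Rightarrow> real"
  where "carrier_dist M N x y =
    (if x \<in> carrier M \<and> y \<in> carrier M then N (x \<ominus>\<^bsub>M\<^esub> y) else 0)"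

locale unital_cstar_algebra = Module.module complex_ring A + Ring.ring A
  for A :: "('a, 'm) cstar_scheme" (structure) +
  assumes one_neq_zero: "\<one> \<noteq> \<zero>"
    and smult_mult_left:
      "x \<in> carrier A \<Longrightarrow> y \<in> carrier A \<Longrightarrow> (c \<odot> x) \<otimes> y = c \<odot> (x \<otimes> y)"
    and smult_mult_right:
      "x \<in> carrier A \<Longrightarrow> y \<in> carrier A \<Longrightarrow> x \<otimes> (c \<odot> y) = c \<odot> (x \<otimes> y)"
    and adj_closed: "x \<in> carrier A \<Longrightarrow> adj A x \<in> carrier A"
    and adj_adj: "x \<in> carrier A \<Longrightarrow> adj A (adj A x) = x"
    and adj_add:
      "x \<in> carrier A \<Longrightarrow> y \<in> carrier A \<Longrightarrow> adj A (x \<oplus> y) = adj A x \<oplus> adj A y"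
    and adj_smult: "x \<in> carrier A \<Longrightarrow> adj A (c \<odot> x) = cnj c \<odot> adj A x"
    and adj_mult:
      "x \<in> carrier A \<Longrightarrow> y \<in> carrier A \<Longrightarrow> adj A (x \<otimes> y) = adj A y \<otimes> adj A x"
    and nrm_eq_zero: "x \<in> carrier A \<Longrightarrow> nrm A x = 0 \<longleftrightarrow> x = \<zero>"
    and nrm_triangle:
      "x \<in> carrier A \<Longrightarrow> y \<in> carrier A \<Longrightarrow> nrm A (x \<oplus> y) \<le> nrm A x + nrm A y"
    and nrm_smult: "x \<in> carrier A \<Longrightarrow> nrm A (c \<odot> x) = cmod c * nrm A x"
    and nrm_mult:
      "x \<in> carrier A \<Longrightarrow> y \<in> carrier A \<Longrightarrow> nrm A (x \<otimes> y) \<le> nrm A x * nrm A y"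
    and cstar_identity: "x \<in> carrier A \<Longrightarrow> nrm A (adj A x \<otimes> x) = (nrm A x)\<^sup>2"
    and complete: "Metric_space.mcomplete (carrier A) (carrier_dist A (nrm A))"

definition separable_cstar :: "'a cstar \<Rightarrow> bool"
  where "separable_cstar A \<longleftrightarrow>
    separable_space (Metric_space.mtopology (carrier A) (carrier_dist A (nrm A)))"

definition central_projection :: "'a cstar \<Rightarrow> 'a \<Rightarrow> bool"
  where "central_projection A p \<longleftrightarrow>
    p \<in> carrier A \<and> p \<otimes>\<^bsub>A\<^esub> p = p \<and> adj A p = p \<and>
    (\<forall>x\<in>carrier A. p \<otimes>\<^bsub>A\<^esub> x = x \<otimes>\<^bsub>A\<^esub> p)"

definition no_nontrivial_central_projections :: "'a cstar \<Rightarrow> bool"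
  where "no_nontrivial_central_projections A \<longleftrightarrow>
    (\<forall>p. central_projection A p \<longrightarrow> p = \<zero>\<^bsub>A\<^esub> \<or> p = \<one>\<^bsub>A\<^esub>)"

text \<open>\<open>\<^sup>*\<close>-isomorphisms; only the values on the carrier matter.\<close>

definition cstar_iso :: "'a cstar \<Rightarrow> 'b cstar \<Rightarrow> ('a \<Rightarrow> 'b) set"
  where "cstar_iso A B = {h \<in> ring_iso A B.
    (\<forall>c. \<forall>x\<in>carrier A. h (c \<odot>\<^bsub>A\<^esub> x) = c \<odot>\<^bsub>B\<^esub> h x) \<and>
    (\<forall>x\<in>carrier A. h (adj A x) = adj B (h x))}"


section \<open>Hilbert spaces and bounded operators\<close>

text \<open>The multiplicative fields that a Hilbert space inherits from the module record are unused.\<close>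

record 'h hilbert = "(complex, 'h) module" +
  inner_prod :: "'h \<Rightarrow> 'h \<Rightarrow> complex"

definition hnrm :: "'h hilbert \<Rightarrow> 'h \<Rightarrow> real"
  where "hnrm H x = sqrt (Re (inner_prod H x x))"

locale hilbert_space = Module.module complex_ring H
  for H :: "'h hilbert" (structure) +
  assumes inner_add_left:
      "x \<in> carrier H \<Longrightarrow> y \<in> carrier H \<Longrightarrow> z \<in> carrier H \<Longrightarrow>
        inner_prod H (x \<oplus> y) z = inner_prod H x z + inner_prod H y z"
    and inner_smult_left:
      "x \<in> carrier H \<Longrightarrow> y \<in> carrier H \<Longrightarrow> inner_prod H (c \<odot> x) y = c * inner_prod H x y"
    and inner_commute:
      "x \<in> carrier H \<Longrightarrow> y \<in> carrier H \<Longrightarrow> inner_prod H y x = cnj (inner_prod H x y)"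
    and inner_nonneg: "x \<in> carrier H \<Longrightarrow> 0 \<le> Re (inner_prod H x x)"
    and inner_definite: "x \<in> carrier H \<Longrightarrow> inner_prod H x x = 0 \<Longrightarrow> x = \<zero>"
    and complete: "Metric_space.mcomplete (carrier H) (carrier_dist H (hnrm H))"

text \<open>Operators are extensional functions, so that they are determined by their values on \<open>H\<close>.\<close>

definition bounded_ops :: "'h hilbert \<Rightarrow> ('h \<Rightarrow> 'h) set"
  where "bounded_ops H = {T \<in> carrier H \<rightarrow>\<^sub>E carrier H.
    (\<forall>x\<in>carrier H. \<forall>y\<in>carrier H. T (x \<oplus>\<^bsub>H\<^esub> y) = T x \<oplus>\<^bsub>H\<^esub> T y) \<and>
    (\<forall>c. \<forall>x\<in>carrier H. T (c \<odot>\<^bsub>H\<^esub> x) = c \<odot>\<^bsub>H\<^esub> T x) \<and>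
    (\<exists>K. \<forall>x\<in>carrier H. hnrm H (T x) \<le> K * hnrm H x)}"

definition bounded_op_algebra :: "'h hilbert \<Rightarrow> ('h \<Rightarrow> 'h) cstar"
  where "bounded_op_algebra H = \<lparr>
    carrier = bounded_ops H,
    monoid.mult = compose (carrier H),
    one = (\<lambda>x\<in>carrier H. x),
    zero = (\<lambda>x\<in>carrier H. \<zero>\<^bsub>H\<^esub>),
    add = (\<lambda>S T. \<lambda>x\<in>carrier H. S x \<oplus>\<^bsub>H\<^esub> T x),
    smult = (\<lambda>c T. \<lambda>x\<in>carrier H. c \<odot>\<^bsub>H\<^esub> T x),
    adj = (\<lambda>T. THE S. S \<in> bounded_ops H \<and>
      (\<forall>x\<in>carrier H. \<forall>y\<in>carrier H. inner_prod H (T x) y = inner_prod H x (S y))),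
    nrm = (\<lambda>T. SUP x\<in>{x \<in> carrier H. hnrm H x \<le> 1}. hnrm H (T x))\<rparr>"


section \<open>The metric approximation property\<close>

definition operator_system :: "'h hilbert \<Rightarrow> ('h \<Rightarrow> 'h) set \<Rightarrow> bool"
  where "operator_system H E \<longleftrightarrow>
    submodule E complex_ring (bounded_op_algebra H) \<and>
    \<one>\<^bsub>bounded_op_algebra H\<^esub> \<in> E \<and>
    (\<forall>T\<in>E. adj (bounded_op_algebra H) T \<in> E)"

definition finite_dimensional :: "'a cstar \<Rightarrow> 'a set \<Rightarrow> bool"
  where "finite_dimensional A E \<longleftrightarrow>
    (\<exists>S. finite S \<and> S \<subseteq> E \<and>
      (\<forall>x\<in>E. \<exists>c :: 'a \<Rightarrow> complex. x = (\<Oplus>\<^bsub>A\<^esub>s\<in>S. c s \<odot>\<^bsub>A\<^esub> s)))"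

text \<open>Unital linear contractions from a subspace \<open>V\<close> of \<open>A\<close> to a subspace \<open>W\<close> of \<open>B\<close>.\<close>

definition unital_contraction ::
    "'a cstar \<Rightarrow> 'a set \<Rightarrow> 'b cstar \<Rightarrow> 'b set \<Rightarrow> ('a \<Rightarrow> 'b) \<Rightarrow> bool"
  where "unital_contraction A V B W f \<longleftrightarrow>
    f \<in> V \<rightarrow> W \<and>
    (\<forall>x\<in>V. \<forall>y\<in>V. f (x \<oplus>\<^bsub>A\<^esub> y) = f x \<oplus>\<^bsub>B\<^esub> f y) \<and>
    (\<forall>c. \<forall>x\<in>V. f (c \<odot>\<^bsub>A\<^esub> x) = c \<odot>\<^bsub>B\<^esub> f x) \<and>
    f \<one>\<^bsub>A\<^esub> = \<one>\<^bsub>B\<^esub> \<and>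
    (\<forall>x\<in>V. nrm B (f x) \<le> nrm A x)"

text \<open>
  The Hilbert space on which \<open>E\<close> acts is existentially quantified and may depend on \<open>F\<close> and \<open>\<epsilon>\<close>;
  its underlying set is any subset of the type \<open>'h\<close>.  Since HOL has no quantification over types,
  \<open>'h\<close> is a parameter.  In a hypothesis of a theorem a free \<open>'h\<close> amounts to an existential
  quantifier, so that there is no restriction on the Hilbert spaces.
\<close>

definition metric_approximation_property :: "'h itself \<Rightarrow> 'a cstar \<Rightarrow> bool"
  where "metric_approximation_property (_ :: 'h itself) A \<longleftrightarrow>
    (\<forall>F \<epsilon>. finite F \<and> F \<subseteq> carrier A \<and> 0 < \<epsilon> \<longrightarrow>
      (\<exists>(H :: 'h hilbert) E \<phi> \<psi>.
        hilbert_space H \<and> operator_system H E \<and>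
        finite_dimensional (bounded_op_algebra H) E \<and>
        unital_contraction A (carrier A) (bounded_op_algebra H) E \<phi> \<and>
        unital_contraction (bounded_op_algebra H) E A (carrier A) \<psi> \<and>
        (\<forall>a\<in>F. nrm A (\<psi> (\<phi> a) \<ominus>\<^bsub>A\<^esub> a) < \<epsilon>)))"


section \<open>Reduced products\<close>

definition cstar_product :: "(nat \<Rightarrow> 'a cstar) \<Rightarrow> (nat \<Rightarrow> 'a) cstar"
  where "cstar_product A = \<lparr>
    carrier = {x. (\<forall>n. x n \<in> carrier (A n)) \<and> bdd_above (range (\<lambda>n. nrm (A n) (x n)))},
    monoid.mult = (\<lambda>x y n. x n \<otimes>\<^bsub>A n\<^esub> y n),
    one = (\<lambda>n. \<one>\<^bsub>A n\<^esub>),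
    zero = (\<lambda>n. \<zero>\<^bsub>A n\<^esub>),
    add = (\<lambda>x y n. x n \<oplus>\<^bsub>A n\<^esub> y n),
    smult = (\<lambda>c x n. c \<odot>\<^bsub>A n\<^esub> x n),
    adj = (\<lambda>x n. adj (A n) (x n)),
    nrm = (\<lambda>x. SUP n. nrm (A n) (x n))\<rparr>"

definition sum_ideal :: "(nat \<Rightarrow> 'a cstar) \<Rightarrow> (nat \<Rightarrow> 'a) set"
  where "sum_ideal A = {x \<in> carrier (cstar_product A). (\<lambda>n. nrm (A n) (x n)) \<longlonglongrightarrow> 0}"

text \<open>
  For a closed two-sided \<open>\<^sup>*\<close>-closed ideal \<open>I\<close> the unions below are single cosets, as in
  \<^const>\<open>rcoset_mult\<close>.
\<close>

definition cstar_quotient :: "'a cstar \<Rightarrow> 'a set \<Rightarrow> 'a set cstar"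
  where "cstar_quotient A I = \<lparr>
    carrier = carrier (A Quot I),
    monoid.mult = monoid.mult (A Quot I),
    one = \<one>\<^bsub>A Quot I\<^esub>,
    zero = \<zero>\<^bsub>A Quot I\<^esub>,
    add = add (A Quot I),
    smult = (\<lambda>c K. \<Union>x\<in>K. I +>\<^bsub>A\<^esub> (c \<odot>\<^bsub>A\<^esub> x)),
    adj = (\<lambda>K. \<Union>x\<in>K. I +>\<^bsub>A\<^esub> adj A x),
    nrm = (\<lambda>K. INF x\<in>K. nrm A x)\<rparr>"

definition reduced_product :: "(nat \<Rightarrow> 'a cstar) \<Rightarrow> (nat \<Rightarrow> 'a) set cstar"
  where "reduced_product A = cstar_quotient (cstar_product A) (sum_ideal A)"

definition quot_map :: "(nat \<Rightarrow> 'a cstar) \<Rightarrow> (nat \<Rightarrow> 'a) \<Rightarrow> (nat \<Rightarrow> 'a) set"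
  where "quot_map A x = sum_ideal A +>\<^bsub>cstar_product A\<^esub> x"


section \<open>Topologically trivial and asymptotically algebraic isomorphisms\<close>

definition strict_topology :: "(nat \<Rightarrow> 'a cstar) \<Rightarrow> (nat \<Rightarrow> 'a) topology"
  where "strict_topology A = (let P = cstar_product A in topology_generated_by
    ({{y \<in> carrier P. nrm P ((y \<ominus>\<^bsub>P\<^esub> x) \<otimes>\<^bsub>P\<^esub> a) < \<epsilon>} | x a \<epsilon>.
        x \<in> carrier P \<and> a \<in> sum_ideal A \<and> 0 < \<epsilon>} \<union>
     {{y \<in> carrier P. nrm P (a \<otimes>\<^bsub>P\<^esub> (y \<ominus>\<^bsub>P\<^esub> x)) < \<epsilon>} | x a \<epsilon>.
        x \<in> carrier P \<and> a \<in> sum_ideal A \<and> 0 < \<epsilon>}))"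

definition unit_ball :: "(nat \<Rightarrow> 'a cstar) \<Rightarrow> (nat \<Rightarrow> 'a) set"
  where "unit_ball A = {x \<in> carrier (cstar_product A). nrm (cstar_product A) x \<le> 1}"

definition borel_in :: "'a topology \<Rightarrow> 'a set \<Rightarrow> bool"
  where "borel_in T S \<longleftrightarrow> S \<in> sigma_sets (topspace T) {U. openin T U}"

definition topologically_trivial ::
    "(nat \<Rightarrow> 'a cstar) \<Rightarrow> (nat \<Rightarrow> 'b cstar) \<Rightarrow> ((nat \<Rightarrow> 'a) set \<Rightarrow> (nat \<Rightarrow> 'b) set) \<Rightarrow> bool"
  where "topologically_trivial A B \<Lambda> \<longleftrightarrow>
    borel_in
      (prod_topology (subtopology (strict_topology A) (unit_ball A))
                     (subtopology (strict_topology B) (unit_ball B)))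
      {(a, b). a \<in> unit_ball A \<and> b \<in> unit_ball B \<and> \<Lambda> (quot_map A a) = quot_map B b}"

text \<open>
  The conditions on \<open>\<Phi>\<close> determine it on the product.  That \<open>\<Phi>\<close> takes values in the product,
  i.e. in bounded sequences, is part of the notion; no condition is put on the single \<open>\<phi> n\<close>.
\<close>

definition asymptotically_algebraic ::
    "(nat \<Rightarrow> 'a cstar) \<Rightarrow> (nat \<Rightarrow> 'b cstar) \<Rightarrow> ((nat \<Rightarrow> 'a) set \<Rightarrow> (nat \<Rightarrow> 'b) set) \<Rightarrow> bool"
  where "asymptotically_algebraic A B \<Lambda> \<longleftrightarrow>
    (\<exists>F\<^sub>1 F\<^sub>2 g \<phi> \<Phi>.
      finite F\<^sub>1 \<and> finite F\<^sub>2 \<and> bij_betw g (UNIV - F\<^sub>1) (UNIV - F\<^sub>2) \<and>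
      (\<forall>n\<in>UNIV - F\<^sub>1. \<phi> n \<in> carrier (A n) \<rightarrow> carrier (B (g n))) \<and>
      \<Phi> \<in> carrier (cstar_product A) \<rightarrow> carrier (cstar_product B) \<and>
      (\<forall>x\<in>carrier (cstar_product A).
        (\<forall>n\<in>UNIV - F\<^sub>1. \<Phi> x (g n) = \<phi> n (x n)) \<and>
        (\<forall>m\<in>F\<^sub>2. \<Phi> x m = \<zero>\<^bsub>B m\<^esub>) \<and>
        quot_map B (\<Phi> x) = \<Lambda> (quot_map A x)))"

end

theory Submission
  imports Defs
begin

text \<open>
  Every element of the unit ball of a product agrees, modulo the ideal of null sequences, with a
  sequence chosen from countable dense sets.  Passing to codes turns the graph of the isomorphism
  into a Borel subset of the square of the Baire space \<open>\<nat>\<^sup>\<nat>\<close>, and such a set has a continuous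
  uniformization on a comeagre set \<open>D\<close>.  So the isomorphism has a lift each of whose coordinates
  depends, locally on \<open>D\<close>, on finitely many coordinates.

  Central projections of the reduced product lift to characteristic functions of sets, because an
  asymptotically central projection is eventually central.  If a coordinate of the lift on these
  reacted to changes on two disjoint sets infinitely often, then a fusion of sequences would yield
  disjoint sets with non-disjoint images; so every coordinate depends on a single coordinate, and
  this defines the almost bijection of the index sets.  A second fusion shows that, up to any
  \<open>\<epsilon>\<close> and on a suitable cylinder, the lift of elements is a function of the
  corresponding coordinate alone.  An arbitrary sequence is interleaved from two elements of \<open>D\<close>,
  which extends this from \<open>D\<close> to all sequences.

  The only boundedness of the isomorphism that is needed is that it carries a small ball into the
  unit ball; this holds since a selfadjoint contraction is the real part of a unitary.
\<close>

text \<open>A continuous selection is available on a comeagre set only, and such a set may miss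
  every sequence that one wants to evaluate. Hence the detours through pairs of generic points: a
  set of indices is read off from the difference of two of them, and patching a sequence from two of
  them is harmless once the lift at \<open>m\<close> consults the coordinate \<open>g m\<close>
  alone, for then \<open>m\<close> sees just one of the two pieces. Two codings are used: parities
  of natural numbers encode sets of indices and yield \<open>g\<close>; positions in dense sequences
  encode elements and yield the coordinate maps. Local determination alone is too weak for either,
  since the number of coordinates consulted varies with the point and with \<open>m\<close>; each
  fusion turns infinitely many local failures into one failure of an algebraic law of the
  isomorphism. The coordinate maps may be arbitrary functions, so arbitrary choices of codes can
  enter them. The precision of these choices has to grow with the index, which is why the cylinders
  for \<epsilon> = 1/(k+1) are nested and the one used at \<open>m\<close> depends on
  \<open>m\<close>.\<close>

section \<open>Comeagre sets\<close>

definition comeagre :: "'a::topological_space set \<Rightarrow> bool"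
  where "comeagre D \<longleftrightarrow> (\<exists>\<G>. countable \<G> \<and> (\<forall>G\<in>\<G>. open G \<and> closure G = UNIV) \<and> \<Inter>\<G> \<subseteq> D)"

lemma comeagre_mono: "comeagre D \<Longrightarrow> D \<subseteq> E \<Longrightarrow> comeagre E"
  unfolding comeagre_def by (meson subset_trans)

lemma comeagre_open_dense: "open G \<Longrightarrow> closure G = UNIV \<Longrightarrow> comeagre G"
  unfolding comeagre_def by (intro exI[of _ "{G}"]) auto

lemma comeagre_INT:
  assumes "countable I" and "\<And>i. i \<in> I \<Longrightarrow> comeagre (D i)"
  shows "comeagre (\<Inter>i\<in>I. D i)"
proof -
  have "\<forall>i\<in>I. \<exists>\<G>. countable \<G> \<and> (\<forall>G\<in>\<G>. open G \<and> closure G = UNIV) \<and> \<Inter>\<G> \<subseteq> D i"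
    using assms(2) by (simp add: comeagre_def)
  then obtain \<G> where \<G>: "\<forall>i\<in>I. countable (\<G> i) \<and>
      (\<forall>G\<in>\<G> i. open G \<and> closure G = UNIV) \<and> \<Inter>(\<G> i) \<subseteq> D i"
    by (rule bchoice[THEN exE])
  have "countable (\<Union>(\<G> ` I))" using assms(1) \<G> by (intro countable_UN) auto
  moreover have "\<Inter>(\<Union>(\<G> ` I)) \<subseteq> (\<Inter>i\<in>I. D i)"
  proof (rule INT_greatest)
    fix i assume "i \<in> I"
    then have "\<Inter>(\<Union>(\<G> ` I)) \<subseteq> \<Inter>(\<G> i)" by (intro Inter_anti_mono) auto
    then show "\<Inter>(\<Union>(\<G> ` I)) \<subseteq> D i" using \<G> \<open>i \<in> I\<close> by (meson subset_trans)
  qed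
  ultimately show ?thesis
    unfolding comeagre_def using \<G> by (intro exI[of _ "\<Union>(\<G> ` I)"]) auto
qed

lemma comeagre_Int: "comeagre D \<Longrightarrow> comeagre E \<Longrightarrow> comeagre (D \<inter> E)"
  using comeagre_INT[of "UNIV::bool set" "\<lambda>b. if b then D else E"]
  by (simp add: UNIV_bool Int_commute)

lemma comeagre_obtain:
  assumes "comeagre D"
  obtains U :: "nat \<Rightarrow> 'a::topological_space set"
  where "\<And>k. open (U k)" "\<And>k. closure (U k) = UNIV" "(\<Inter>k. U k) \<subseteq> D"
proof -
  obtain \<G> where \<G>: "countable \<G>" "\<And>G. G \<in> \<G> \<Longrightarrow> open G \<and> closure G = UNIV" "\<Inter>\<G> \<subseteq> D"
    using assms(1) unfolding comeagre_def by metis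
  \<comment> \<open>\<open>UNIV\<close> is inserted because \<open>range_from_nat_into\<close> asks
    for a nonempty set; the intersection stays the same.\<close>
  have "range (from_nat_into (insert UNIV \<G>)) = insert UNIV \<G>"
    using \<G>(1) by (intro range_from_nat_into) auto
  moreover have "\<Inter>(insert UNIV \<G>) \<subseteq> D" using \<G>(3) by simp
  moreover have "open G \<and> closure G = UNIV" if "G \<in> insert UNIV \<G>" for G
    using that \<G>(2) by auto
  ultimately show thesis using that[of "from_nat_into (insert UNIV \<G>)"] by (metis rangeI)
qed

lemma closure_UNIV_iff:
  "closure G = UNIV \<longleftrightarrow> (\<forall>W. open W \<and> W \<noteq> {} \<longrightarrow> W \<inter> G \<noteq> {})"
proof
  assume "closure G = UNIV"
  then show "\<forall>W. open W \<and> W \<noteq> {} \<longrightarrow> W \<inter> G \<noteq> {}"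
    by (metis inf_top_right open_Int_closure_eq_empty)
next
  assume "\<forall>W. open W \<and> W \<noteq> {} \<longrightarrow> W \<inter> G \<noteq> {}"
  then have "- closure G = {}"
    using closure_subset[of G] by (metis disjoint_eq_subset_Compl compl_mono open_Compl closed_closure)
  then show "closure G = UNIV" by blast
qed

section \<open>The open hull\<close>

text \<open>The interior of the set of points at which \<open>S\<close> is locally nonmeagre: the
  union collects the open sets in which \<open>S\<close> is meagre, and its complement is that set
  of points. Such a hull exists for every set, Borel or not, which matters for the projections
  below.\<close>

definition open_hull :: "'a::second_countable_topology set \<Rightarrow> 'a set"
  where "open_hull S = - closure (\<Union>{W. open W \<and> comeagre (- (S \<inter> W))})"

lemma open_open_hull: "open (open_hull S)"
  unfolding open_hull_def by (intro open_Compl closed_closure)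

text \<open>This is the Banach category theorem for a second countable space:
  \<open>Lindelof\<close> leaves countably many of the open sets in which \<open>S\<close> is
  meagre, and what remains between their union and its closure is a frontier, hence nowhere
  dense.\<close>

lemma comeagre_open_hull: "comeagre (- (S - open_hull S))"
proof -
  define \<W> where "\<W> = {W. open W \<and> comeagre (- (S \<inter> W))}"
  define V where "V = \<Union>\<W>"
  obtain \<B> where \<B>: "\<B> \<subseteq> \<W>" "countable \<B>" "\<Union>\<B> = V"
    using Lindelof[of \<W>] unfolding \<W>_def V_def by auto
  have "open V" unfolding V_def \<W>_def by (intro open_Union) auto
  then have fr: "frontier V = closure V - V" by (simp add: frontier_def interior_open)
  have "comeagre (\<Inter>W\<in>\<B>. - (S \<inter> W))"
    using \<B>(1,2) unfolding \<W>_def by (intro comeagre_INT) auto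
  moreover have "comeagre (- frontier V)"
  proof (rule comeagre_open_dense)
    show "open (- frontier V)" by (intro open_Compl frontier_closed)
    have sub: "interior (frontier V) \<subseteq> closure V - V"
      using interior_subset fr by metis
    then have "interior (frontier V) \<inter> V = {}" by blast
    then have "interior (frontier V) \<inter> closure V = {}"
      by (simp add: open_Int_closure_eq_empty)
    then have "interior (frontier V) = {}" using sub by blast
    then show "closure (- frontier V) = UNIV"
      by (simp only: closure_complement Compl_empty_eq)
  qed
  ultimately have "comeagre ((\<Inter>W\<in>\<B>. - (S \<inter> W)) \<inter> - frontier V)" by (rule comeagre_Int)
  then show ?thesis
  proof (rule comeagre_mono)
    have "open_hull S = - closure V" by (simp add: open_hull_def V_def \<W>_def)
    moreover have "(\<Inter>W\<in>\<B>. - (S \<inter> W)) = - (S \<inter> V)" unfolding \<B>(3)[symmetric] by auto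
    ultimately show "(\<Inter>W\<in>\<B>. - (S \<inter> W)) \<inter> - frontier V \<subseteq> - (S - open_hull S)"
      using \<B>(3) unfolding fr by auto
  qed
qed

lemma open_hull_nonmeagre:
  assumes "open W" "comeagre (- (S \<inter> W))"
  shows "W \<inter> open_hull S = {}"
proof -
  have "W \<subseteq> \<Union>{W. open W \<and> comeagre (- (S \<inter> W))}"
    using assms by (intro Union_upper) simp
  also have "\<dots> \<subseteq> closure \<dots>" by (rule closure_subset)
  finally show ?thesis unfolding open_hull_def by (simp only: disjoint_eq_subset_Compl double_compl)
qed

section \<open>Uniformization on a comeagre set\<close>

text \<open>A stem is a total function of which only the first \<open>n\<close> values count; any
  point of a cylinder can then serve as its stem.\<close>

definition cyl :: "nat \<Rightarrow> (nat \<Rightarrow> 'a) \<Rightarrow> (nat \<Rightarrow> 'a) set"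
  where "cyl n s = {x. \<forall>i<n. x i = s i}"

lemma mem_cyl [simp]: "x \<in> cyl n s \<longleftrightarrow> (\<forall>i<n. x i = s i)"
  by (simp add: cyl_def)

lemma open_cyl [simp, intro]: "open (cyl n (s :: nat \<Rightarrow> nat))"
proof -
  have "cyl n s = (\<Inter>i<n. (\<lambda>x. x i) -` {s i})" by auto
  also have "open \<dots>"
    by (intro open_INT ballI open_vimage open_discrete continuous_on_product_coordinates) simp
  finally show ?thesis .
qed

lemma open_contains_cyl:
  fixes x :: "nat \<Rightarrow> nat"
  assumes "open U" "x \<in> U"
  obtains n where "cyl n x \<subseteq> U"
proof -
  obtain \<xi> where \<xi>: "x \<in> (\<Pi>\<^sub>E i\<in>UNIV. \<xi> i)" "finite {i. \<xi> i \<noteq> topspace (euclidean :: nat topology)}"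
      "(\<Pi>\<^sub>E i\<in>UNIV. \<xi> i) \<subseteq> U"
    using product_topology_open_contains_basis[of "\<lambda>_. euclidean" UNIV U x] assms
    by (auto simp: open_fun_def)
  obtain n where n: "\<And>i. \<xi> i \<noteq> UNIV \<Longrightarrow> i < n"
    using finite_nat_set_iff_bounded[of "{i. \<xi> i \<noteq> UNIV}"] \<xi>(2) by auto
  have "y \<in> (\<Pi>\<^sub>E i\<in>UNIV. \<xi> i)" if "y \<in> cyl n x" for y
  proof -
    have "y i \<in> \<xi> i" for i
      using that \<xi>(1) n[of i] by (cases "\<xi> i = UNIV") (auto simp: PiE_iff)
    then show ?thesis by auto
  qed
  then have "cyl n x \<subseteq> U" using \<xi>(3) by blast
  then show thesis by (rule that)
qed

lemma open_iff_cyl: "open (U :: (nat \<Rightarrow> nat) set) \<longleftrightarrow> (\<forall>x\<in>U. \<exists>n. cyl n x \<subseteq> U)"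
proof
  show "open U \<Longrightarrow> \<forall>x\<in>U. \<exists>n. cyl n x \<subseteq> U" by (meson open_contains_cyl)
next
  assume *: "\<forall>x\<in>U. \<exists>n. cyl n x \<subseteq> U"
  show "open U"
  proof (subst open_subopen, intro ballI)
    fix x assume "x \<in> U"
    then obtain n where "cyl n x \<subseteq> U" using * by blast
    then show "\<exists>T. open T \<and> x \<in> T \<and> T \<subseteq> U" by (intro exI[of _ "cyl n x"]) auto
  qed
qed

lemma cyl_anti_mono: "m \<le> n \<Longrightarrow> cyl n x \<subseteq> cyl m x"
  by auto

lemma open_contains_cyl_Times:
  fixes p :: "(nat \<Rightarrow> nat) \<times> (nat \<Rightarrow> nat)"
  assumes "open U" "p \<in> U"
  obtains n where "cyl n (fst p) \<times> cyl n (snd p) \<subseteq> U"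
proof -
  obtain S T where ST: "open S" "open T" "p \<in> S \<times> T" "S \<times> T \<subseteq> U"
    using assms by (elim open_prod_elim)
  obtain m where m: "cyl m (fst p) \<subseteq> S" using ST(1,3) by (metis open_contains_cyl mem_Times_iff)
  obtain n where n: "cyl n (snd p) \<subseteq> T" using ST(2,3) by (metis open_contains_cyl mem_Times_iff)
  have "cyl (max m n) (fst p) \<subseteq> S" "cyl (max m n) (snd p) \<subseteq> T"
    using m n cyl_anti_mono[of m "max m n"] cyl_anti_mono[of n "max m n"] by (meson max.cobounded1 max.cobounded2 subset_trans)+
  then have "cyl (max m n) (fst p) \<times> cyl (max m n) (snd p) \<subseteq> U"
    using ST(4) by blast
  then show thesis by (rule that)
qed

section \<open>Fusion and the Baire category theorem\<close>

text \<open>The points \<open>\<xi> j\<close> are built simultaneously. \<open>Q\<close> is an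
  invariant of the approximations and \<open>P k\<close> is what the \<open>k\<close>-th step has to
  achieve. Since the lengths increase strictly, the nested stems converge, and whatever
  \<open>P\<close> says about all points of a cylinder survives in the limit.\<close>

theorem fusion:
  fixes x0 :: "'j \<Rightarrow> nat \<Rightarrow> 'a"
  assumes init: "Q n0 x0"
    and step: "\<And>k n x. Q n x \<Longrightarrow>
      \<exists>n' x'. n < n' \<and> (\<forall>j. x' j \<in> cyl n (x j)) \<and> Q n' x' \<and> P k n n' x'"
  obtains \<xi> ns xs where "ns 0 = n0" "xs 0 = x0" "strict_mono ns"
    "\<And>k j. \<xi> j \<in> cyl (ns k) (xs k j)" "\<And>k. P k (ns k) (ns (Suc k)) (xs (Suc k))"
    "\<And>k. Q (ns k) (xs k)"
proof -
  have "\<exists>f. \<forall>k. (Q (fst (f k)) (snd (f k)) \<and> (k = 0 \<longrightarrow> f k = (n0, x0))) \<and>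
    (fst (f k) < fst (f (Suc k)) \<and> (\<forall>j. snd (f (Suc k)) j \<in> cyl (fst (f k)) (snd (f k) j)) \<and>
      P k (fst (f k)) (fst (f (Suc k))) (snd (f (Suc k))))"
  proof (rule dependent_nat_choice)
    show "\<exists>s. Q (fst s) (snd s) \<and> (0 = 0 \<longrightarrow> s = (n0, x0))" using init by auto
  next
    fix s :: "nat \<times> ('j \<Rightarrow> nat \<Rightarrow> 'a)" and k :: nat
    assume "Q (fst s) (snd s) \<and> (k = 0 \<longrightarrow> s = (n0, x0))"
    then have "Q (fst s) (snd s)" ..
    from step[OF this, of k]
    show "\<exists>t. (Q (fst t) (snd t) \<and> (Suc k = 0 \<longrightarrow> t = (n0, x0))) \<and>
      (fst s < fst t \<and> (\<forall>j. snd t j \<in> cyl (fst s) (snd s j)) \<and> P k (fst s) (fst t) (snd t))"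
      by auto
  qed
  then obtain f where f: "\<And>k. Q (fst (f k)) (snd (f k))" "f 0 = (n0, x0)"
    "\<And>k. fst (f k) < fst (f (Suc k))"
    "\<And>k j. snd (f (Suc k)) j \<in> cyl (fst (f k)) (snd (f k) j)"
    "\<And>k. P k (fst (f k)) (fst (f (Suc k))) (snd (f (Suc k)))" by metis
  define ns xs where "ns k = fst (f k)" and "xs k = snd (f k)" for k
  have mono: "strict_mono ns" unfolding ns_def strict_mono_Suc_iff using f(3) by blast
  have chain: "xs (k + l) j \<in> cyl (ns k) (xs k j)" for k l j
  proof (induction l)
    case 0
    show ?case by simp
  next
    case (Suc l)
    have "ns k \<le> ns (k + l)" using mono by (simp add: strict_mono_less_eq)
    then show ?case using Suc f(4)[of "k + l" j] by (simp add: ns_def xs_def)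
  qed
  \<comment> \<open>Stage \<open>Suc i\<close> has decided coordinate \<open>i\<close>, because
    \<open>Suc i \<le> ns (Suc i)\<close>.\<close>
  define \<xi> where "\<xi> j i = xs (Suc i) j i" for j i
  have "\<xi> j \<in> cyl (ns k) (xs k j)" for k j
  proof -
    have "\<xi> j i = xs k j i" if "i < ns k" for i
    proof (cases "k \<le> Suc i")
      case True
      then show ?thesis using chain[where k = k and l = "Suc i - k" and j = j] that by (simp add: \<xi>_def)
    next
      case False
      have "Suc i \<le> ns (Suc i)" by (rule strict_mono_imp_increasing[OF mono])
      then show ?thesis
        using chain[where k = "Suc i" and l = "k - Suc i" and j = j] False by (simp add: \<xi>_def)
    qed
    then show ?thesis by simp
  qed
  then show thesis using that[of ns xs \<xi>] f mono by (simp add: ns_def xs_def)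
qed

lemma dense_meets_cyl:
  fixes x :: "nat \<Rightarrow> nat"
  assumes "open U" "closure U = UNIV"
  obtains n' x' where "n < n'" "x' \<in> cyl n x" "cyl n' x' \<subseteq> U"
proof -
  have "x \<in> cyl n x" by simp
  then have "cyl n x \<inter> U \<noteq> {}" using assms(2) open_cyl unfolding closure_UNIV_iff by blast
  then obtain x' where x': "x' \<in> cyl n x" "x' \<in> U" by blast
  obtain m where "cyl m x' \<subseteq> U" using open_contains_cyl[OF assms(1) x'(2)] by metis
  then have "cyl (max m (Suc n)) x' \<subseteq> U" using cyl_anti_mono[of m "max m (Suc n)" x'] by simp
  then show thesis using that[of "max m (Suc n)" x'] x'(1) by simp
qed

text \<open>The Baire category theorem for the Baire space, as a fusion of one point whose
  \<open>k\<close>-th step enters \<open>U k\<close>.\<close>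

lemma comeagre_meets_cyl:
  fixes D :: "(nat \<Rightarrow> nat) set"
  assumes "comeagre D"
  obtains y where "y \<in> D" "y \<in> cyl n x"
proof -
  obtain U where U: "\<And>k. open (U k)" "\<And>k. closure (U k) = UNIV" "(\<Inter>k::nat. U k) \<subseteq> D"
    using comeagre_obtain[OF assms] by metis
  have step: "\<exists>n' z'. n < n' \<and> (\<forall>j. z' j \<in> cyl n (z j)) \<and> True \<and> cyl n' (z' ()) \<subseteq> U k"
    for k n and z :: "unit \<Rightarrow> nat \<Rightarrow> nat"
  proof -
    obtain n' x' where "n < n'" "x' \<in> cyl n (z ())" "cyl n' x' \<subseteq> U k"
      using dense_meets_cyl[OF U(1,2)] by metis
    then show ?thesis by (intro exI[of _ n'] exI[of _ "\<lambda>_. x'"]) simp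
  qed
  obtain \<xi> ns xs where \<xi>: "ns 0 = n" "xs 0 = (\<lambda>_::unit. x)"
    "\<And>k j. \<xi> j \<in> cyl (ns k) (xs k j)" "\<And>k. cyl (ns (Suc k)) (xs (Suc k) ()) \<subseteq> U k"
    using fusion[of "\<lambda>_ _. True" n "\<lambda>_::unit. x" "\<lambda>k n n' z'. cyl n' (z' ()) \<subseteq> U k", OF _ step]
    by metis
  have "\<xi> () \<in> U k" for k using \<xi>(3)[of "()" "Suc k"] \<xi>(4)[of k] by blast
  then have "\<xi> () \<in> D" using U(3) by blast
  moreover have "\<xi> () \<in> cyl n x" using \<xi>(3)[of "()" 0] \<xi>(1,2) by simp
  ultimately show thesis by (rule that)
qed

lemma comeagre_meets_open:
  fixes D W :: "(nat \<Rightarrow> nat) set"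
  assumes "comeagre D" "open W" "W \<noteq> {}"
  shows "D \<inter> W \<noteq> {}"
proof -
  obtain x where "x \<in> W" using assms(3) by blast
  then obtain n where "cyl n x \<subseteq> W" using open_contains_cyl[OF assms(2)] by metis
  then show ?thesis using comeagre_meets_cyl[OF assms(1)] by (metis disjoint_iff subsetD)
qed

lemma open_hull_UNIV: "open_hull (UNIV :: (nat \<Rightarrow> nat) set) = UNIV"
proof -
  have "W = {}" if "open W" "comeagre (- W)" for W :: "(nat \<Rightarrow> nat) set"
    using comeagre_meets_open[of "- W" W] that by auto
  then have "{W :: (nat \<Rightarrow> nat) set. open W \<and> comeagre (- (UNIV \<inter> W))} \<subseteq> {{}}" by auto
  then have "\<Union>{W :: (nat \<Rightarrow> nat) set. open W \<and> comeagre (- (UNIV \<inter> W))} = {}"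
    by (metis (no_types, lifting) Union_empty_conv singletonD subsetD)
  then show ?thesis unfolding open_hull_def by (simp only: closure_empty Compl_empty_eq)
qed

text \<open>Continuity of \<open>f\<close> on \<open>D\<close>, where each coordinate of \<open>f\<close> takes values in a discrete space.\<close>

definition locally_determined :: "(nat \<Rightarrow> nat) set \<Rightarrow> ((nat \<Rightarrow> nat) \<Rightarrow> nat \<Rightarrow> 'b) \<Rightarrow> bool"
  where "locally_determined D f \<longleftrightarrow>
    (\<forall>x\<in>D. \<forall>m. \<exists>n. \<forall>y\<in>D. y \<in> cyl n x \<longrightarrow> f y m = f x m)"

text \<open>
  The set \<open>A s\<close> of points with a witness extending the word \<open>s\<close> is replaced by its open hull.  On a
  comeagre set membership in all these hulls is locally constant, and the least branch through
  them is defined and depends continuously on the point.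
\<close>

theorem closed_uniformization:
  fixes C :: "((nat \<Rightarrow> nat) \<times> (nat \<Rightarrow> nat)) set"
  assumes "closed C" and total: "\<And>x. \<exists>w. (x, w) \<in> C"
  obtains D f where "comeagre D" "\<And>x. x \<in> D \<Longrightarrow> (x, f x) \<in> C" "locally_determined D f"
proof -
  define A where "A s = {x. \<exists>w. (x, w) \<in> C \<and> (\<forall>i<length s. w i = s ! i)}" for s
  define V where "V s = open_hull (A s)" for s
  \<comment> \<open>Left out are the frontier of \<open>V s\<close>, so that membership in
    \<open>V s\<close> is locally constant on \<open>G s\<close>, and the points of
    \<open>V s\<close> at which no one-letter extension of \<open>s\<close> goes on, so that
    branches never stop.\<close>
  define G where "G s = - closure (V s) \<union> (V s \<inter> (\<Union>n. V (s @ [n])))" for s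
  define D where "D = (\<Inter>s. G s)"
  have oV: "open (V s)" for s by (simp add: V_def open_open_hull)
  have A_split: "A s = (\<Union>n. A (s @ [n]))" for s
  proof (intro Set.set_eqI iffI)
    fix x assume "x \<in> A s"
    then obtain w where w: "(x, w) \<in> C" "\<forall>i<length s. w i = s ! i" by (auto simp: A_def)
    then have "\<forall>i<length (s @ [w (length s)]). w i = (s @ [w (length s)]) ! i"
      by (simp add: nth_append less_Suc_eq)
    then show "x \<in> (\<Union>n. A (s @ [n]))" using w(1) unfolding A_def by blast
  next
    fix x assume "x \<in> (\<Union>n. A (s @ [n]))"
    then obtain n w where w: "(x, w) \<in> C" "\<forall>i<length (s @ [n]). w i = (s @ [n]) ! i"
      unfolding A_def by blast
    have "\<forall>i<length s. w i = s ! i" using w(2) by (auto simp: nth_append split: if_splits)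
    then show "x \<in> A s" using w(1) unfolding A_def by blast
  qed
  have oG: "open (G s)" for s
    unfolding G_def using oV by (intro open_Un open_Compl closed_closure open_Int open_UN) auto
  \<comment> \<open>A nonempty open \<open>W\<close> missed by \<open>G s\<close> would meet
    \<open>V s\<close>, but \<open>W \<inter> V s\<close> would meet none of the
    \<open>V (s @ [n])\<close>. There \<open>A s\<close> is covered by the meagre sets
    \<open>A (s @ [n]) - V (s @ [n])\<close>, whereas the hull \<open>V s\<close> contains no
    nonempty open set in which \<open>A s\<close> is meagre.\<close>
  have dG: "closure (G s) = UNIV" for s
    unfolding closure_UNIV_iff
  proof (intro allI impI notI)
    fix W assume W: "open W \<and> W \<noteq> {}" and "W \<inter> G s = {}"
    then have sub: "W \<subseteq> closure (V s)" and dis: "W \<inter> V s \<inter> (\<Union>n. V (s @ [n])) = {}"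
      unfolding G_def by auto
    have ne: "W \<inter> V s \<noteq> {}"
      using W sub open_Int_closure_eq_empty[of W "V s"] by (simp add: inf.absorb1)
    have "comeagre (\<Inter>n. - (A (s @ [n]) - V (s @ [n])))"
      unfolding V_def by (intro comeagre_INT comeagre_open_hull) auto
    then have "comeagre (- (A s \<inter> (W \<inter> V s)))"
      by (rule comeagre_mono) (use dis in \<open>auto simp: A_split[of s]\<close>)
    then have "(W \<inter> V s) \<inter> open_hull (A s) = {}"
      using W oV by (intro open_hull_nonmeagre) auto
    then show False using ne by (simp add: V_def)
  qed
  have cD: "comeagre D"
    unfolding D_def by (intro comeagre_INT comeagre_open_dense oG dG) auto
  have V_Nil: "V [] = UNIV"
  proof -
    have "A [] = UNIV" using total by (auto simp: A_def)
    then show ?thesis by (simp add: V_def open_hull_UNIV)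
  qed
  define b where "b x = rec_nat [] (\<lambda>_ s. s @ [LEAST n. x \<in> V (s @ [n])])" for x
  define f where "f x k = (LEAST n. x \<in> V (b x k @ [n]))" for x k
  have b0: "b x 0 = []" and bS: "b x (Suc k) = b x k @ [f x k]" for x k
    by (simp_all add: b_def f_def)
  have b_map: "b x k = map (f x) [0..<k]" for x k
    by (induction k) (simp_all add: b0 bS)
  have inV: "x \<in> V (b x k)" if "x \<in> D" for x k
  proof (induction k)
    case 0
    show ?case by (simp add: b0 V_Nil)
  next
    case (Suc k)
    have "x \<in> G (b x k)" using that by (simp add: D_def)
    then have "\<exists>n. x \<in> V (b x k @ [n])"
      using Suc closure_subset[of "V (b x k)"] unfolding G_def by auto
    then show ?case unfolding bS f_def by (rule LeastI_ex)
  qed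
  have stable: "\<exists>n. \<forall>y\<in>D. y \<in> cyl n x \<longrightarrow> (y \<in> V s \<longleftrightarrow> x \<in> V s)" if "x \<in> D" for x s
  proof (cases "x \<in> V s")
    case True
    then obtain n where "cyl n x \<subseteq> V s" using open_contains_cyl[OF oV] by metis
    then show ?thesis using True by blast
  next
    case False
    then have "x \<in> - closure (V s)" using that by (auto simp: D_def G_def)
    then obtain n where "cyl n x \<subseteq> - closure (V s)"
      using open_contains_cyl[of "- closure (V s)" x] by auto
    then show ?thesis using False closure_subset[of "V s"] by blast
  qed
  have loc_b: "\<exists>n. \<forall>y\<in>D. y \<in> cyl n x \<longrightarrow> b y k = b x k" if x: "x \<in> D" for x k
  proof (induction k)
    case 0
    show ?case by (simp add: b0)
  next
    case (Suc k)
    then obtain n where n: "\<And>y. y \<in> D \<Longrightarrow> y \<in> cyl n x \<Longrightarrow> b y k = b x k" by blast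
    have "\<forall>j. \<exists>n. \<forall>y\<in>D. y \<in> cyl n x \<longrightarrow> (y \<in> V (b x k @ [j]) \<longleftrightarrow> x \<in> V (b x k @ [j]))"
      using stable[OF x] by blast
    then obtain N where N: "\<And>j y. y \<in> D \<Longrightarrow> y \<in> cyl (N j) x \<Longrightarrow>
        (y \<in> V (b x k @ [j]) \<longleftrightarrow> x \<in> V (b x k @ [j]))"
      by metis
    \<comment> \<open>Only the nodes up to \<open>f x k\<close> are consulted to see that
      \<open>f x k\<close> is the least value, so finitely many of the radii \<open>N j\<close>
      suffice.\<close>
    define M where "M = Max (insert n (N ` {..f x k}))"
    have Mn: "n \<le> M" and MN: "j \<le> f x k \<Longrightarrow> N j \<le> M" for j
      unfolding M_def by (intro Max_ge; simp)+
    have "b y (Suc k) = b x (Suc k)" if y: "y \<in> D" "y \<in> cyl M x" for y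
    proof -
      have byk: "b y k = b x k" using n y cyl_anti_mono[OF Mn] by blast
      have eq: "y \<in> V (b x k @ [j]) \<longleftrightarrow> x \<in> V (b x k @ [j])" if "j \<le> f x k" for j
        using N y cyl_anti_mono[OF MN[OF that]] by blast
      have "x \<in> V (b x k @ [f x k])" using inV[OF x, of "Suc k"] by (simp add: bS)
      then have "f y k = f x k"
        unfolding f_def[of y] byk using eq
        by (intro Least_equality) (auto, metis f_def linorder_le_cases not_less_Least order.order_iff_strict)
      then show ?thesis by (simp add: bS byk)
    qed
    then show ?case by blast
  qed
  have "locally_determined D f"
    unfolding locally_determined_def
  proof (intro ballI allI)
    fix x m assume "x \<in> D"
    then obtain n where n: "\<And>y. y \<in> D \<Longrightarrow> y \<in> cyl n x \<Longrightarrow> b y (Suc m) = b x (Suc m)"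
      using loc_b[of x "Suc m"] by blast
    have "f y m = f x m" if "y \<in> D" "y \<in> cyl n x" for y
      using n[OF that] by (simp add: bS)
    then show "\<exists>n. \<forall>y\<in>D. y \<in> cyl n x \<longrightarrow> f y m = f x m" by blast
  qed
  moreover have "(x, f x) \<in> C" if x: "x \<in> D" for x
  proof (rule ccontr)
    assume "(x, f x) \<notin> C"
    then obtain n where n: "cyl n x \<times> cyl n (f x) \<subseteq> - C"
      using open_contains_cyl_Times[of "- C" "(x, f x)"] \<open>closed C\<close> by auto
    have "comeagre UNIV" using comeagre_open_dense[of UNIV] by simp
    \<comment> \<open>Otherwise \<open>A (b x n)\<close> would be meagre, even empty, in
      \<open>cyl n x\<close>, and \<open>x\<close> would not lie in the hull
      \<open>V (b x n)\<close>. A point near \<open>x\<close> with a witness near \<open>f x\<close>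
      then contradicts the choice of \<open>n\<close>.\<close>
    then have "A (b x n) \<inter> cyl n x \<noteq> {}"
      using open_hull_nonmeagre[OF open_cyl, of "A (b x n)" n x] inV[OF x, of n]
      unfolding V_def by force
    then obtain x' w where "(x', w) \<in> C" "x' \<in> cyl n x" "\<forall>i<length (b x n). w i = b x n ! i"
      unfolding A_def by blast
    moreover from this have "w \<in> cyl n (f x)" by (simp add: b_map)
    ultimately show False using n by blast
  qed
  ultimately show thesis using that cD by blast
qed

section \<open>Borel sets are projections of closed sets\<close>

definition analytic :: "'a::topological_space set \<Rightarrow> bool"
  where "analytic Q \<longleftrightarrow> (\<exists>C :: ('a \<times> (nat \<Rightarrow> nat)) set. closed C \<and> Q = {p. \<exists>z. (p, z) \<in> C})"

lemma continuous_on_snd_coordinate: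
  "continuous_on UNIV (\<lambda>q :: 'a::topological_space \<times> (nat \<Rightarrow> nat). snd q k)"
  by (rule continuous_on_product_then_coordinatewise[OF continuous_on_snd[OF continuous_on_id]])

lemma closed_imp_analytic:
  assumes "closed Q"
  shows "analytic Q"
  unfolding analytic_def using closed_Times[OF assms closed_UNIV]
  by (intro exI[of _ "Q \<times> UNIV"]) auto

text \<open>Coordinate \<open>0\<close> of the witness names the set, and the remaining coordinates
  form a witness for it.\<close>

lemma analytic_UN:
  assumes "\<And>n::nat. analytic (Q n)"
  shows "analytic (\<Union>n. Q n)"
proof -
  obtain C where C: "\<And>n. closed (C n)" "\<And>n. Q n = {p. \<exists>z :: nat \<Rightarrow> nat. (p, z) \<in> C n}"
    using assms unfolding analytic_def by metis
  define E where "E = (\<Inter>n. {q. snd q 0 \<noteq> n} \<union> (\<lambda>q. (fst q, \<lambda>k. snd q (Suc k))) -` C n)"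
  have "closed {q :: 'a \<times> (nat \<Rightarrow> nat). snd q 0 \<noteq> n}" for n
  proof -
    have "{q :: 'a \<times> (nat \<Rightarrow> nat). snd q 0 \<noteq> n} = (\<lambda>q. snd q 0) -` (- {n})" by auto
    also have "closed \<dots>"
      by (intro closed_vimage closed_Compl open_discrete continuous_on_snd_coordinate)
    finally show ?thesis .
  qed
  moreover have "closed ((\<lambda>q. (fst q, \<lambda>k. snd q (Suc k))) -` C n)" for n
    by (intro closed_vimage C(1) continuous_on_Pair continuous_on_fst continuous_on_id
        continuous_on_coordinatewise_then_product continuous_on_snd_coordinate)
  ultimately have "closed E" unfolding E_def by (intro closed_INT ballI closed_Un) auto
  moreover have E: "(p, z) \<in> E \<longleftrightarrow> (p, \<lambda>k. z (Suc k)) \<in> C (z 0)" for p z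
    by (auto simp: E_def)
  have "(\<Union>n. Q n) = {p. \<exists>z. (p, z) \<in> E}"
  proof (intro Set.set_eqI iffI)
    fix p assume "p \<in> (\<Union>n. Q n)"
    then obtain n z where z: "(p, z) \<in> C n" by (auto simp: C(2))
    have "(p, case_nat n z) \<in> E" unfolding E using z by simp
    then show "p \<in> {p. \<exists>z. (p, z) \<in> E}" by auto
  next
    fix p assume "p \<in> {p. \<exists>z. (p, z) \<in> E}"
    then obtain z where "(p, \<lambda>k. z (Suc k)) \<in> C (z 0)" by (auto simp: E)
    then have "p \<in> Q (z 0)" unfolding C(2) by auto
    then show "p \<in> (\<Union>n. Q n)" by auto
  qed
  ultimately show ?thesis unfolding analytic_def by metis
qed

text \<open>A single witness stores one witness for each \<open>n\<close> along the pairing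
  function.\<close>

lemma analytic_INT:
  assumes "\<And>n::nat. analytic (Q n)"
  shows "analytic (\<Inter>n. Q n)"
proof -
  obtain C where C: "\<And>n. closed (C n)" "\<And>n. Q n = {p. \<exists>z :: nat \<Rightarrow> nat. (p, z) \<in> C n}"
    using assms unfolding analytic_def by metis
  define E where "E = (\<Inter>n. (\<lambda>q. (fst q, \<lambda>k. snd q (prod_encode (n, k)))) -` C n)"
  have "closed E" unfolding E_def
    by (intro closed_INT ballI closed_vimage C(1) continuous_on_Pair continuous_on_fst continuous_on_id
        continuous_on_coordinatewise_then_product continuous_on_snd_coordinate)
  moreover have E: "(p, z) \<in> E \<longleftrightarrow> (\<forall>n. (p, \<lambda>k. z (prod_encode (n, k))) \<in> C n)" for p z
    by (auto simp: E_def)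
  have "(\<Inter>n. Q n) = {p. \<exists>z. (p, z) \<in> E}"
  proof (intro Set.set_eqI iffI)
    fix p assume "p \<in> (\<Inter>n. Q n)"
    then have "\<forall>n. \<exists>z. (p, z) \<in> C n" by (auto simp: C(2))
    then obtain z where z: "\<And>n. (p, z n) \<in> C n" by metis
    have "(p, \<lambda>j. z (fst (prod_decode j)) (snd (prod_decode j))) \<in> E" unfolding E using z by simp
    then show "p \<in> {p. \<exists>z. (p, z) \<in> E}" by auto
  next
    fix p assume "p \<in> {p. \<exists>z. (p, z) \<in> E}"
    then obtain z where "\<And>n. (p, \<lambda>k. z (prod_encode (n, k))) \<in> C n" by (auto simp: E)
    then have "p \<in> Q n" for n unfolding C(2) by auto
    then show "p \<in> (\<Inter>n. Q n)" by auto
  qed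
  ultimately show ?thesis unfolding analytic_def by metis
qed

text \<open>Membership in \<open>K n\<close> depends on the first \<open>n\<close> coordinates only,
  so \<open>K n\<close> is closed, and \<open>Q\<close> is the countable union of the
  \<open>K n\<close>.\<close>

lemma open_imp_analytic:
  fixes Q :: "((nat \<Rightarrow> nat) \<times> (nat \<Rightarrow> nat)) set"
  assumes "open Q"
  shows "analytic Q"
proof -
  define K where "K n = {p. cyl n (fst p) \<times> cyl n (snd p) \<subseteq> Q}" for n
  have "closed (K n)" for n
  proof -
    have "open (- K n)"
    proof (subst open_subopen, intro ballI)
      fix p assume p: "p \<in> - K n"
      let ?T = "cyl n (fst p) \<times> cyl n (snd p)"
      have eq: "cyl n (fst q) = cyl n (fst p) \<and> cyl n (snd q) = cyl n (snd p)" if "q \<in> ?T" for q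
        using that by (auto simp: cyl_def mem_Times_iff)
      have "q \<in> - K n" if "q \<in> ?T" for q
        using p eq[OF that] by (simp add: K_def)
      then have "?T \<subseteq> - K n" by (rule subsetI)
      moreover have "p \<in> ?T" by (simp add: mem_Times_iff)
      ultimately show "\<exists>T. open T \<and> p \<in> T \<and> T \<subseteq> - K n"
        using open_Times[OF open_cyl open_cyl] by metis
    qed
    then show ?thesis by (simp add: closed_def)
  qed
  then have "analytic (\<Union>n. K n)" by (intro analytic_UN closed_imp_analytic)
  moreover have "(\<Union>n. K n) = Q"
  proof
    show "(\<Union>n. K n) \<subseteq> Q" by (auto simp: K_def)
    show "Q \<subseteq> (\<Union>n. K n)"
    proof
      fix p assume "p \<in> Q"
      then obtain n where "cyl n (fst p) \<times> cyl n (snd p) \<subseteq> Q"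
        using open_contains_cyl_Times[OF assms] by metis
      then show "p \<in> (\<Union>n. K n)" by (auto simp: K_def)
    qed
  qed
  ultimately show ?thesis by simp
qed

text \<open>The induction carries \<open>Q\<close> and \<open>- Q\<close> together, since
  analyticity does not pass to complements.\<close>

lemma borel_imp_analytic:
  fixes Q :: "((nat \<Rightarrow> nat) \<times> (nat \<Rightarrow> nat)) set"
  assumes "Q \<in> sigma_sets UNIV {U. open U}"
  shows "analytic Q"
proof -
  from assms have "analytic Q \<and> analytic (- Q)"
  proof induction
    case (Basic a)
    then show ?case by (auto intro: open_imp_analytic closed_imp_analytic)
  next
    case Empty
    show ?case by (auto intro: closed_imp_analytic)
  next
    case (Compl a)
    then show ?case by (simp add: Compl_eq_Diff_UNIV[symmetric])
  next
    case (Union a)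
    then show ?case by (simp add: analytic_UN analytic_INT)
  qed
  then show ?thesis ..
qed

text \<open>\<open>Q\<close> is the projection of a closed set \<open>C\<close>. The second
  coordinate and the witness are merged by pairing into one sequence \<open>w\<close>, so that
  uniformizing a closed set suffices; forgetting the witness keeps local determination.\<close>

theorem borel_uniformization:
  fixes Q :: "((nat \<Rightarrow> nat) \<times> (nat \<Rightarrow> nat)) set"
  assumes "Q \<in> sigma_sets UNIV {U. open U}" and total: "\<And>x. \<exists>y. (x, y) \<in> Q"
  shows "\<exists>D f. comeagre D \<and> locally_determined D f \<and> (\<forall>x\<in>D. (x, f x) \<in> Q)"
proof -
  obtain C :: "(((nat \<Rightarrow> nat) \<times> (nat \<Rightarrow> nat)) \<times> (nat \<Rightarrow> nat)) set"
    where C: "closed C" "Q = {p. \<exists>z. (p, z) \<in> C}"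
    using borel_imp_analytic[OF assms(1)] unfolding analytic_def by blast
  define l r where "l w k = fst (prod_decode (w k))" and "r w k = snd (prod_decode (w k))"
    for w :: "nat \<Rightarrow> nat" and k
  define E where "E = (\<lambda>q. ((fst q, l (snd q)), r (snd q))) -` C"
  have cont: "continuous_on UNIV (\<lambda>q :: (nat \<Rightarrow> nat) \<times> (nat \<Rightarrow> nat). h (snd q k))" for h :: "nat \<Rightarrow> nat" and k
  proof -
    have "continuous_on UNIV h" by (simp add: continuous_on_discrete)
    then show ?thesis
      by (rule continuous_on_compose2[OF _ continuous_on_snd_coordinate]) auto
  qed
  have "closed E"
    unfolding E_def l_def r_def
    by (intro closed_vimage C(1) continuous_on_Pair continuous_on_fst continuous_on_id
        continuous_on_coordinatewise_then_product cont[of "\<lambda>j. fst (prod_decode j)"]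
        cont[of "\<lambda>j. snd (prod_decode j)"])
  moreover have "\<exists>w. (x, w) \<in> E" for x
  proof -
    obtain y z where "((x, y), z) \<in> C" using total[of x] C(2) by blast
    then have "(x, \<lambda>k. prod_encode (y k, z k)) \<in> E" by (simp add: E_def l_def[abs_def] r_def[abs_def])
    then show ?thesis by blast
  qed
  ultimately obtain D f where D: "comeagre D" "\<And>x. x \<in> D \<Longrightarrow> (x, f x) \<in> E" "locally_determined D f"
    using closed_uniformization by metis
  have "(x, l (f x)) \<in> Q" if "x \<in> D" for x
    using D(2)[OF that] C(2) by (auto simp: E_def)
  moreover have "locally_determined D (\<lambda>x. l (f x))"
    using D(3) unfolding locally_determined_def l_def by metis
  ultimately show ?thesis using D(1) by (intro exI[of _ D] exI[of _ "\<lambda>x. l (f x)"] conjI ballI)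
qed

section \<open>Combinatorics of locally determined lifts\<close>

definition graft :: "nat \<Rightarrow> (nat \<Rightarrow> 'a) \<Rightarrow> (nat \<Rightarrow> 'a) \<Rightarrow> nat \<Rightarrow> 'a"
  where "graft n s x = (\<lambda>i. if i < n then s i else x i)"

lemma graft_below [simp]: "i < n \<Longrightarrow> graft n s x i = s i"
  and graft_above [simp]: "\<not> i < n \<Longrightarrow> graft n s x i = x i"
  by (simp_all add: graft_def)

lemma graft_cong: "x \<in> cyl n s \<Longrightarrow> graft n s x = x"
  by (auto simp: graft_def)

text \<open>Closure under changes of finitely many coordinates, so that a counterexample over one
  stem can be moved over another.\<close>

definition tail_invariant :: "(nat \<Rightarrow> nat) set \<Rightarrow> bool"
  where "tail_invariant D \<longleftrightarrow> (\<forall>x\<in>D. \<forall>n s. graft n s x \<in> D)"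

text \<open>\<open>cyl\<close> makes \<open>f\<close> nonexpanding, and \<open>surj\<close> makes it
  map a cylinder of length at least \<open>n\<close> onto a cylinder of the same length. The
  threshold \<open>n\<close> is there for \<open>graft n s\<close>, which forgets the first
  \<open>n\<close> coordinates; for \<open>flip\<close> it is \<open>0\<close>.\<close>

lemma vimage_open_dense:
  fixes U :: "(nat \<Rightarrow> nat) set" and f :: "(nat \<Rightarrow> nat) \<Rightarrow> nat \<Rightarrow> nat"
  assumes U: "open U" "closure U = UNIV"
    and cyl: "\<And>m x y. y \<in> cyl m x \<Longrightarrow> f y \<in> cyl m (f x)"
    and surj: "\<And>m x y. n \<le> m \<Longrightarrow> y \<in> cyl m (f x) \<Longrightarrow> \<exists>x'\<in>cyl m x. f x' = y"
  shows "open (f -` U)" "closure (f -` U) = UNIV"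
proof -
  show "open (f -` U)"
    unfolding open_iff_cyl
  proof (intro ballI)
    fix x assume "x \<in> f -` U"
    then have "f x \<in> U" by simp
    then obtain m where m: "cyl m (f x) \<subseteq> U" using open_contains_cyl[OF U(1)] by metis
    have "y \<in> f -` U" if "y \<in> cyl m x" for y using subsetD[OF m cyl[OF that]] by simp
    then have "cyl m x \<subseteq> f -` U" by (rule subsetI)
    then show "\<exists>m. cyl m x \<subseteq> f -` U" by (rule exI)
  qed
  show "closure (f -` U) = UNIV"
    unfolding closure_UNIV_iff
  proof (intro allI impI)
    fix W :: "(nat \<Rightarrow> nat) set" assume W: "open W \<and> W \<noteq> {}"
    then obtain x where "x \<in> W" by blast
    then obtain m where m: "cyl m x \<subseteq> W" using open_contains_cyl W by metis
    obtain n' y where y: "max n m < n'" "y \<in> cyl (max n m) (f x)" "cyl n' y \<subseteq> U"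
      using dense_meets_cyl[OF U] by metis
    obtain x' where x': "x' \<in> cyl (max n m) x" "f x' = y"
      using surj[OF _ y(2)] by auto
    have "x' \<in> cyl m x" using x'(1) by simp
    then have "x' \<in> W" using m by (rule subsetD[rotated])
    moreover have "y \<in> cyl n' y" by simp
    then have "y \<in> U" using y(3) by (rule subsetD[rotated])
    ultimately show "W \<inter> f -` U \<noteq> {}" using x'(2) by blast
  qed
qed

lemma graft_vimage_open_dense:
  fixes U :: "(nat \<Rightarrow> nat) set"
  assumes "open U" "closure U = UNIV"
  shows "open (graft n s -` U)" "closure (graft n s -` U) = UNIV"
proof -
  have c: "graft n s y \<in> cyl m (graft n s x)" if "y \<in> cyl m x" for m x y
    using that by (simp add: graft_def)
  have d: "\<exists>x'\<in>cyl m x. graft n s x' = y" if "n \<le> m" "y \<in> cyl m (graft n s x)" for m x y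
    using that by (intro bexI[of _ "graft n x y"]) (auto simp: graft_def fun_eq_iff)
  show "open (graft n s -` U)" "closure (graft n s -` U) = UNIV"
    by (rule vimage_open_dense[OF assms c d]; assumption)+
qed

text \<open>There are countably many finite words, so the preimages of the given dense open sets
  under all grafts still form a sequence. Their intersection is invariant because a composition of
  two grafts is a graft. The fusions need the open sets themselves, not only comeagreness.\<close>

lemma comeagre_tail_invariant:
  assumes "comeagre D"
  shows "\<exists>U :: nat \<Rightarrow> (nat \<Rightarrow> nat) set. (\<forall>k. open (U k)) \<and> (\<forall>k. closure (U k) = UNIV) \<and>
    (\<Inter>k. U k) \<subseteq> D \<and> tail_invariant (\<Inter>k. U k)"
proof -
  obtain V where V: "\<And>k. open (V k)" "\<And>k. closure (V k) = UNIV" "(\<Inter>k::nat. V k) \<subseteq> D"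
    using comeagre_obtain[OF assms] by metis
  define h where "h l = (\<lambda>i. if i < length l then l ! i else 0)" for l :: "nat list"
  define U where "U k = (let l = from_nat (snd (prod_decode k)) in
    graft (length l) (h l) -` V (fst (prod_decode k)))" for k
  have U_iff: "x \<in> (\<Inter>k. U k) \<longleftrightarrow> (\<forall>n s. graft n s x \<in> (\<Inter>k. V k))" for x
  proof
    assume x: "x \<in> (\<Inter>k. U k)"
    show "\<forall>n s. graft n s x \<in> (\<Inter>k. V k)"
    proof (intro allI INT_I)
      fix n k and s :: "nat \<Rightarrow> nat"
      have "x \<in> U (prod_encode (k, to_nat (map s [0..<n])))" using x by blast
      moreover have "graft (length (map s [0..<n])) (h (map s [0..<n])) x = graft n s x"
        by (auto simp: graft_def h_def)
      ultimately show "graft n s x \<in> V k" by (simp add: U_def)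
    qed
  qed (simp add: U_def Let_def)
  have "(\<Inter>k. U k) \<subseteq> D"
  proof
    fix x assume "x \<in> (\<Inter>k. U k)"
    then have "graft 0 x x \<in> (\<Inter>k. V k)" unfolding U_iff by blast
    then show "x \<in> D" using V(3) by (auto simp: graft_def)
  qed
  moreover have "tail_invariant (\<Inter>k. U k)"
    unfolding tail_invariant_def U_iff
  proof (intro ballI allI)
    fix x n s m t assume "x \<in> (\<Inter>k. U k)"
    then have x: "graft n s x \<in> (\<Inter>k. V k)" for n s unfolding U_iff by blast
    have "graft m t (graft n s x) = graft (max m n) (\<lambda>i. if i < m then t i else s i) x"
      by (auto simp: graft_def fun_eq_iff)
    then show "graft m t (graft n s x) \<in> (\<Inter>k. V k)" using x by simp
  qed
  moreover have "open (U k)" "closure (U k) = UNIV" for k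
    unfolding U_def Let_def by (intro graft_vimage_open_dense V)+
  ultimately show ?thesis by (intro exI[of _ U] conjI allI)
qed

lemma locally_determined_mono:
  "locally_determined D f \<Longrightarrow> E \<subseteq> D \<Longrightarrow> locally_determined E f"
  unfolding locally_determined_def by (meson subsetD)

lemma locally_determined_finite:
  assumes "locally_determined D f" "finite J" "\<And>j. j \<in> J \<Longrightarrow> \<xi> j \<in> D"
  obtains n where "n0 < n" "\<And>j y. j \<in> J \<Longrightarrow> y \<in> D \<Longrightarrow> y \<in> cyl n (\<xi> j) \<Longrightarrow> f y m = f (\<xi> j) m"
proof -
  have "\<forall>j\<in>J. \<exists>n. \<forall>y\<in>D. y \<in> cyl n (\<xi> j) \<longrightarrow> f y m = f (\<xi> j) m"
    using assms(1,3) unfolding locally_determined_def by blast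
  then obtain N where N: "\<And>j y. j \<in> J \<Longrightarrow> y \<in> D \<Longrightarrow> y \<in> cyl (N j) (\<xi> j) \<Longrightarrow> f y m = f (\<xi> j) m"
    by metis
  define n where "n = Suc (Max (insert n0 (N ` J)))"
  have "n0 < n" "\<And>j. j \<in> J \<Longrightarrow> N j \<le> n"
    unfolding n_def less_Suc_eq_le using assms(2) by (auto intro!: Max_ge le_SucI)
  then show thesis using that[of n] N cyl_anti_mono by (metis subsetD)
qed

lemma open_contains_cyl_finite:
  assumes "open U" "finite J" "\<And>j. j \<in> J \<Longrightarrow> \<xi> j \<in> U"
  obtains n where "n0 < n" "\<And>j. j \<in> J \<Longrightarrow> cyl n (\<xi> j) \<subseteq> (U :: (nat \<Rightarrow> nat) set)"
proof -
  have "\<forall>j\<in>J. \<exists>n. cyl n (\<xi> j) \<subseteq> U"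
    using open_contains_cyl[OF assms(1)] assms(3) by metis
  then obtain N where N: "\<And>j. j \<in> J \<Longrightarrow> cyl (N j) (\<xi> j) \<subseteq> U" by metis
  define n where "n = Suc (Max (insert n0 (N ` J)))"
  have "n0 < n" "\<And>j. j \<in> J \<Longrightarrow> N j \<le> n"
    unfolding n_def less_Suc_eq_le using assms(2) by (auto intro!: Max_ge le_SucI)
  then show thesis using that[of n] N cyl_anti_mono by (meson subset_trans)
qed

lemma strict_mono_locate:
  fixes ns :: "nat \<Rightarrow> nat"
  assumes "strict_mono ns" "ns 0 \<le> i"
  obtains k where "ns k \<le> i" "i < ns (Suc k)"
proof -
  have inc: "k \<le> ns k" for k using assms(1) by (rule strict_mono_imp_increasing)
  define l where "l = (LEAST k. i < ns k)"
  have lt: "i < ns l" unfolding l_def by (rule LeastI[of _ "Suc i"]) (use inc[of "Suc i"] in simp)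
  then have "l \<noteq> 0" using assms(2) by (cases l) auto
  then obtain k where k: "l = Suc k" by (cases l) auto
  have "ns k \<le> i" using not_less_Least[of k "\<lambda>k. i < ns k"] k unfolding l_def by auto
  then show thesis using that lt k by blast
qed

text \<open>
  Any sequence is, beyond a given stem, interleaved from two elements of a comeagre set: on
  alternate blocks one of the two is forced into the next dense open set while the other copies \<open>z\<close>.
\<close>

lemma comeagre_interleave:
  fixes D :: "(nat \<Rightarrow> nat) set"
  assumes "comeagre D"
  obtains x y where "x \<in> D" "y \<in> D" "x \<in> cyl n s" "y \<in> cyl n s"
    "\<And>i. n \<le> i \<Longrightarrow> x i = z i \<or> y i = z i"
proof -
  obtain U where U: "\<And>k. open (U k)" "\<And>k. closure (U k) = UNIV" "(\<Inter>k::nat. U k) \<subseteq> D"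
    using comeagre_obtain[OF assms] by metis
  define P where "P k m m' w \<longleftrightarrow> cyl m' (w True) \<subseteq> U k \<and> cyl m' (w False) \<subseteq> U k \<and>
      (\<forall>i. m \<le> i \<and> i < m' \<longrightarrow> w True i = z i \<or> w False i = z i)"
    for k m m' and w :: "bool \<Rightarrow> nat \<Rightarrow> nat"
  have step: "\<exists>m' w'. m < m' \<and> (\<forall>j. w' j \<in> cyl m (w j)) \<and> True \<and> P k m m' w'"
    for k m and w :: "bool \<Rightarrow> nat \<Rightarrow> nat"
  proof -
    obtain m1 x where x: "m < m1" "x \<in> cyl m (w True)" "cyl m1 x \<subseteq> U k"
      using dense_meets_cyl[OF U(1,2)] by metis
    obtain m2 y where y: "m1 < m2" "y \<in> cyl m1 (graft m (w False) z)" "cyl m2 y \<subseteq> U k"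
      using dense_meets_cyl[OF U(1,2)] by metis
    \<comment> \<open>The second point copies \<open>z\<close> on \<open>[m, m1)\<close> while the
      first enters \<open>U k\<close>; from \<open>m1\<close> on the first copies \<open>z\<close>
      while the second enters \<open>U k\<close>.\<close>
    define w' where "w' j = (if j then graft m1 x z else y)" for j
    have "graft m1 x z \<in> cyl m1 x" by simp
    then have "cyl m2 (graft m1 x z) \<subseteq> U k" using x(3) y(1) by force
    moreover have "w' True i = z i \<or> w' False i = z i" if "m \<le> i" for i
      using that y(2) by (cases "i < m1") (auto simp: w'_def)
    ultimately have "P k m m2 w'" using y(3) by (simp add: P_def w'_def)
    moreover have "w' j \<in> cyl m (w j)" for j using x y by (cases j) (auto simp: w'_def)
    ultimately show ?thesis using x(1) y(1) by (intro exI[of _ m2] exI[of _ w']) auto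
  qed
  obtain \<xi> ns xs where \<xi>: "ns 0 = n" "xs 0 = (\<lambda>_::bool. s)" "strict_mono ns"
    "\<And>k j. \<xi> j \<in> cyl (ns k) (xs k j)" "\<And>k. P k (ns k) (ns (Suc k)) (xs (Suc k))"
    using fusion[of "\<lambda>_ _. True" n "\<lambda>_::bool. s" P, OF _ step] by metis
  have "\<xi> j \<in> U k" for j k using \<xi>(4)[of j "Suc k"] \<xi>(5)[of k] by (cases j) (auto simp: P_def)
  then have D: "\<xi> j \<in> D" for j using U(3) by blast
  have "\<xi> True i = z i \<or> \<xi> False i = z i" if ni: "n \<le> i" for i
  proof -
    obtain l where l: "ns l \<le> i" "i < ns (Suc l)"
      using strict_mono_locate[OF \<xi>(3), of i] ni \<xi>(1) by auto
    then have "xs (Suc l) True i = z i \<or> xs (Suc l) False i = z i"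
      using \<xi>(5)[of l] by (simp add: P_def)
    then show ?thesis using \<xi>(4)[of True "Suc l"] \<xi>(4)[of False "Suc l"] l by simp
  qed
  then show thesis using that[of "\<xi> True" "\<xi> False"] D \<xi>(4)[of _ 0] \<xi>(1,2) by simp
qed

text \<open>
  Two sequences that agree in a tail have almost equal lifts; by Baire category, this happens
  uniformly on a cylinder.
\<close>

lemma stabilize:
  fixes h :: "(nat \<Rightarrow> nat) \<Rightarrow> nat \<Rightarrow> 'b"
  assumes cD: "comeagre D" and tD: "tail_invariant D" and lh: "locally_determined D h"
    and fin: "\<And>x y n. x \<in> D \<Longrightarrow> y \<in> D \<Longrightarrow> (\<forall>i\<ge>n. x i = y i) \<Longrightarrow> finite {m. h x m \<noteq> h y m}"
    and J: "finite J"
  obtains n' s N where "n \<le> n'" "s \<in> cyl n t"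
    "\<And>x i j m. x \<in> D \<Longrightarrow> x \<in> cyl n' s \<Longrightarrow> i \<in> J \<Longrightarrow> j \<in> J \<Longrightarrow> N \<le> m \<Longrightarrow>
      h (graft n (p i) x) m = h (graft n (p j) x) m"
proof (rule ccontr)
  assume no: "\<not> thesis"
  note concl = that
  have bad: "\<exists>x i j m. x \<in> D \<and> x \<in> cyl n' s \<and> i \<in> J \<and> j \<in> J \<and> N \<le> m \<and>
      h (graft n (p i) x) m \<noteq> h (graft n (p j) x) m" if "n \<le> n'" "s \<in> cyl n t" for n' s N
  proof (rule ccontr)
    assume nb: "\<not> ?thesis"
    have "thesis"
    proof (rule concl[OF that, of N])
      fix x i j m
      assume "x \<in> D" "x \<in> cyl n' s" "i \<in> J" "j \<in> J" "N \<le> m"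
      then show "h (graft n (p i) x) m = h (graft n (p j) x) m" using nb by metis
    qed
    with no show False ..
  qed
  \<comment> \<open>The failure is asked for throughout a cylinder, which makes \<open>G N\<close>
    open; local determination shows that nothing is lost by this.\<close>
  define G where "G N = {x. \<exists>k\<ge>n. \<exists>m\<ge>N. \<exists>i\<in>J. \<exists>j\<in>J. \<forall>y\<in>D. y \<in> cyl k x \<longrightarrow>
      h (graft n (p i) y) m \<noteq> h (graft n (p j) y) m}" for N
  have oG: "open (G N)" for N
    unfolding open_iff_cyl
  proof (intro ballI)
    fix x assume "x \<in> G N"
    then obtain k m i j where *: "n \<le> k" "N \<le> m" "i \<in> J" "j \<in> J" "\<forall>y\<in>D. y \<in> cyl k x \<longrightarrow>
      h (graft n (p i) y) m \<noteq> h (graft n (p j) y) m" unfolding G_def by blast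
    have "z \<in> G N" if "z \<in> cyl k x" for z
    proof -
      have "cyl k z = cyl k x" using that by (auto simp: cyl_def)
      then show ?thesis unfolding G_def using * by blast
    qed
    then show "\<exists>k. cyl k x \<subseteq> G N" by blast
  qed
  have dG: "\<exists>y\<in>G N. y \<in> cyl n' s" if n': "n \<le> n'" "s \<in> cyl n t" for n' s N
  proof -
    obtain x i j m where x: "x \<in> D" "x \<in> cyl n' s" "i \<in> J" "j \<in> J" "N \<le> m"
      "h (graft n (p i) x) m \<noteq> h (graft n (p j) x) m" using bad[OF n'] by metis
    have gD: "graft n (p l) y \<in> D" if "y \<in> D" for y l using that tD by (simp add: tail_invariant_def)
    obtain k where k: "n < k" "\<And>l y. l \<in> {i, j} \<Longrightarrow> y \<in> D \<Longrightarrow> y \<in> cyl k (graft n (p l) x) \<Longrightarrow>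
        h y m = h (graft n (p l) x) m"
      using locally_determined_finite[OF lh, of "{i, j}" "\<lambda>l. graft n (p l) x" n m] gD[OF x(1)]
      by (metis finite.emptyI finite_insert)
    have "h (graft n (p i) y) m \<noteq> h (graft n (p j) y) m" if y: "y \<in> D" "y \<in> cyl k x" for y
    proof -
      have "graft n (p l) y \<in> cyl k (graft n (p l) x)" for l
        using y(2) by (auto simp: graft_def)
      then show ?thesis using k(2)[of i] k(2)[of j] gD[OF y(1)] x(6) by simp
    qed
    then have "\<forall>y\<in>D. y \<in> cyl k x \<longrightarrow> h (graft n (p i) y) m \<noteq> h (graft n (p j) y) m" by blast
    then have "x \<in> G N"
      unfolding G_def mem_Collect_eq using k(1) x(3,4,5) by (meson less_imp_le)
    then show ?thesis using x(2) by blast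
  qed
  \<comment> \<open>\<open>G N\<close> is known to be dense only inside \<open>cyl n t\<close>;
    adding the complement of this clopen cylinder makes it dense everywhere.\<close>
  have cG: "comeagre (G N \<union> - cyl n t)" for N
  proof (rule comeagre_open_dense)
    have "open (- cyl n t)"
      unfolding open_iff_cyl
    proof (intro ballI)
      fix x assume "x \<in> - cyl n t"
      then have "cyl n x \<subseteq> - cyl n t" by auto
      then show "\<exists>k. cyl k x \<subseteq> - cyl n t" by blast
    qed
    then show "open (G N \<union> - cyl n t)" using oG by (rule open_Un[rotated])
    show "closure (G N \<union> - cyl n t) = UNIV"
      unfolding closure_UNIV_iff
    proof (intro allI impI)
      fix W :: "(nat \<Rightarrow> nat) set" assume W: "open W \<and> W \<noteq> {}"
      then obtain x where x: "x \<in> W" by blast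
      show "W \<inter> (G N \<union> - cyl n t) \<noteq> {}"
      proof (cases "x \<in> cyl n t")
        case True
        obtain m where m: "cyl m x \<subseteq> W" using open_contains_cyl W x by metis
        obtain y where y: "y \<in> G N" "y \<in> cyl (max n m) x" using dG[of "max n m" x N] True by auto
        then have "y \<in> W" using m by auto
        then show ?thesis using y(1) by blast
      next
        case False
        then show ?thesis using x by blast
      qed
    qed
  qed
  have "comeagre (D \<inter> (\<Inter>N. G N \<union> - cyl n t))"
    using cD cG by (intro comeagre_Int comeagre_INT) auto
  then obtain x where x: "x \<in> D \<inter> (\<Inter>N. G N \<union> - cyl n t)" "x \<in> cyl n t"
    using comeagre_meets_cyl by metis
  then have xG: "x \<in> G N" for N by auto
  have gD: "graft n (p l) x \<in> D" for l using x(1) tD by (simp add: tail_invariant_def)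
  \<comment> \<open>A point of all \<open>G N\<close> has grafts that differ at arbitrarily large
    \<open>m\<close>, whereas finitely many grafts differ at finitely many \<open>m\<close>
    altogether.\<close>
  define M where "M = (\<Union>i\<in>J. \<Union>j\<in>J. {m. h (graft n (p i) x) m \<noteq> h (graft n (p j) x) m})"
  have "finite {m. h (graft n (p i) x) m \<noteq> h (graft n (p j) x) m}" for i j
    by (rule fin[OF gD gD, of n]) simp
  then have "finite M" unfolding M_def using J by blast
  then obtain N where N: "\<And>m. m \<in> M \<Longrightarrow> m < N"
    by (metis finite_nat_set_iff_bounded)
  obtain m i j k where *: "N \<le> m" "i \<in> J" "j \<in> J" "\<forall>y\<in>D. y \<in> cyl k x \<longrightarrow>
      h (graft n (p i) y) m \<noteq> h (graft n (p j) y) m"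
    using xG[of N] unfolding G_def mem_Collect_eq by metis
  have "x \<in> cyl k x" "x \<in> D" using x(1) by auto
  then have "h (graft n (p i) x) m \<noteq> h (graft n (p j) x) m" using *(4) by metis
  then have "m \<in> M" unfolding M_def using *(2,3) by blast
  then show False using N[of m] *(1) by simp
qed

lemma comeagre_INT_open_dense:
  assumes U: "\<And>k. open (U k)" "\<And>k. closure (U k) = UNIV"
  shows "comeagre (\<Inter>k::nat. U k)"
  by (rule comeagre_INT) (simp_all add: comeagre_open_dense U)

text \<open>
  Otherwise a fusion yields \<open>x\<close>, \<open>y\<close>, \<open>u\<close>, \<open>v\<close> that contradict the last assumption.  A counterexample
  over one stem is transferred to the other three stems by stabilizing the tails first.
\<close>

lemma no_disjoint_sensitivity:
  fixes h :: "(nat \<Rightarrow> nat) \<Rightarrow> nat \<Rightarrow> 'b"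
  assumes U: "\<And>k. open (U k)" "\<And>k. closure (U k) = UNIV" and DU: "D = (\<Inter>k::nat. U k)" and tD: "tail_invariant D" and lh: "locally_determined D h"
    and fin: "\<And>x y n. x \<in> D \<Longrightarrow> y \<in> D \<Longrightarrow> (\<forall>i\<ge>n. x i = y i) \<Longrightarrow> finite {m. h x m \<noteq> h y m}"
    and disj: "\<And>x y u v. x \<in> D \<Longrightarrow> y \<in> D \<Longrightarrow> u \<in> D \<Longrightarrow> v \<in> D \<Longrightarrow>
      (\<forall>i. x i = y i \<or> u i = v i) \<Longrightarrow> finite {m. h x m \<noteq> h y m \<and> h u m \<noteq> h v m}"
  obtains n s N where "\<And>m x y u v. N \<le> m \<Longrightarrow> {x, y, u, v} \<subseteq> D \<inter> cyl n s \<Longrightarrow>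
    (\<forall>i. x i = y i \<or> u i = v i) \<Longrightarrow> h x m = h y m \<or> h u m = h v m"
proof (rule ccontr)
  assume no: "\<not> thesis"
  note concl = that
  define Bad where "Bad N n s m x y u v \<longleftrightarrow> N \<le> m \<and> {x, y, u, v} \<subseteq> D \<inter> cyl n s \<and>
    (\<forall>i. x i = y i \<or> u i = v i) \<and> h x m \<noteq> h y m \<and> h u m \<noteq> h v m" for N n s m x y u v
  have bad: "\<exists>m x y u v. Bad N n s m x y u v" for n s N
  proof (rule ccontr)
    assume nb: "\<not> ?thesis"
    have "thesis"
    proof (rule concl[of N n s])
      fix m x y u v
      assume "N \<le> m" "{x, y, u, v} \<subseteq> D \<inter> cyl n s" "\<forall>i. x i = y i \<or> u i = v i"
      moreover have "\<not> Bad N n s m x y u v" using nb by metis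
      ultimately show "h x m = h y m \<or> h u m = h v m" unfolding Bad_def by argo
    qed
    with no show False ..
  qed
  have cD: "comeagre D" unfolding DU by (rule comeagre_INT_open_dense[OF U])
  \<comment> \<open>In an index \<open>(b, c)\<close> the bit \<open>b\<close> selects the pair,
    \<open>x\<close>, \<open>y\<close> or \<open>u\<close>, \<open>v\<close>, and \<open>c\<close>
    the member of the pair.\<close>
  define Sep where "Sep m n' w = (\<forall>b. \<forall>\<xi>\<in>D. \<forall>Y\<in>D. \<xi> \<in> cyl n' (w (b, True)) \<longrightarrow>
      Y \<in> cyl n' (w (b, False)) \<longrightarrow> h \<xi> m \<noteq> h Y m)"
    for m n' and w :: "bool \<times> bool \<Rightarrow> nat \<Rightarrow> nat"
  define Alt where "Alt n n' w = (\<forall>i. n \<le> i \<and> i < n' \<longrightarrow>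
      w (True, True) i = w (True, False) i \<or> w (False, True) i = w (False, False) i)"
    for n n' and w :: "bool \<times> bool \<Rightarrow> nat \<Rightarrow> nat"
  define P where "P k n n' w = ((\<forall>j. cyl n' (w j) \<subseteq> U k) \<and> (\<exists>m\<ge>k. Sep m n' w) \<and> Alt n n' w)"
    for k :: nat and n n' and w :: "bool \<times> bool \<Rightarrow> nat \<Rightarrow> nat"
  have step: "\<exists>n' w'. n < n' \<and> (\<forall>j. w' j \<in> cyl n (w j)) \<and> True \<and> P k n n' w'"
    for k n and w :: "bool \<times> bool \<Rightarrow> nat \<Rightarrow> nat"
  proof -
    define t where "t = w (True, True)"
    show ?thesis
    proof (rule stabilize[OF cD tD lh fin finite[of UNIV], where p = w and n = n and t = t])
    fix n1 s N
    assume st: "n \<le> n1" "s \<in> cyl n t"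
      "\<And>x i j m. x \<in> D \<Longrightarrow> x \<in> cyl n1 s \<Longrightarrow> i \<in> UNIV \<Longrightarrow> j \<in> UNIV \<Longrightarrow> N \<le> m \<Longrightarrow>
        h (graft n (w i) x) m = h (graft n (w j) x) m"
    obtain m x y u v where m: "max N k \<le> m" and xyuv: "{x, y, u, v} \<subseteq> D \<inter> cyl n1 s"
      "\<forall>i. x i = y i \<or> u i = v i" "h x m \<noteq> h y m" "h u m \<noteq> h v m"
      using bad[where N = "max N k" and n = n1 and s = s] unfolding Bad_def by metis
    define z where "z j = (if fst j then if snd j then x else y else if snd j then u else v)" for j :: "bool \<times> bool"
    have zD: "z j \<in> D" "z j \<in> cyl n1 s" for j using xyuv(1) by (auto simp: z_def)
    have zt: "z j \<in> cyl n t" for j using zD(2)[of j] st(1,2) by simp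
    define b where "b j = graft n (w j) (z j)" for j
    have bD: "b j \<in> D" for j using zD(1) tD by (simp add: b_def tail_invariant_def)
    \<comment> \<open>At \<open>m\<close> all four stems yield the same value by stabilization, and
      over the stem \<open>t\<close> the graft is \<open>z j\<close> itself. So the inequalities
      found over one stem hold over the four stems of the fusion.\<close>
    have hb: "h (b j) m = h (z j) m" for j
      using st(3)[OF zD, where i = j and j = "(True, True)" and m = m] m graft_cong[OF zt[of j]]
      by (simp add: b_def t_def)
    obtain n2 where n2: "n < n2" "\<And>j y. j \<in> UNIV \<Longrightarrow> y \<in> D \<Longrightarrow> y \<in> cyl n2 (b j) \<Longrightarrow> h y m = h (b j) m"
      using locally_determined_finite[OF lh finite[of UNIV], where \<xi> = b] bD by metis
    have bU: "b j \<in> U k" for j k using bD[of j] DU by blast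
    obtain n' where n': "n2 < n'" "\<And>j. j \<in> UNIV \<Longrightarrow> cyl n' (b j) \<subseteq> U k"
      using open_contains_cyl_finite[OF U(1) finite[of UNIV], where \<xi> = b] bU by metis
    have "cyl n' x \<subseteq> cyl n2 x" for x :: "nat \<Rightarrow> nat" using n'(1) by (intro cyl_anti_mono) simp
    note sub = subsetD[OF this]
    have "h \<xi> m \<noteq> h Y m" if XY: "\<xi> \<in> D" "Y \<in> D" "\<xi> \<in> cyl n' (b (c, True))" "Y \<in> cyl n' (b (c, False))" for c \<xi> Y
    proof -
      have "h \<xi> m = h (b (c, True)) m" "h Y m = h (b (c, False)) m"
        using n2(2)[OF UNIV_I XY(1) sub[OF XY(3)]] n2(2)[OF UNIV_I XY(2) sub[OF XY(4)]] .
      then show ?thesis using xyuv(3,4) by (simp add: hb z_def)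
    qed
    then have "Sep m n' b" unfolding Sep_def by metis
    moreover have "Alt n n' b" using xyuv(2) by (simp add: Alt_def b_def z_def)
    ultimately have "P k n n' b" unfolding P_def using n'(2) m by auto
    moreover have "b j \<in> cyl n (w j)" for j by (simp add: b_def)
    ultimately show ?thesis using n2(1) n'(1) by (meson less_trans)
    qed
  qed
  obtain \<xi> ns xs where \<xi>: "ns 0 = 0" "strict_mono ns"
    "\<And>k j. \<xi> j \<in> cyl (ns k) (xs k j)" "\<And>k. P k (ns k) (ns (Suc k)) (xs (Suc k))"
    using fusion[of "\<lambda>_ _. True" 0 "\<lambda>_::bool \<times> bool. undefined" P, OF _ step] by metis
  have "\<xi> j \<in> U k" for j k
    using \<xi>(3)[of j "Suc k"] \<xi>(4)[of k] unfolding P_def by blast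
  then have D: "\<xi> j \<in> D" for j using DU by blast
  have "\<xi> (True, True) i = \<xi> (True, False) i \<or> \<xi> (False, True) i = \<xi> (False, False) i" for i
  proof -
    obtain l where l: "ns l \<le> i" "i < ns (Suc l)"
      using strict_mono_locate[OF \<xi>(2), of i] \<xi>(1) by auto
    then have "xs (Suc l) (True, True) i = xs (Suc l) (True, False) i \<or>
        xs (Suc l) (False, True) i = xs (Suc l) (False, False) i"
      using \<xi>(4)[of l] by (simp add: P_def Alt_def)
    moreover have "\<xi> j i = xs (Suc l) j i" for j using \<xi>(3)[of j "Suc l"] l(2) by simp
    ultimately show ?thesis by simp
  qed
  then have "finite {m. h (\<xi> (True, True)) m \<noteq> h (\<xi> (True, False)) m \<and>
      h (\<xi> (False, True)) m \<noteq> h (\<xi> (False, False)) m}"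
    by (intro disj D allI)
  then obtain K where K: "\<forall>m\<in>{m. h (\<xi> (True, True)) m \<noteq> h (\<xi> (True, False)) m \<and>
      h (\<xi> (False, True)) m \<noteq> h (\<xi> (False, False)) m}. m < K"
    unfolding finite_nat_set_iff_bounded by (rule exE)
  obtain m where m: "K \<le> m" "Sep m (ns (Suc K)) (xs (Suc K))"
    using \<xi>(4)[of K] unfolding P_def by blast
  have "h (\<xi> (b, True)) m \<noteq> h (\<xi> (b, False)) m" for b
    using m(2) D[of "(b, True)"] D[of "(b, False)"] \<xi>(3)[of "(b, True)" "Suc K"]
      \<xi>(3)[of "(b, False)" "Suc K"] unfolding Sep_def by blast
  then have "m < K" using K by blast
  then show False using m(1) by simp
qed

text \<open>Two different coordinates cannot both influence the value at a large \<open>m\<close>,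
  as the changes at them would be disjoint. If \<open>x\<close> and \<open>y\<close> agree at the
  only influential coordinate \<open>g m\<close>, turning \<open>x\<close> into \<open>y\<close> one
  coordinate at a time never changes the value.\<close>

lemma single_coordinate:
  fixes h :: "(nat \<Rightarrow> nat) \<Rightarrow> nat \<Rightarrow> 'b"
  assumes U: "\<And>k. open (U k)" "\<And>k. closure (U k) = UNIV" and DU: "D = (\<Inter>k::nat. U k)" and tD: "tail_invariant D" and lh: "locally_determined D h"
    and fin: "\<And>x y n. x \<in> D \<Longrightarrow> y \<in> D \<Longrightarrow> (\<forall>i\<ge>n. x i = y i) \<Longrightarrow> finite {m. h x m \<noteq> h y m}"
    and disj: "\<And>x y u v. x \<in> D \<Longrightarrow> y \<in> D \<Longrightarrow> u \<in> D \<Longrightarrow> v \<in> D \<Longrightarrow>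
      (\<forall>i. x i = y i \<or> u i = v i) \<Longrightarrow> finite {m. h x m \<noteq> h y m \<and> h u m \<noteq> h v m}"
  obtains n s N g where "\<And>m. n \<le> g m"
    "\<And>m x y. N \<le> m \<Longrightarrow> x \<in> D \<inter> cyl n s \<Longrightarrow> y \<in> D \<inter> cyl n s \<Longrightarrow> x (g m) = y (g m) \<Longrightarrow> h x m = h y m"
proof (rule no_disjoint_sensitivity[OF assms])
  fix n s N
  assume ns: "\<And>m x y u v. N \<le> m \<Longrightarrow> {x, y, u, v} \<subseteq> D \<inter> cyl n s \<Longrightarrow>
    (\<forall>i. x i = y i \<or> u i = v i) \<Longrightarrow> h x m = h y m \<or> h u m = h v m"
  define sens where "sens m i \<longleftrightarrow> (\<exists>x\<in>D \<inter> cyl n s. \<exists>y\<in>D \<inter> cyl n s.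
    (\<forall>l. l \<noteq> i \<longrightarrow> x l = y l) \<and> h x m \<noteq> h y m)" for m i
  \<comment> \<open>Where no coordinate matters, the default \<open>n\<close> keeps
    \<open>n \<le> g m\<close> true.\<close>
  define g where "g m = (if \<exists>i. sens m i then SOME i. sens m i else n)" for m
  have sens_ge: "n \<le> i" if si: "sens m i" for m i
  proof (rule ccontr)
    assume "\<not> n \<le> i"
    obtain x y where xy: "x \<in> cyl n s" "y \<in> cyl n s" "\<forall>l. l \<noteq> i \<longrightarrow> x l = y l" "h x m \<noteq> h y m"
      using si unfolding sens_def by blast
    then have "x l = y l" for l using \<open>\<not> n \<le> i\<close> by (cases "l = i") auto
    then show False using xy(4) by presburger
  qed
  have sens_uniq: "i = j" if ij: "N \<le> m" "sens m i" "sens m j" for m i j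
  proof (rule ccontr)
    assume ne: "i \<noteq> j"
    obtain x y where xy: "x \<in> D \<inter> cyl n s" "y \<in> D \<inter> cyl n s" "\<forall>l. l \<noteq> i \<longrightarrow> x l = y l" "h x m \<noteq> h y m"
      using ij(2) unfolding sens_def by blast
    obtain u v where uv: "u \<in> D \<inter> cyl n s" "v \<in> D \<inter> cyl n s" "\<forall>l. l \<noteq> j \<longrightarrow> u l = v l" "h u m \<noteq> h v m"
      using ij(3) unfolding sens_def by blast
    have "x l = y l \<or> u l = v l" for l using xy(3) uv(3) ne by (cases "l = i") auto
    then show False using ns[OF ij(1), of x y u v] xy uv by blast
  qed
  have sens_g: "g m = i" if "N \<le> m" "sens m i" for m i
    using sens_uniq[OF that(1)] that(2) unfolding g_def by (metis (mono_tags, lifting) someI)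
  have "n \<le> g m" for m using sens_ge[of m] unfolding g_def by (auto intro: someI2)
  moreover have "h x m = h y m"
    if m: "N \<le> m" and x: "x \<in> D \<inter> cyl n s" and y: "y \<in> D \<inter> cyl n s" and gm: "x (g m) = y (g m)" for m x y
  proof (rule ccontr)
    assume ne: "h x m \<noteq> h y m"
    obtain k where k: "\<And>z. z \<in> D \<Longrightarrow> z \<in> cyl k y \<Longrightarrow> h z m = h y m"
      using lh y unfolding locally_determined_def by blast
    \<comment> \<open>\<open>w j\<close> has the values of \<open>y\<close> below \<open>j\<close>
      and those of \<open>x\<close> from \<open>j\<close> on. By local determination the lift of
      \<open>w k\<close> at \<open>m\<close> is already that of \<open>y\<close>, so finitely many
      single changes have to be examined.\<close>
    define w where "w j = graft j y x" for j
    have wD: "w j \<in> D \<inter> cyl n s" for j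
      using x y tD by (auto simp: w_def tail_invariant_def graft_def)
    have "h (w k) m = h y m" by (rule k) (use wD[of k] in \<open>auto simp: w_def\<close>)
    moreover have "w 0 = x" by (simp add: w_def graft_def)
    ultimately have "h (w 0) m \<noteq> h (w k) m" using ne by simp
    then obtain j where j: "h (w j) m \<noteq> h (w (Suc j)) m"
      by (induction k) (auto, metis)
    have eq: "w j l = w (Suc j) l" if "l \<noteq> j" for l
      using that by (auto simp: w_def graft_def)
    then have "sens m j" unfolding sens_def using wD j by blast
    then have "g m = j" by (rule sens_g[OF m])
    then have "w j j = w (Suc j) j" using gm by (simp add: w_def)
    then have "w j = w (Suc j)" using eq by (metis ext)
    then show False using j by simp
  qed
  ultimately show thesis by (rule that)
qed

section \<open>Automorphisms of the subsets of the natural numbers modulo finite sets\<close>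

text \<open>Exchanges \<open>2 * a\<close> and \<open>2 * a + 1\<close> at the coordinates in
  \<open>S\<close>: an involution that reverses parities exactly there and maps cylinders to
  cylinders.\<close>

definition flip :: "nat set \<Rightarrow> (nat \<Rightarrow> nat) \<Rightarrow> nat \<Rightarrow> nat"
  where "flip S x = (\<lambda>i. if i \<in> S then (if even (x i) then Suc (x i) else x i - 1) else x i)"

lemma flip_flip [simp]: "flip S (flip S x) = x"
  by (auto simp: flip_def fun_eq_iff elim: oddE)

lemma flip_cyl: "y \<in> cyl n x \<Longrightarrow> flip S y \<in> cyl n (flip S x)"
  by (auto simp: flip_def)

lemma odd_flip: "odd (flip S x i) \<longleftrightarrow> (odd (x i)) \<noteq> (i \<in> S)"
  by (auto simp: flip_def)

lemma comeagre_flip: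
  assumes "comeagre D"
  shows "comeagre (flip S -` D)"
proof -
  obtain U where U: "\<And>k. open (U k)" "\<And>k. closure (U k) = UNIV" "(\<Inter>k::nat. U k) \<subseteq> D"
    using comeagre_obtain[OF assms] by metis
  have d: "\<exists>x'\<in>cyl m x. flip S x' = y" if "y \<in> cyl m (flip S x)" for m x y
    using flip_cyl[OF that, of S] unfolding flip_flip by (intro bexI[of _ "flip S y"]) simp_all
  have "comeagre (flip S -` U k)" for k
    by (intro comeagre_open_dense vimage_open_dense[OF U(1,2) flip_cyl d, where n = 0])
  then have "comeagre (\<Inter>k. flip S -` U k)" by (intro comeagre_INT) auto
  then show ?thesis by (rule comeagre_mono) (use U(3) in auto)
qed

text \<open>
  The relation \<open>R\<close> stands for an automorphism of the Boolean algebra of subsets of the natural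
  numbers modulo finite sets; a sequence \<open>x\<close> encodes the set of those \<open>i\<close> for which \<open>x i\<close> is odd.
\<close>

locale almost_homomorphism =
  fixes R :: "nat set \<Rightarrow> nat set \<Rightarrow> bool"
  assumes total: "\<exists>T. R S T"
    and surjective: "\<exists>S. R S T"
    and cong: "R S T \<Longrightarrow> R S' T' \<Longrightarrow> finite (sym_diff S S') \<longleftrightarrow> finite (sym_diff T T')"
    and closed: "R S T \<Longrightarrow> finite (sym_diff T T') \<Longrightarrow> R S T'"
    and inter: "R S T \<Longrightarrow> R S' T' \<Longrightarrow> R (S \<inter> S') (T \<inter> T')"
    and compl: "R S T \<Longrightarrow> R (- S) (- T)"
begin

lemma empty: "R {} {}"
proof -
  obtain T where "R {} T" using total by blast
  from inter[OF this compl[OF this]] show ?thesis by simp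
qed

lemma symdiff:
  assumes "R S T" "R S' T'"
  shows "R (sym_diff S S') (sym_diff T T')"
proof -
  have "R (- (- (S \<inter> - S') \<inter> - (S' \<inter> - S))) (- (- (T \<inter> - T') \<inter> - (T' \<inter> - T)))"
    by (intro compl inter assms)
  moreover have "- (- (S \<inter> - S') \<inter> - (S' \<inter> - S)) = sym_diff S S'" for S S' :: "nat set" by blast
  ultimately show ?thesis by simp
qed

lemma finite_iff:
  assumes "R S T"
  shows "finite S \<longleftrightarrow> finite T"
  using cong[OF assms empty] by simp

text \<open>Only generic codes can be evaluated, so \<open>S\<close> is obtained as a difference:
  \<open>x\<close> and \<open>flip S x\<close> can both be taken in \<open>E\<close>, and after a
  change of the stem of the latter the lifts differ almost exactly on \<open>T\<close>. A large
  \<open>m\<close> in \<open>T\<close> with \<open>g m \<notin> S\<close> would see no change of its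
  coordinate. So almost all of \<open>T\<close> lies in the preimage of \<open>S\<close>, and
  complements give the other inclusion.\<close>

lemma induced_by_function:
  assumes cD: "comeagre D" and loc: "locally_determined D f"
    and f: "\<And>x. x \<in> D \<Longrightarrow> R {i. odd (x i)} {m. odd (f x m)}"
  obtains g where "\<And>S. R S (g -` S)"
proof -
  obtain U :: "nat \<Rightarrow> (nat \<Rightarrow> nat) set" where "(\<forall>k. open (U k)) \<and> (\<forall>k. closure (U k) = UNIV) \<and>
      (\<Inter>k. U k) \<subseteq> D \<and> tail_invariant (\<Inter>k. U k)"
    using comeagre_tail_invariant[OF cD] by (rule exE)
  then have U: "\<And>k. open (U k)" "\<And>k. closure (U k) = UNIV" "(\<Inter>k. U k) \<subseteq> D"
      "tail_invariant (\<Inter>k. U k)" by simp_all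
  define E where "E = (\<Inter>k. U k)"
  define h where "h x m = odd (f x m)" for x m
  have cE: "comeagre E" unfolding E_def by (rule comeagre_INT_open_dense[OF U(1,2)])
  have tE: "tail_invariant E" using U(4) by (simp add: E_def)
  have lE: "locally_determined E h"
    using locally_determined_mono[OF loc, of E] U(3)
    unfolding locally_determined_def h_def E_def by metis
  have hE: "R {i. odd (x i)} {m. h x m}" if "x \<in> E" for x
    using f that U(3) unfolding E_def h_def by blast
  have diff: "R {i. odd (x i) \<noteq> odd (y i)} {m. h x m \<noteq> h y m}" if "x \<in> E" "y \<in> E" for x y
  proof -
    have "sym_diff {i. odd (x i)} {i. odd (y i)} = {i. odd (x i) \<noteq> odd (y i)}"
      "sym_diff {m. h x m} {m. h y m} = {m. h x m \<noteq> h y m}" by auto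
    then show ?thesis using symdiff[OF hE[OF that(1)] hE[OF that(2)]] by (simp only:)
  qed
  have fin: "finite {m. h x m \<noteq> h y m}" if "x \<in> E" "y \<in> E" "\<forall>i\<ge>n. x i = y i" for x y n
  proof -
    have "{i. odd (x i) \<noteq> odd (y i)} \<subseteq> {..<n}" using that(3) by (auto simp: not_le[symmetric])
    then have "finite {i. odd (x i) \<noteq> odd (y i)}" by (rule finite_subset) simp
    then show ?thesis using finite_iff[OF diff[OF that(1,2)]] by simp
  qed
  have disj: "finite {m. h x m \<noteq> h y m \<and> h u m \<noteq> h v m}"
    if "x \<in> E" "y \<in> E" "u \<in> E" "v \<in> E" "\<forall>i. x i = y i \<or> u i = v i" for x y u v
  proof -
    have "\<not> (odd (x i) \<noteq> odd (y i) \<and> odd (u i) \<noteq> odd (v i))" for i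
      using spec[OF that(5), of i] by auto
    then have "{i. odd (x i) \<noteq> odd (y i)} \<inter> {i. odd (u i) \<noteq> odd (v i)} = {}" by auto
    then have "finite ({m. h x m \<noteq> h y m} \<inter> {m. h u m \<noteq> h v m})"
      using finite_iff[OF inter[OF diff[OF that(1,2)] diff[OF that(3,4)]]] by simp
    then show ?thesis by (simp add: Int_def)
  qed
  show thesis
  proof (rule single_coordinate[OF U(1,2) E_def tE lE fin disj])
    fix n s N g
    assume g: "\<And>m::nat. n \<le> g m" "\<And>m x y. N \<le> m \<Longrightarrow> x \<in> E \<inter> cyl n s \<Longrightarrow> y \<in> E \<inter> cyl n s \<Longrightarrow>
        x (g m) = y (g m) \<Longrightarrow> h x m = h y m"
    have key: "finite (T - g -` S)" if "R S T" for S T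
    proof -
      obtain x where x: "x \<in> E" "flip S x \<in> E" "x \<in> cyl n s"
        using comeagre_meets_cyl[OF comeagre_Int[OF cE comeagre_flip[OF cE, of S]], of n s] by auto
      define y where "y = graft n s (flip S x)"
      have y: "y \<in> E" using tE x(2) by (simp add: y_def tail_invariant_def)
      have "sym_diff S {i. odd (x i) \<noteq> odd (y i)} \<subseteq> {..<n}"
        by (auto simp: y_def graft_def odd_flip split: if_splits)
      then have "finite (sym_diff S {i. odd (x i) \<noteq> odd (y i)})" by (rule finite_subset) simp
      then have "finite (sym_diff T {m. h x m \<noteq> h y m})"
        using cong[OF \<open>R S T\<close> diff[OF x(1) y]] by blast
      moreover have "m < N \<or> m \<in> sym_diff T {m. h x m \<noteq> h y m}" if "m \<in> T - g -` S" for m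
      proof (rule disjCI)
        assume "m \<notin> sym_diff T {m. h x m \<noteq> h y m}"
        then have "h x m \<noteq> h y m" using that by blast
        moreover have "y \<in> cyl n s" by (simp add: y_def)
        moreover have "x (g m) = y (g m)"
          using that g(1)[of m] by (simp add: y_def flip_def)
        ultimately show "m < N" using g(2)[of m x y] x(1,3) y by (meson IntI not_le)
      qed
      ultimately show ?thesis
        by (intro finite_subset[of "T - g -` S" "{..<N} \<union> sym_diff T {m. h x m \<noteq> h y m}"]) auto
    qed
    have "R S (g -` S)" for S
    proof -
      obtain T where T: "R S T" using total by blast
      have "finite ((T - g -` S) \<union> (- T - g -` (- S)))" using key[OF T] key[OF compl[OF T]] by simp
      moreover have "(T - g -` S) \<union> (- T - g -` (- S)) = sym_diff T (g -` S)" by blast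
      ultimately show ?thesis using closed[OF T] by simp
    qed
    then show thesis by (rule that)
  qed
qed

text \<open>Preimages under \<open>g\<close> are finite exactly for finite sets; hence
  \<open>g\<close> is finite-to-one with cofinite range. For injectivity, \<open>T\<close> picks the
  least point of each fibre with several points. By surjectivity \<open>T\<close> is almost equal to
  a preimage, which consists of whole fibres; but every fibre that meets \<open>T\<close> also has a
  point outside of \<open>T\<close>, so \<open>T\<close> is finite.\<close>

lemma induced_almost_bijective:
  assumes g: "\<And>S. R S (g -` S)"
  obtains F1 F2 q where "finite F1" "finite F2" "bij_betw q (UNIV - F1) (UNIV - F2)"
    "\<And>n. n \<notin> F1 \<Longrightarrow> g (q n) = n"
proof -
  have fin: "finite (g -` S) \<longleftrightarrow> finite S" for S using finite_iff[OF g[of S]] by simp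
  define M where "M = {m. \<exists>m'. m' \<noteq> m \<and> g m' = g m}"
  define T where "T = {m \<in> M. \<forall>m'. g m' = g m \<longrightarrow> m \<le> m'}"
  obtain S where "R S T" using surjective by blast
  then have S: "finite (sym_diff T (g -` S))" using cong[OF _ g[of S], of S T] by simp
  define c where "c m = (SOME m'. m' \<noteq> m \<and> g m' = g m)" for m
  have c: "c m \<noteq> m \<and> g (c m) = g m" if "m \<in> M" for m
    using that unfolding M_def c_def by (metis (mono_tags, lifting) mem_Collect_eq someI_ex)
  have cT: "c m \<notin> T" if "m \<in> T" for m
    using c[of m] that unfolding T_def by (metis (mono_tags, lifting) le_antisym mem_Collect_eq)
  have "finite (T \<inter> g -` S)"
  proof (rule finite_imageD)
    have "c ` (T \<inter> g -` S) \<subseteq> sym_diff T (g -` S)"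
    proof
      fix x assume "x \<in> c ` (T \<inter> g -` S)"
      then obtain m where m: "x = c m" "m \<in> T" "g m \<in> S" by blast
      then have "g (c m) \<in> S" using c[of m] by (simp add: T_def)
      then show "x \<in> sym_diff T (g -` S)" using m cT[OF m(2)] by simp
    qed
    then show "finite (c ` (T \<inter> g -` S))" using S by (rule finite_subset)
    show "inj_on c (T \<inter> g -` S)"
    proof (rule inj_onI)
      fix a b assume a: "a \<in> T \<inter> g -` S" and b: "b \<in> T \<inter> g -` S" and "c a = c b"
      have "g (c a) = g a" "g (c b) = g b" using a b c by (auto simp: T_def)
      then have gab: "g a = g b" using \<open>c a = c b\<close> by simp
      have "a \<le> b" "b \<le> a" using a b gab by (auto simp: T_def)
      then show "a = b" by simp
    qed
  qed
  moreover have "T - g -` S \<subseteq> sym_diff T (g -` S)" by blast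
  then have "finite (T - g -` S)" using S by (rule finite_subset)
  ultimately have "finite ((T \<inter> g -` S) \<union> (T - g -` S))" by simp
  moreover have "(T \<inter> g -` S) \<union> (T - g -` S) = T" by blast
  ultimately have "finite T" by simp
  then have "finite (g ` T)" by simp
  moreover have "M \<subseteq> g -` (g ` T)"
  proof
    fix m assume m: "m \<in> M"
    define l where "l = (LEAST m'. g m' = g m)"
    have l: "g l = g m" unfolding l_def by (rule LeastI[of _ m]) simp
    have "l \<in> M"
    proof (cases "l = m")
      case False
      then show ?thesis using l unfolding M_def by (metis (mono_tags, lifting) mem_Collect_eq)
    qed (use m in simp)
    moreover have "l \<le> m'" if "g m' = g l" for m'
      unfolding l_def by (rule Least_le) (use that l in simp)
    ultimately have "l \<in> T" by (simp add: T_def)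
    then show "m \<in> g -` (g ` T)" using l by (metis image_eqI vimageI)
  qed
  ultimately have fM: "finite M" using fin finite_subset by metis
  have "finite (- range g)" using fin[of "- range g"] by (auto simp: vimage_def)
  define F1 where "F1 = - range g \<union> g ` M"
  define q where "q n = (SOME m. g m = n)" for n
  have gq: "g (q n) = n" if "n \<in> range g" for n
    using that unfolding q_def by (metis (mono_tags, lifting) imageE someI)
  have "bij_betw q (UNIV - F1) (UNIV - M)"
  proof (rule bij_betw_byWitness[where f' = g])
    show "\<forall>n\<in>UNIV - F1. g (q n) = n" using gq by (auto simp: F1_def)
    show "\<forall>m\<in>UNIV - M. q (g m) = m"
    proof
      fix m assume "m \<in> UNIV - M"
      moreover have "g (q (g m)) = g m" by (rule gq) simp
      ultimately show "q (g m) = m" unfolding M_def by blast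
    qed
    show "q ` (UNIV - F1) \<subseteq> UNIV - M"
    proof
      fix m assume "m \<in> q ` (UNIV - F1)"
      then obtain n where n: "m = q n" "n \<in> range g" "n \<notin> g ` M" by (auto simp: F1_def)
      then show "m \<in> UNIV - M" using gq[OF n(2)] by (metis DiffI UNIV_I image_eqI)
    qed
    show "g ` (UNIV - M) \<subseteq> UNIV - F1"
    proof
      fix n assume "n \<in> g ` (UNIV - M)"
      then obtain m where m: "n = g m" "m \<notin> M" by blast
      have "n \<notin> g ` M"
      proof
        assume "n \<in> g ` M"
        then obtain m' where "m' \<in> M" "g m' = g m" using m(1) by force
        then have "m' \<noteq> m" using m(2) by blast
        with \<open>g m' = g m\<close> m(2) show False unfolding M_def by blast
      qed
      then show "n \<in> UNIV - F1" using m by (simp add: F1_def)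
    qed
  qed
  moreover have "finite F1" using fM \<open>finite (- range g)\<close> by (simp add: F1_def)
  moreover have "g (q n) = n" if "n \<notin> F1" for n using gq that by (simp add: F1_def)
  ultimately show thesis using that[of F1 M q] fM by blast
qed

end

text \<open>
  Otherwise a fusion yields \<open>x\<close> and \<open>y\<close> with \<open>x (g m) = y (g m)\<close> and \<open>\<delta> m (f x m) (f y m) > \<epsilon> / 2\<close> for
  infinitely many \<open>m\<close>: of two points over the stem of \<open>x\<close> whose lifts are more than \<open>\<epsilon>\<close> apart, at
  least one has a lift at distance more than \<open>\<epsilon> / 2\<close> from that of \<open>y\<close>.
\<close>

lemma uniform_stem:
  fixes f :: "(nat \<Rightarrow> nat) \<Rightarrow> nat \<Rightarrow> nat" and \<delta> :: "nat \<Rightarrow> nat \<Rightarrow> nat \<Rightarrow> real"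
  assumes U: "\<And>k. open (U k)" "\<And>k. closure (U k) = UNIV" and DU: "D = (\<Inter>k::nat. U k)"
    and tD: "tail_invariant D" and lf: "locally_determined D f"
    and sym: "\<And>m a b. \<delta> m a b = \<delta> m b a" and tri: "\<And>m a b c. \<delta> m a c \<le> \<delta> m a b + \<delta> m b c"
    and ftone: "\<And>i. finite (g -` {i})"
    and coord: "\<And>x y \<epsilon>. x \<in> D \<Longrightarrow> y \<in> D \<Longrightarrow> 0 < \<epsilon> \<Longrightarrow>
      finite {m. x (g m) = y (g m) \<and> \<epsilon> < \<delta> m (f x m) (f y m)}"
    and eps: "0 < \<epsilon>"
  shows "\<exists>n s N. n0 \<le> n \<and> s \<in> cyl n0 s0 \<and> (\<forall>m x y. N \<le> m \<longrightarrow> x \<in> D \<longrightarrow> x \<in> cyl n s \<longrightarrow> y \<in> D \<longrightarrow>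
    y \<in> cyl n s \<longrightarrow> x (g m) = y (g m) \<longrightarrow> \<delta> m (f x m) (f y m) \<le> \<epsilon>)"
proof (rule ccontr)
  assume no: "\<not> ?thesis"
  define Bad where "Bad n s N m x y \<longleftrightarrow> N \<le> m \<and> x \<in> D \<and> x \<in> cyl n s \<and> y \<in> D \<and>
    y \<in> cyl n s \<and> x (g m) = y (g m) \<and> \<epsilon> < \<delta> m (f x m) (f y m)" for n s N m x y
  have bad: "\<exists>m x y. Bad n s N m x y" if "n0 \<le> n" "s \<in> cyl n0 s0" for n s N
  proof (rule ccontr)
    assume nb: "\<not> ?thesis"
    have "\<forall>m x y. N \<le> m \<longrightarrow> x \<in> D \<longrightarrow> x \<in> cyl n s \<longrightarrow> y \<in> D \<longrightarrow>
      y \<in> cyl n s \<longrightarrow> x (g m) = y (g m) \<longrightarrow> \<delta> m (f x m) (f y m) \<le> \<epsilon>"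
    proof (intro allI impI)
      fix m x y
      assume "N \<le> m" "x \<in> D" "x \<in> cyl n s" "y \<in> D" "y \<in> cyl n s" "x (g m) = y (g m)"
      moreover have "\<not> Bad n s N m x y" using nb by metis
      ultimately show "\<delta> m (f x m) (f y m) \<le> \<epsilon>" by (metis Bad_def not_le)
    qed
    with no that show False by blast
  qed
  \<comment> \<open>With \<open>g m < n'\<close> the equality at \<open>g m\<close> passes from the
    stems to the limits.\<close>
  define Sep where "Sep m n' w \<longleftrightarrow> w True (g m) = w False (g m) \<and> g m < n' \<and>
    (\<forall>\<xi>\<in>D. \<forall>Y\<in>D. \<xi> \<in> cyl n' (w True) \<longrightarrow> Y \<in> cyl n' (w False) \<longrightarrow> \<epsilon> / 2 < \<delta> m (f \<xi> m) (f Y m))"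
    for m n' and w :: "bool \<Rightarrow> nat \<Rightarrow> nat"
  define P where "P k n n' w = ((\<forall>j. cyl n' (w j) \<subseteq> U k) \<and> (\<exists>m\<ge>k. Sep m n' w))"
    for k n n' :: nat and w :: "bool \<Rightarrow> nat \<Rightarrow> nat"
  \<comment> \<open>Failures are known only over stems that extend \<open>s0\<close> beyond
    \<open>n0\<close>, so the fusion must stay there.\<close>
  define Q where "Q n w \<longleftrightarrow> n0 \<le> n \<and> (\<forall>j. w j \<in> cyl n0 s0)" for n and w :: "bool \<Rightarrow> nat \<Rightarrow> nat"
  have step: "\<exists>n' w'. n < n' \<and> (\<forall>j. w' j \<in> cyl n (w j)) \<and> Q n' w' \<and> P k n n' w'"
    if Q: "Q n w" for k n w
  proof -
    have "finite (g -` {..<n})"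
    proof -
      have "g -` {..<n} = (\<Union>i<n. g -` {i})" by auto
      then show ?thesis using ftone by simp
    qed
    then obtain N where N: "\<forall>m\<in>g -` {..<n}. m < N" unfolding finite_nat_set_iff_bounded by (rule exE)
    then have gN: "n \<le> g m" if "N \<le> m" for m using that by (meson lessThan_iff not_le vimageI)
    obtain m p p' where b: "Bad n (w True) (max N k) m p p'"
      using bad[of n "w True" "max N k"] Q unfolding Q_def by metis
    \<comment> \<open>\<open>p\<close> is moved over the stem of the second point; its coordinate
      \<open>g m \<ge> n\<close> is not touched.\<close>
    define y where "y = graft n (w False) p"
    have pD: "p \<in> D" "p' \<in> D" "p \<in> cyl n (w True)" "p' \<in> cyl n (w True)"
        "p (g m) = p' (g m)" "\<epsilon> < \<delta> m (f p m) (f p' m)" "N \<le> m" "k \<le> m"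
      using b by (auto simp: Bad_def)
    have yD: "y \<in> D" using pD(1) tD by (simp add: y_def tail_invariant_def)
    have "\<delta> m (f p m) (f p' m) \<le> \<delta> m (f p m) (f y m) + \<delta> m (f p' m) (f y m)"
      using tri[of m "f p m" "f p' m" "f y m"] sym[of m "f y m" "f p' m"] by simp
    then have "\<epsilon> / 2 < \<delta> m (f p m) (f y m) \<or> \<epsilon> / 2 < \<delta> m (f p' m) (f y m)" using pD(6) by auto
    then obtain x where x: "x \<in> D" "x \<in> cyl n (w True)" "x (g m) = p (g m)" "\<epsilon> / 2 < \<delta> m (f x m) (f y m)"
      using pD by metis
    define v where "v j = (if j then x else y)" for j
    have vD: "v j \<in> D" for j using x(1) yD by (simp add: v_def)
    then have vU: "v j \<in> U k" for j using DU by blast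
    obtain n2 where n2: "max n (g m) < n2" "\<And>j z. j \<in> UNIV \<Longrightarrow> z \<in> D \<Longrightarrow> z \<in> cyl n2 (v j) \<Longrightarrow> f z m = f (v j) m"
      using locally_determined_finite[OF lf finite[of UNIV], where \<xi> = v] vD by metis
    obtain n' where n': "n2 < n'" "\<And>j. j \<in> UNIV \<Longrightarrow> cyl n' (v j) \<subseteq> U k"
      using open_contains_cyl_finite[OF U(1) finite[of UNIV], where \<xi> = v] vU by metis
    have "cyl n' x \<subseteq> cyl n2 x" for x :: "nat \<Rightarrow> nat" using n'(1) by (intro cyl_anti_mono) simp
    note sub = subsetD[OF this]
    have "\<epsilon> / 2 < \<delta> m (f \<xi> m) (f Y m)"
      if "\<xi> \<in> D" "Y \<in> D" "\<xi> \<in> cyl n' (v True)" "Y \<in> cyl n' (v False)" for \<xi> Y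
      using n2(2)[OF UNIV_I that(1) sub[OF that(3)]] n2(2)[OF UNIV_I that(2) sub[OF that(4)]] x(4)
      by (simp add: v_def)
    moreover have "v True (g m) = v False (g m)"
      using x(3) gN[OF pD(7)] by (simp add: v_def y_def)
    ultimately have "Sep m n' v" unfolding Sep_def using n2(1) n'(1) by auto
    then have "P k n n' v" unfolding P_def using n'(2) pD(8) by auto
    moreover have "v j \<in> cyl n (w j)" for j using x(2) by (cases j) (auto simp: v_def y_def)
    moreover have "n < n'" using n2(1) n'(1) by simp
    moreover from calculation have "Q n' v" using Q by (fastforce simp: Q_def)
    ultimately show ?thesis by blast
  qed
  have Q0: "Q n0 (\<lambda>_. s0)" by (simp add: Q_def)
  obtain \<xi> ns xs where \<xi>: "\<And>k j. \<xi> j \<in> cyl (ns k) (xs k j)" "\<And>k. P k (ns k) (ns (Suc k)) (xs (Suc k))"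
    using fusion[of Q n0 "\<lambda>_. s0" P, OF Q0 step] by metis
  have "\<xi> j \<in> U k" for j k
    using \<xi>(1)[of j "Suc k"] \<xi>(2)[of k] unfolding P_def by blast
  then have D: "\<xi> j \<in> D" for j using DU by blast
  have "finite {m. \<xi> True (g m) = \<xi> False (g m) \<and> \<epsilon> / 2 < \<delta> m (f (\<xi> True) m) (f (\<xi> False) m)}"
    using eps by (intro coord[OF D D]) simp
  then obtain K where K: "\<forall>m\<in>{m. \<xi> True (g m) = \<xi> False (g m) \<and> \<epsilon> / 2 < \<delta> m (f (\<xi> True) m) (f (\<xi> False) m)}. m < K"
    unfolding finite_nat_set_iff_bounded by (rule exE)
  obtain m where m: "K \<le> m" "Sep m (ns (Suc K)) (xs (Suc K))"
    using \<xi>(2)[of K] unfolding P_def by blast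
  have "\<epsilon> / 2 < \<delta> m (f (\<xi> True) m) (f (\<xi> False) m)"
    using m(2) D \<xi>(1) unfolding Sep_def by blast
  moreover have "\<xi> j (g m) = xs (Suc K) j (g m)" for j
    using \<xi>(1)[of j "Suc K"] m(2) by (simp add: Sep_def)
  then have "\<xi> True (g m) = \<xi> False (g m)" using m(2) by (simp add: Sep_def)
  ultimately have "m < K" using K by blast
  then show False using m(1) by simp
qed

text \<open>Stems for \<epsilon> = 1/(k+1) are nested, and \<open>\<phi> m a\<close> is the value at
  \<open>m\<close> of the lift of some point of a deep cylinder with value \<open>a\<close> at
  \<open>g m\<close>. An arbitrary \<open>z\<close> is interleaved from two points of a fixed
  cylinder \<open>C k\<close>; beyond a bound each \<open>m\<close> sees one of them, and this one
  is compared with the chosen point inside \<open>C k\<close>.\<close>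

lemma coordinate_maps:
  fixes f :: "(nat \<Rightarrow> nat) \<Rightarrow> nat \<Rightarrow> nat" and \<delta> :: "nat \<Rightarrow> nat \<Rightarrow> nat \<Rightarrow> real"
  assumes cD: "comeagre D" and lf: "locally_determined D f"
    and sym: "\<And>m a b. \<delta> m a b = \<delta> m b a" and tri: "\<And>m a b c. \<delta> m a c \<le> \<delta> m a b + \<delta> m b c"
    and ftone: "\<And>i. finite (g -` {i})"
    and coord: "\<And>x y \<epsilon>. x \<in> D \<Longrightarrow> y \<in> D \<Longrightarrow> 0 < \<epsilon> \<Longrightarrow>
      finite {m. x (g m) = y (g m) \<and> \<epsilon> < \<delta> m (f x m) (f y m)}"
  shows "\<exists>\<phi>. \<forall>z \<epsilon>. 0 < \<epsilon> \<longrightarrow> (\<exists>x\<in>D. \<exists>y\<in>D. \<exists>N. \<forall>m\<ge>N.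
    (x (g m) = z (g m) \<and> \<delta> m (f x m) (\<phi> m (z (g m))) \<le> \<epsilon>) \<or>
    (y (g m) = z (g m) \<and> \<delta> m (f y m) (\<phi> m (z (g m))) \<le> \<epsilon>))"
proof -
  obtain U :: "nat \<Rightarrow> (nat \<Rightarrow> nat) set" where "(\<forall>k. open (U k)) \<and> (\<forall>k. closure (U k) = UNIV) \<and>
      (\<Inter>k. U k) \<subseteq> D \<and> tail_invariant (\<Inter>k. U k)"
    using comeagre_tail_invariant[OF cD] by (rule exE)
  then have U: "\<And>k. open (U k)" "\<And>k. closure (U k) = UNIV" "(\<Inter>k. U k) \<subseteq> D"
      "tail_invariant (\<Inter>k. U k)" by simp_all
  define E where "E = (\<Inter>k. U k)"
  have cE: "comeagre E" unfolding E_def by (rule comeagre_INT_open_dense[OF U(1,2)])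
  have ED: "E \<subseteq> D" using U(3) by (simp add: E_def)
  note lE = locally_determined_mono[OF lf ED]
  note stem = uniform_stem[OF U(1,2) E_def U(4)[folded E_def] lE sym tri ftone coord[OF subsetD[OF ED] subsetD[OF ED]]]
  \<comment> \<open>A triple \<open>s\<close> consists of the length of a stem, the stem and the
    bound for \<open>m\<close>.\<close>
  define Good where "Good k s \<longleftrightarrow> (\<forall>m x y. snd (snd s) \<le> m \<longrightarrow> x \<in> E \<longrightarrow> x \<in> cyl (fst s) (fst (snd s)) \<longrightarrow> y \<in> E \<longrightarrow>
    y \<in> cyl (fst s) (fst (snd s)) \<longrightarrow> x (g m) = y (g m) \<longrightarrow> \<delta> m (f x m) (f y m) \<le> 1 / (real k + 1)) \<and>
    (\<forall>m\<ge>snd (snd s). fst s \<le> g m)" for k and s :: "nat \<times> (nat \<Rightarrow> nat) \<times> nat"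
  have ex: "\<exists>s. Good k s \<and> n0 \<le> fst s \<and> fst (snd s) \<in> cyl n0 s0" for k n0 s0
  proof -
    obtain n s N where s: "n0 \<le> n" "s \<in> cyl n0 s0" "\<forall>m x y. N \<le> m \<longrightarrow> x \<in> E \<longrightarrow> x \<in> cyl n s \<longrightarrow> y \<in> E \<longrightarrow>
      y \<in> cyl n s \<longrightarrow> x (g m) = y (g m) \<longrightarrow> \<delta> m (f x m) (f y m) \<le> 1 / (real k + 1)"
      using stem[of "1 / (real k + 1)" n0 s0] by (metis add_nonneg_pos of_nat_0_le_iff zero_less_divide_1_iff zero_less_one)
    have "finite (g -` {..<n})"
    proof -
      have "g -` {..<n} = (\<Union>i<n. g -` {i})" by auto
      then show ?thesis using ftone by simp
    qed
    then obtain M where M: "\<forall>m\<in>g -` {..<n}. m < M" unfolding finite_nat_set_iff_bounded by (rule exE)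
    have "n \<le> g m" if "M \<le> m" for m using M that by (meson lessThan_iff not_le vimageI)
    then have "Good k (n, s, max N M)" using s(3) unfolding Good_def by simp
    then show ?thesis using s(1,2) by force
  qed
  have "\<exists>t. \<forall>k. Good k (t k) \<and> (fst (t k) \<le> fst (t (Suc k)) \<and> fst (snd (t (Suc k))) \<in> cyl (fst (t k)) (fst (snd (t k))))"
  proof (rule dependent_nat_choice)
    show "\<exists>s. Good 0 s" using ex[of 0 0 undefined] by blast
    show "\<exists>s'. Good (Suc k) s' \<and> (fst s \<le> fst s' \<and> fst (snd s') \<in> cyl (fst s) (fst (snd s)))" for s k
      using ex[of "Suc k" "fst s" "fst (snd s)"] by blast
  qed
  then obtain t where t: "\<And>k. Good k (t k)" "\<And>k. fst (t k) \<le> fst (t (Suc k))"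
    "\<And>k. fst (snd (t (Suc k))) \<in> cyl (fst (t k)) (fst (snd (t k)))" by metis
  define C where "C k = cyl (fst (t k)) (fst (snd (t k)))" for k
  define N where "N k = snd (snd (t k))" for k
  have "C (Suc k) \<subseteq> C k" for k
    using t(2)[of k] t(3)[of k] unfolding C_def by auto
  then have C_anti: "k \<le> l \<Longrightarrow> C l \<subseteq> C k" for k l by (rule lift_Suc_antimono_le)
  \<comment> \<open>The largest \<open>k \<le> m\<close> whose bound \<open>N k\<close> has been
    passed. It tends to infinity, so that one \<open>\<phi>\<close> serves all \<epsilon>;
    \<open>k \<le> m\<close> makes the set finite, and \<open>0\<close> makes it nonempty.\<close>
  define \<kappa> where "\<kappa> m = Max (insert 0 {k. k \<le> m \<and> N k \<le> m})" for m
  have \<kappa>: "k \<le> \<kappa> m \<and> N (\<kappa> m) \<le> m" if "k \<le> m" "N k \<le> m" for k m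
  proof -
    have fin: "finite {k. k \<le> m \<and> N k \<le> m}" by simp
    have k: "k \<le> \<kappa> m" unfolding \<kappa>_def using that fin by (intro Max_ge) auto
    have "\<kappa> m \<in> insert 0 {k. k \<le> m \<and> N k \<le> m}" unfolding \<kappa>_def using fin by (intro Max_in) auto
    then have "N (\<kappa> m) \<le> m" using k that(2) by (cases "\<kappa> m = 0") auto
    with k show ?thesis by blast
  qed
  define \<phi> where "\<phi> m a = f (SOME x. x \<in> E \<and> x \<in> C (\<kappa> m) \<and> x (g m) = a) m" for m a
  have "\<exists>x\<in>D. \<exists>y\<in>D. \<exists>N. \<forall>m\<ge>N.
    (x (g m) = z (g m) \<and> \<delta> m (f x m) (\<phi> m (z (g m))) \<le> \<epsilon>) \<or>
    (y (g m) = z (g m) \<and> \<delta> m (f y m) (\<phi> m (z (g m))) \<le> \<epsilon>)" if eps: "0 < \<epsilon>" for z \<epsilon>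
  proof -
    obtain k where k: "1 / (real k + 1) < \<epsilon>"
      using reals_Archimedean[OF eps] by (auto simp: inverse_eq_divide add.commute)
    obtain x y where xy: "x \<in> E" "y \<in> E" "x \<in> C k" "y \<in> C k" "\<And>i. fst (t k) \<le> i \<Longrightarrow> x i = z i \<or> y i = z i"
      using comeagre_interleave[OF cE, of "fst (t k)" "fst (snd (t k))" z] unfolding C_def by metis
    have main: "\<delta> m (f v m) (\<phi> m (z (g m))) \<le> \<epsilon>"
      if m: "max k (N k) \<le> m" and v: "v \<in> E" "v \<in> C k" "v (g m) = z (g m)" for m v
    proof -
      have km: "k \<le> \<kappa> m" "N (\<kappa> m) \<le> m" using \<kappa>[of k m] m by auto
      have "fst (t (\<kappa> m)) \<le> g m" using t(1)[of "\<kappa> m"] km(2) by (simp add: Good_def N_def)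
      \<comment> \<open>The stem ends at or before \<open>g m\<close>, so the value
        \<open>z (g m)\<close> may be prescribed behind it.\<close>
      moreover obtain u where u: "u \<in> E" "u \<in> cyl (Suc (g m)) (graft (fst (t (\<kappa> m))) (fst (snd (t (\<kappa> m)))) z)"
        using comeagre_meets_cyl[OF cE] by metis
      ultimately have "u \<in> C (\<kappa> m) \<and> u (g m) = z (g m)" by (simp add: C_def)
      with u(1) have "\<exists>u. u \<in> E \<and> u \<in> C (\<kappa> m) \<and> u (g m) = z (g m)" by blast
      then obtain w where w: "w \<in> E \<and> w \<in> C (\<kappa> m) \<and> w (g m) = z (g m)" "\<phi> m (z (g m)) = f w m"
        unfolding \<phi>_def by (metis (mono_tags, lifting) someI_ex)
      have "w \<in> C k" using w(1) C_anti[OF km(1)] by blast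
      then have "\<delta> m (f v m) (f w m) \<le> 1 / (real k + 1)"
        using t(1)[of k] v w(1) m unfolding Good_def C_def N_def by auto
      then show ?thesis using w(2) k by simp
    qed
    have "(x (g m) = z (g m) \<and> \<delta> m (f x m) (\<phi> m (z (g m))) \<le> \<epsilon>) \<or>
        (y (g m) = z (g m) \<and> \<delta> m (f y m) (\<phi> m (z (g m))) \<le> \<epsilon>)" if m: "max k (N k) \<le> m" for m
    proof -
      have "fst (t k) \<le> g m" using t(1)[of k] m by (simp add: Good_def N_def)
      then have "x (g m) = z (g m) \<or> y (g m) = z (g m)" by (rule xy(5))
      then show ?thesis using main[OF m] xy(1-4) by blast
    qed
    then show ?thesis using xy(1,2) ED by blast
  qed
  then show ?thesis by (intro exI[of _ \<phi>] allI impI)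
qed

section \<open>Elementary \<open>C\<^sup>*\<close>-algebra\<close>

lemma complex_ring_simps [simp]:
  "carrier complex_ring = UNIV" "one complex_ring = 1" "zero complex_ring = 0"
  "monoid.mult complex_ring = (*)" "add complex_ring = (+)"
  by (auto simp: ring_of_type_algebra_def)

context unital_cstar_algebra
begin

lemma scale_closed [simp, intro]: "x \<in> carrier A \<Longrightarrow> c \<odot> x \<in> carrier A"
  using smult_closed[of c x] by simp

lemma scale_add_left: "x \<in> carrier A \<Longrightarrow> (c + d) \<odot> x = c \<odot> x \<oplus> d \<odot> x"
  using smult_l_distr[of c d x] by simp

lemma scale_add_right: "x \<in> carrier A \<Longrightarrow> y \<in> carrier A \<Longrightarrow> c \<odot> (x \<oplus> y) = c \<odot> x \<oplus> c \<odot> y"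
  using smult_r_distr[of c x y] by simp

lemma scale_scale: "x \<in> carrier A \<Longrightarrow> c \<odot> (d \<odot> x) = (c * d) \<odot> x"
  using smult_assoc1[of c d x] by simp

lemma scale_one [simp]: "x \<in> carrier A \<Longrightarrow> 1 \<odot> x = x"
  using smult_one[of x] by simp

lemma scale_zero_left [simp]: "x \<in> carrier A \<Longrightarrow> 0 \<odot> x = \<zero>"
  using smult_l_null[of x] by simp

lemma scale_uminus_one: "x \<in> carrier A \<Longrightarrow> (-1) \<odot> x = \<ominus> x"
proof -
  assume x: "x \<in> carrier A"
  have "(-1) \<odot> x \<oplus> x = \<zero>" using scale_add_left[OF x, of "-1" 1] x by simp
  then show ?thesis using x by (simp add: minus_equality)
qed

lemma scale_minus: "x \<in> carrier A \<Longrightarrow> y \<in> carrier A \<Longrightarrow> c \<odot> (x \<ominus> y) = c \<odot> x \<ominus> c \<odot> y"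
  unfolding a_minus_def
  by (simp add: scale_add_right scale_uminus_one[symmetric] scale_scale)

lemma scale_half_double: "x \<in> carrier A \<Longrightarrow> (1 / 2) \<odot> x \<oplus> (1 / 2) \<odot> x = x"
  using scale_add_left[of x "1/2" "1/2"] by simp

lemma adj_closed' [simp, intro]: "x \<in> carrier A \<Longrightarrow> adj A x \<in> carrier A"
  by (rule adj_closed)

lemma adj_one [simp]: "adj A \<one> = \<one>"
  using adj_mult[of "adj A \<one>" \<one>] adj_adj[of \<one>] by simp

lemma adj_uminus: "x \<in> carrier A \<Longrightarrow> adj A (\<ominus> x) = \<ominus> adj A x"
  using adj_smult[of x "-1"] by (simp add: scale_uminus_one)

lemma adj_minus: "x \<in> carrier A \<Longrightarrow> y \<in> carrier A \<Longrightarrow> adj A (x \<ominus> y) = adj A x \<ominus> adj A y"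
  unfolding a_minus_def by (simp add: adj_add adj_uminus)

lemma nrm_zero [simp]: "nrm A \<zero> = 0"
  using nrm_eq_zero[of \<zero>] by simp

lemma nrm_uminus: "x \<in> carrier A \<Longrightarrow> nrm A (\<ominus> x) = nrm A x"
  using nrm_smult[of x "-1"] by (simp add: scale_uminus_one)

lemma nrm_nonneg [simp]: "x \<in> carrier A \<Longrightarrow> 0 \<le> nrm A x"
  using nrm_triangle[of x "\<ominus> x"] by (simp add: nrm_uminus r_neg)

lemma nrm_minus: "x \<in> carrier A \<Longrightarrow> y \<in> carrier A \<Longrightarrow> nrm A (x \<ominus> y) \<le> nrm A x + nrm A y"
  unfolding a_minus_def using nrm_triangle[of x "\<ominus> y"] by (simp add: nrm_uminus)

lemma nrm_minus_commute: "x \<in> carrier A \<Longrightarrow> y \<in> carrier A \<Longrightarrow> nrm A (x \<ominus> y) = nrm A (y \<ominus> x)"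
  using nrm_uminus[of "x \<ominus> y"] by (simp add: a_minus_def minus_add a_comm)

lemma nrm_minus_triangle:
  assumes "x \<in> carrier A" "y \<in> carrier A" "z \<in> carrier A"
  shows "nrm A (x \<ominus> z) \<le> nrm A (x \<ominus> y) + nrm A (y \<ominus> z)"
proof -
  have "x \<ominus> z = (x \<ominus> y) \<oplus> (y \<ominus> z)" using assms by algebra
  then show ?thesis using nrm_triangle[of "x \<ominus> y" "y \<ominus> z"] assms by simp
qed

lemma nrm_le_minus:
  assumes "x \<in> carrier A" "y \<in> carrier A"
  shows "nrm A x \<le> nrm A y + nrm A (x \<ominus> y)"
proof -
  have "x = y \<oplus> (x \<ominus> y)" using assms by algebra
  then show ?thesis using nrm_triangle[of y "x \<ominus> y"] assms by simp
qed

lemma nrm_adj [simp]: "x \<in> carrier A \<Longrightarrow> nrm A (adj A x) = nrm A x"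
proof -
  have le: "nrm A y \<le> nrm A (adj A y)" if "y \<in> carrier A" for y
  proof -
    have "nrm A y * nrm A y \<le> nrm A (adj A y) * nrm A y"
      using cstar_identity[OF that] nrm_mult[of "adj A y" y] that by (simp add: power2_eq_square)
    then show ?thesis using that nrm_nonneg[OF that] nrm_nonneg[of "adj A y"]
      by (cases "nrm A y = 0") (auto simp: mult_le_cancel_right)
  qed
  assume "x \<in> carrier A"
  then show ?thesis using le[of x] le[of "adj A x"] adj_adj[of x] by auto
qed

lemma nrm_one [simp]: "nrm A \<one> = 1"
proof -
  have "nrm A \<one> = (nrm A \<one>)\<^sup>2" using cstar_identity[of \<one>] by simp
  moreover have "nrm A \<one> \<noteq> 0" using nrm_eq_zero[of \<one>] one_neq_zero by simp
  ultimately show ?thesis by (simp add: power2_eq_square)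
qed

lemma nrm_unitary: "u \<in> carrier A \<Longrightarrow> adj A u \<otimes> u = \<one> \<Longrightarrow> nrm A u = 1"
  by (metis cstar_identity nrm_nonneg nrm_one one_power2 power2_eq_imp_eq zero_le_one)

sublocale dist: Metric_space "carrier A" "carrier_dist A (nrm A)"
proof
  show "0 \<le> carrier_dist A (nrm A) x y" for x y by (simp add: carrier_dist_def)
  show "carrier_dist A (nrm A) x y = carrier_dist A (nrm A) y x" for x y
    by (simp add: carrier_dist_def nrm_minus_commute)
  show "carrier_dist A (nrm A) x y = 0 \<longleftrightarrow> x = y" if "x \<in> carrier A" "y \<in> carrier A" for x y
    using that by (simp add: carrier_dist_def nrm_eq_zero r_right_minus_eq)
  show "carrier_dist A (nrm A) x z \<le> carrier_dist A (nrm A) x y + carrier_dist A (nrm A) y z"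
    if "x \<in> carrier A" "y \<in> carrier A" "z \<in> carrier A" for x y z
    using that by (simp add: carrier_dist_def nrm_minus_triangle)
qed

lemma limitin_dist_iff:
  "limitin dist.mtopology v l sequentially \<longleftrightarrow>
    l \<in> carrier A \<and> (\<forall>\<epsilon>>0. \<exists>N. \<forall>n\<ge>N. v n \<in> carrier A \<and> nrm A (v n \<ominus> l) < \<epsilon>)"
  unfolding dist.limit_metric_sequentially carrier_dist_def by (auto; metis)

lemma eqI_small:
  assumes "x \<in> carrier A" "y \<in> carrier A" "\<And>\<epsilon>. 0 < \<epsilon> \<Longrightarrow> nrm A (x \<ominus> y) \<le> K * \<epsilon>"
  shows "x = y"
proof -
  have "nrm A (x \<ominus> y) \<le> 0"
  proof (rule field_le_epsilon)
    fix e :: real assume "0 < e"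
    then have "nrm A (x \<ominus> y) \<le> K * (e / (\<bar>K\<bar> + 1))" by (intro assms(3)) simp
    also have "\<dots> \<le> e"
    proof -
      have "K / (\<bar>K\<bar> + 1) \<le> 1" using abs_ge_self[of K] by (simp add: divide_le_eq)
      then have "K / (\<bar>K\<bar> + 1) * e \<le> 1 * e" using \<open>0 < e\<close> by (intro mult_right_mono) auto
      then show ?thesis by simp
    qed
    finally show "nrm A (x \<ominus> y) \<le> 0 + e" by simp
  qed
  then have "nrm A (x \<ominus> y) = 0" using assms(1,2) by (intro antisym nrm_nonneg) auto
  then show ?thesis using assms(1,2) by (simp add: nrm_eq_zero r_right_minus_eq)
qed

text \<open>
  With \<open>w = \<one> \<ominus> r\<close> the equation \<open>w\<^sup>2 (\<one> \<oplus> s) = \<one>\<close> becomes the fixed point equation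
  \<open>r = (s - 2rs + r\<^sup>2 + r\<^sup>2s) / 2\<close>, whose right-hand side is a contraction of the ball of
  radius \<open>nrm A s\<close>.
\<close>

lemma inverse_sqrt:
  assumes s: "s \<in> carrier A" "adj A s = s" "nrm A s \<le> 1 / 4" and z: "z \<in> carrier A"
    and comm: "\<And>r. r \<in> carrier A \<Longrightarrow> r \<otimes> z = z \<otimes> r \<Longrightarrow> r \<otimes> s = s \<otimes> r"
  obtains w where "w \<in> carrier A" "adj A w = w" "w \<otimes> z = z \<otimes> w" "w \<otimes> w \<otimes> (\<one> \<oplus> s) = \<one>"
    "nrm A (w \<ominus> \<one>) \<le> nrm A s"
proof -
  \<comment> \<open>Selfadjointness and commutation with \<open>z\<close> are closed conditions;
    building them into the complete set lets the fixed point inherit them.\<close>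
  define S where "S = {r \<in> carrier A. nrm A r \<le> nrm A s \<and> adj A r = r \<and> r \<otimes> z = z \<otimes> r}"
  have SA: "S \<subseteq> carrier A" by (auto simp: S_def)
  define T where "T r = (1 / 2) \<odot> (s \<ominus> (r \<otimes> s \<oplus> r \<otimes> s) \<oplus> r \<otimes> r \<oplus> r \<otimes> r \<otimes> s)" for r
  have sz: "z \<otimes> s = s \<otimes> z" using comm[OF z] by simp
  have closed: "closedin dist.mtopology S"
    unfolding dist.metric_closedin_iff_sequentially_closed
  proof (intro conjI SA allI impI)
    fix v l assume as: "range v \<subseteq> S \<and> limitin dist.mtopology v l sequentially"
    then have l: "l \<in> carrier A" by (simp add: limitin_dist_iff)
    have appr: "\<exists>r\<in>S. nrm A (r \<ominus> l) < \<epsilon>" if "0 < \<epsilon>" for \<epsilon>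
      using as that unfolding limitin_dist_iff by (metis order_refl rangeI subsetD)
    have "nrm A l \<le> nrm A s + \<epsilon>" if \<epsilon>: "0 < \<epsilon>" for \<epsilon>
    proof -
      obtain r where r: "r \<in> S" "nrm A (r \<ominus> l) < \<epsilon>" using appr[OF \<epsilon>] by blast
      then have rc: "r \<in> carrier A" "nrm A r \<le> nrm A s" by (auto simp: S_def)
      then show ?thesis using nrm_le_minus[OF l, of r] nrm_minus_commute[OF l, of r] r(2) by simp
    qed
    then have 1: "nrm A l \<le> nrm A s" by (rule field_le_epsilon)
    have 2: "adj A l = l"
    proof (rule eqI_small[where K = 2])
      fix \<epsilon> :: real assume \<epsilon>: "0 < \<epsilon>"
      obtain r where r: "r \<in> S" "nrm A (r \<ominus> l) < \<epsilon>" using appr[OF \<epsilon>] by blast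
      then have rc: "r \<in> carrier A" "adj A r = r" by (auto simp: S_def)
      have "nrm A (adj A l \<ominus> r) = nrm A (r \<ominus> l)"
        using nrm_adj[of "l \<ominus> r"] rc l by (simp add: adj_minus nrm_minus_commute[of l r])
      then show "nrm A (adj A l \<ominus> l) \<le> 2 * \<epsilon>"
        using nrm_minus_triangle[of "adj A l" r l] rc l r(2) by simp
    qed (use l in auto)
    have 3: "l \<otimes> z = z \<otimes> l"
    proof (rule eqI_small[where K = "2 * nrm A z"])
      fix \<epsilon> :: real assume \<epsilon>: "0 < \<epsilon>"
      obtain r where r: "r \<in> S" "nrm A (r \<ominus> l) < \<epsilon>" using appr[OF \<epsilon>] by blast
      then have rc: "r \<in> carrier A" "r \<otimes> z = z \<otimes> r" by (auto simp: S_def)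
      have "l \<otimes> z \<ominus> z \<otimes> l = (r \<otimes> z \<ominus> (r \<ominus> l) \<otimes> z) \<ominus> (z \<otimes> r \<ominus> z \<otimes> (r \<ominus> l))"
        using rc(1) l z by algebra
      also have "\<dots> = z \<otimes> (r \<ominus> l) \<ominus> (r \<ominus> l) \<otimes> z"
        unfolding rc(2) using rc(1) l z by algebra
      finally have "nrm A (l \<otimes> z \<ominus> z \<otimes> l) \<le> nrm A (z \<otimes> (r \<ominus> l)) + nrm A ((r \<ominus> l) \<otimes> z)"
        using nrm_minus[of "z \<otimes> (r \<ominus> l)" "(r \<ominus> l) \<otimes> z"] rc(1) l z by simp
      also have "\<dots> \<le> nrm A z * nrm A (r \<ominus> l) + nrm A (r \<ominus> l) * nrm A z"
        using rc(1) l z by (intro add_mono nrm_mult) auto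
      also have "\<dots> \<le> 2 * nrm A z * \<epsilon>"
        using r(2) mult_left_mono[of "nrm A (r \<ominus> l)" \<epsilon> "nrm A z"] nrm_nonneg[OF z] by (simp add: mult.commute)
      finally show "nrm A (l \<otimes> z \<ominus> z \<otimes> l) \<le> 2 * nrm A z * \<epsilon>" .
    qed (use l z in auto)
    show "l \<in> S" using l 1 2 3 by (simp add: S_def)
  qed
  interpret sub: Submetric "carrier A" "carrier_dist A (nrm A)" S
    by unfold_locales (rule SA)
  have comp: "sub.sub.mcomplete" using sub.closedin_mcomplete_imp_mcomplete[OF closed complete] .
  have Tc: "T r \<in> carrier A" if "r \<in> carrier A" for r using that s(1) by (simp add: T_def)
  have T_double: "T r \<oplus> T r = s \<ominus> (r \<otimes> s \<oplus> r \<otimes> s) \<oplus> r \<otimes> r \<oplus> r \<otimes> r \<otimes> s" if "r \<in> carrier A" for r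
    unfolding T_def using that s(1) by (intro scale_half_double) simp
  have half: "nrm A ((1 / 2) \<odot> x) = nrm A x / 2" if "x \<in> carrier A" for x
    using nrm_smult[OF that, of "1/2"] by simp
  have sn: "0 \<le> nrm A s" using s by simp
  have TS: "T r \<in> S" if r: "r \<in> S" for r
  proof -
    have rc: "r \<in> carrier A" "nrm A r \<le> nrm A s" "adj A r = r" "r \<otimes> z = z \<otimes> r" using r by (auto simp: S_def)
    have rs: "r \<otimes> s = s \<otimes> r" using comm rc by blast
    have mult: "nrm A (x \<otimes> y) \<le> p * q" if "x \<in> carrier A" "y \<in> carrier A" "nrm A x \<le> p" "nrm A y \<le> q" for x y p q
      using nrm_mult[OF that(1,2)] mult_mono[OF that(3,4)] that nrm_nonneg[OF that(1)] nrm_nonneg[OF that(2)] by linarith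
    define q where "q = nrm A s"
    have q: "0 \<le> q" "q \<le> 1 / 4" using s sn by (auto simp: q_def)
    have n1: "nrm A (r \<otimes> s) \<le> q * q" "nrm A (r \<otimes> r) \<le> q * q"
      using rc s by (auto intro!: mult simp: q_def)
    have n2: "nrm A (r \<otimes> r \<otimes> s) \<le> q * q * q"
      using n1(2) rc s by (intro mult) (auto simp: q_def)
    have "nrm A (s \<ominus> (r \<otimes> s \<oplus> r \<otimes> s) \<oplus> r \<otimes> r \<oplus> r \<otimes> r \<otimes> s) \<le>
        nrm A s + (nrm A (r \<otimes> s) + nrm A (r \<otimes> s)) + nrm A (r \<otimes> r) + nrm A (r \<otimes> r \<otimes> s)"
      using nrm_triangle[of "s \<ominus> (r \<otimes> s \<oplus> r \<otimes> s) \<oplus> r \<otimes> r" "r \<otimes> r \<otimes> s"]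
        nrm_triangle[of "s \<ominus> (r \<otimes> s \<oplus> r \<otimes> s)" "r \<otimes> r"] nrm_minus[of s "r \<otimes> s \<oplus> r \<otimes> s"]
        nrm_triangle[of "r \<otimes> s" "r \<otimes> s"] rc(1) s(1) by simp
    also have "\<dots> \<le> q + 3 * (q * q) + q * q * q" using n1 n2 by (simp add: q_def)
    \<comment> \<open>By \<open>q \<le> 1 / 4\<close> one has \<open>3 * q + q * q \<le> 1\<close>;
      this keeps the ball of radius \<open>nrm A s\<close> invariant.\<close>
    also have "\<dots> \<le> 2 * q"
    proof -
      have "q * q \<le> q * (1 / 4)" using q by (intro mult_left_mono) auto
      moreover have "q * q * q \<le> q * (1 / 4) * (1 / 4)" using q calculation by (intro mult_mono) auto
      ultimately show ?thesis using q by linarith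
    qed
    finally have 1: "nrm A (T r) \<le> nrm A s" unfolding T_def using rc(1) s(1) by (subst half) (auto simp: q_def)
    have 2: "adj A (T r) = T r"
    proof -
      have "adj A (r \<otimes> s) = r \<otimes> s" using rc s rs by (simp add: adj_mult)
      moreover have "adj A (r \<otimes> r) = r \<otimes> r" using rc by (simp add: adj_mult)
      moreover have "adj A (r \<otimes> r \<otimes> s) = r \<otimes> r \<otimes> s"
      proof -
        have "adj A (r \<otimes> r \<otimes> s) = s \<otimes> (r \<otimes> r)" using rc s by (simp add: adj_mult)
        also have "\<dots> = (r \<otimes> s) \<otimes> r" using rc(1) s(1) by (simp add: m_assoc rs)
        also have "\<dots> = r \<otimes> (s \<otimes> r)" using rc(1) s(1) by (simp add: m_assoc)
        also have "\<dots> = r \<otimes> (r \<otimes> s)" by (simp only: rs)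
        also have "\<dots> = r \<otimes> r \<otimes> s" using rc(1) s(1) by (simp add: m_assoc)
        finally show ?thesis .
      qed
      ultimately show ?thesis unfolding T_def using rc(1) s
        by (simp add: adj_smult adj_add adj_minus)
    qed
    have 3: "T r \<otimes> z = z \<otimes> T r"
    proof -
      have com: "x \<otimes> y \<otimes> z = z \<otimes> (x \<otimes> y)"
        if "x \<in> carrier A" "y \<in> carrier A" "x \<otimes> z = z \<otimes> x" "y \<otimes> z = z \<otimes> y" for x y
        using that z by (metis m_assoc)
      have "r \<otimes> s \<otimes> z = z \<otimes> (r \<otimes> s)" "r \<otimes> r \<otimes> z = z \<otimes> (r \<otimes> r)"
        using com rc s sz by auto
      moreover from this(2) have "r \<otimes> r \<otimes> s \<otimes> z = z \<otimes> (r \<otimes> r \<otimes> s)"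
        using com[of "r \<otimes> r" s] rc s sz by auto
      ultimately show ?thesis unfolding T_def using rc(1) s(1) z sz
        by (simp add: smult_mult_left smult_mult_right a_minus_def l_distr r_distr l_minus r_minus)
    qed
    show ?thesis using 1 2 3 Tc[OF rc(1)] by (simp add: S_def)
  qed
  have contr: "carrier_dist A (nrm A) (T r) (T r') \<le> (3 / 4) * carrier_dist A (nrm A) r r'"
    if r: "r \<in> S" and r': "r' \<in> S" for r r'
  proof -
    have rc: "r \<in> carrier A" "nrm A r \<le> nrm A s" "r' \<in> carrier A" "nrm A r' \<le> nrm A s"
      using r r' by (auto simp: S_def)
    define e where "e = r \<ominus> r'"
    have e: "e \<in> carrier A" using rc by (simp add: e_def)
    define q where "q = nrm A e"
    have q: "0 \<le> q" using e by (simp add: q_def)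
    \<comment> \<open>The noncommutative difference of squares,
      \<open>r \<otimes> r \<ominus> r' \<otimes> r'\<close>.\<close>
    define y where "y = r \<otimes> e \<oplus> e \<otimes> r'"
    have y: "y \<in> carrier A" using rc e by (simp add: y_def)
    have "T r \<ominus> T r' = (1 / 2) \<odot> ((s \<ominus> (r \<otimes> s \<oplus> r \<otimes> s) \<oplus> r \<otimes> r \<oplus> r \<otimes> r \<otimes> s) \<ominus>
        (s \<ominus> (r' \<otimes> s \<oplus> r' \<otimes> s) \<oplus> r' \<otimes> r' \<oplus> r' \<otimes> r' \<otimes> s))"
      unfolding T_def using rc s(1) by (intro scale_minus[symmetric]) auto
    also have "(s \<ominus> (r \<otimes> s \<oplus> r \<otimes> s) \<oplus> r \<otimes> r \<oplus> r \<otimes> r \<otimes> s) \<ominus>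
        (s \<ominus> (r' \<otimes> s \<oplus> r' \<otimes> s) \<oplus> r' \<otimes> r' \<oplus> r' \<otimes> r' \<otimes> s) = (y \<oplus> y \<otimes> s) \<ominus> (e \<otimes> s \<oplus> e \<otimes> s)"
      unfolding y_def e_def using rc(1,3) s(1) by algebra
    finally have "nrm A (T r \<ominus> T r') = nrm A ((y \<oplus> y \<otimes> s) \<ominus> (e \<otimes> s \<oplus> e \<otimes> s)) / 2"
      using half y e s(1) by simp
    also have "\<dots> \<le> (nrm A y + nrm A (y \<otimes> s) + 2 * nrm A (e \<otimes> s)) / 2"
      using nrm_minus[of "y \<oplus> y \<otimes> s" "e \<otimes> s \<oplus> e \<otimes> s"] nrm_triangle[of y "y \<otimes> s"]
        nrm_triangle[of "e \<otimes> s" "e \<otimes> s"] y e s(1) by simp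
    also have "\<dots> \<le> (3 / 4) * q"
    proof -
      have "nrm A (r \<otimes> e) \<le> (1 / 4) * q" "nrm A (e \<otimes> r') \<le> (1 / 4) * q" "nrm A (e \<otimes> s) \<le> (1 / 4) * q"
        using nrm_mult[of r e] nrm_mult[of e r'] nrm_mult[of e s] rc s e q
          mult_right_mono[of "nrm A r" "1/4" q] mult_left_mono[of "nrm A r'" "1/4" q]
          mult_left_mono[of "nrm A s" "1/4" q] by (auto simp: q_def)
      then have "nrm A y \<le> q / 2" "nrm A (e \<otimes> s) \<le> q / 4"
        using nrm_triangle[of "r \<otimes> e" "e \<otimes> r'"] rc e by (auto simp: y_def)
      moreover have "nrm A (y \<otimes> s) \<le> (q / 2) * (1 / 4)"
        using nrm_mult[OF y s(1)] mult_mono[OF calculation(1) s(3)] q sn by simp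
      ultimately show ?thesis using q by argo
    qed
    finally show ?thesis using rc Tc by (simp add: carrier_dist_def q_def e_def)
  qed
  have "\<zero> \<in> S" using z sn adj_uminus[of \<zero>] adj_smult[of \<zero> 0] by (simp add: S_def)
  then have ne: "S \<noteq> {}" by blast
  have TSS: "T \<in> S \<rightarrow> S" using TS by (rule Pi_I)
  have lt: "3 / 4 < (1 :: real)" by simp
  obtain r where r: "r \<in> S" "T r = r"
    by (rule sub.sub.Banach_fixedpoint_thm[OF comp ne TSS lt contr])
  then have rc: "r \<in> carrier A" "nrm A r \<le> nrm A s" "adj A r = r" "r \<otimes> z = z \<otimes> r" by (auto simp: S_def)
  have "(\<one> \<ominus> r) \<otimes> (\<one> \<ominus> r) \<otimes> (\<one> \<oplus> s) =
      \<one> \<oplus> ((s \<ominus> (r \<otimes> s \<oplus> r \<otimes> s) \<oplus> r \<otimes> r \<oplus> r \<otimes> r \<otimes> s) \<ominus> (r \<oplus> r))"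
    using rc(1) s(1) by algebra simp
  also have "\<dots> = \<one> \<oplus> ((r \<oplus> r) \<ominus> (r \<oplus> r))"
    using T_double[OF rc(1)] unfolding r(2) by (simp only:)
  also have "\<dots> = \<one>" using rc(1) by simp
  finally have eq: "(\<one> \<ominus> r) \<otimes> (\<one> \<ominus> r) \<otimes> (\<one> \<oplus> s) = \<one>" .
  have "(\<one> \<ominus> r) \<otimes> z = z \<otimes> (\<one> \<ominus> r)"
    using rc z by (simp add: a_minus_def l_distr r_distr l_minus r_minus)
  moreover have "\<one> \<ominus> r \<ominus> \<one> = \<ominus> r" using rc(1) by algebra
  ultimately show thesis
    using that[of "\<one> \<ominus> r"] eq rc by (simp add: adj_minus nrm_uminus)
qed

end

section \<open>Unitaries, projections and dense sequences\<close>

context unital_cstar_algebra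
begin

text \<open>The unitary is a + i (1 - a^2)^(1/2). With s = - a^2 the root is w (1 + s), where
  \<open>w\<close> is the inverse square root of 1 + s; the bound \<open>1 / 2\<close> on
  \<open>a\<close> gives the bound \<open>1 / 4\<close> on \<open>s\<close>.\<close>

lemma selfadjoint_eq_real_part_of_unitary:
  assumes a: "a \<in> carrier A" "adj A a = a" "nrm A a \<le> 1 / 2"
  obtains u where "u \<in> carrier A" "adj A u \<otimes> u = \<one>" "a = (1 / 2) \<odot> (u \<oplus> adj A u)"
proof -
  define s where "s = \<ominus> (a \<otimes> a)"
  have s: "s \<in> carrier A" using a by (simp add: s_def)
  have "nrm A s \<le> 1 / 4"
    using nrm_mult[of a a] a mult_mono[of "nrm A a" "1/2" "nrm A a" "1/2"] by (simp add: s_def nrm_uminus)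
  moreover have "adj A s = s" using a by (simp add: s_def adj_uminus adj_mult)
  moreover have comm: "r \<otimes> s = s \<otimes> r" if "r \<in> carrier A" "r \<otimes> a = a \<otimes> r" for r
  proof -
    have "r \<otimes> (a \<otimes> a) = a \<otimes> a \<otimes> r" using that a by (metis m_assoc)
    then show ?thesis using that a by (simp add: s_def l_minus r_minus)
  qed
  ultimately obtain w where w: "w \<in> carrier A" "adj A w = w" "w \<otimes> a = a \<otimes> w" "w \<otimes> w \<otimes> (\<one> \<oplus> s) = \<one>"
    using inverse_sqrt[OF s _ _ a(1)] by metis
  have ws: "w \<otimes> s = s \<otimes> w" using comm w by blast
  have as: "a \<otimes> s = s \<otimes> a" using comm a by blast
  define c where "c = w \<otimes> (\<one> \<oplus> s)"
  have c: "c \<in> carrier A" using w s by (simp add: c_def)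
  have w1: "w \<otimes> (\<one> \<oplus> s) = (\<one> \<oplus> s) \<otimes> w" using w(1) s ws by (simp add: l_distr r_distr)
  have a1: "a \<otimes> (\<one> \<oplus> s) = (\<one> \<oplus> s) \<otimes> a" using a(1) s as by (simp add: l_distr r_distr)
  have ac: "a \<otimes> c = c \<otimes> a"
  proof -
    have "a \<otimes> c = (w \<otimes> a) \<otimes> (\<one> \<oplus> s)" using a(1) w(1) s by (simp add: c_def m_assoc[symmetric] w(3))
    also have "\<dots> = w \<otimes> (a \<otimes> (\<one> \<oplus> s))" using a(1) w(1) s by (simp add: m_assoc)
    also have "\<dots> = c \<otimes> a" unfolding a1 c_def using a(1) w(1) s by (simp add: m_assoc)
    finally show ?thesis .
  qed
  have "c \<otimes> c = w \<otimes> ((\<one> \<oplus> s) \<otimes> w) \<otimes> (\<one> \<oplus> s)" unfolding c_def using w(1) s by (simp add: m_assoc)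
  also have "\<dots> = (w \<otimes> w \<otimes> (\<one> \<oplus> s)) \<otimes> (\<one> \<oplus> s)" unfolding w1[symmetric] using w(1) s by (simp add: m_assoc)
  finally have cc: "c \<otimes> c = \<one> \<oplus> s" using s unfolding w(4) by simp
  have cadj: "adj A c = c"
    using w(1,2) s \<open>adj A s = s\<close> w1 by (simp add: c_def adj_mult adj_add)
  define u where "u = a \<oplus> \<i> \<odot> c"
  have ua: "adj A u = a \<ominus> \<i> \<odot> c"
  proof -
    have "(- \<i>) \<odot> c = \<ominus> (\<i> \<odot> c)" using c scale_uminus_one[of "\<i> \<odot> c"] by (simp add: scale_scale)
    then show ?thesis using a c cadj by (simp add: u_def adj_add adj_smult a_minus_def)
  qed
  define e where "e = \<i> \<odot> c"
  have e: "e \<in> carrier A" using c by (simp add: e_def)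
  have ae: "a \<otimes> e = e \<otimes> a" using a(1) c ac by (simp add: e_def smult_mult_left smult_mult_right)
  have ee: "e \<otimes> e = \<ominus> (\<one> \<oplus> s)"
    using c s cc by (simp add: e_def smult_mult_left smult_mult_right scale_scale scale_uminus_one)
  have "adj A u \<otimes> u = (a \<otimes> a \<ominus> e \<otimes> e) \<oplus> (a \<otimes> e \<ominus> e \<otimes> a)"
    unfolding ua unfolding u_def e_def[symmetric] using a(1) e by algebra
  also have "\<dots> = \<one>"
    unfolding ae ee s_def using a(1) e by algebra
  finally have "adj A u \<otimes> u = \<one>" .
  moreover have "(1 / 2) \<odot> (u \<oplus> adj A u) = a"
  proof -
    have "u \<oplus> adj A u = a \<oplus> a" unfolding ua unfolding u_def e_def[symmetric] using a(1) e by algebra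
    then show ?thesis using a(1) by (simp add: scale_add_right scale_half_double)
  qed
  moreover have "u \<in> carrier A" using a(1) c by (simp add: u_def)
  ultimately show thesis using that by metis
qed

text \<open>The element d = 2b - 1 has the square 1 + 4(b^2 - b), which is close to 1, so its sign v
  = (1 + s)^(-1/2) d is a selfadjoint square root of 1, and p = (1 + v)/2. The bound
  \<open>1 / 16\<close> makes the norm of \<open>s\<close> at most \<open>1 / 4\<close>. The
  estimate comes from p - b = (w - 1)d/2, where the norm of w - 1 is at most 4 times that of b^2 -
  b.\<close>

lemma nearby_projection:
  assumes b: "b \<in> carrier A" "adj A b = b" and t: "nrm A (b \<otimes> b \<ominus> b) \<le> 1 / 16"
  obtains p where "p \<in> carrier A" "adj A p = p" "p \<otimes> p = p"
    "nrm A (p \<ominus> b) \<le> (2 * nrm A b + 1) * (2 * nrm A (b \<otimes> b \<ominus> b))"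
proof -
  define t where "t = b \<otimes> b \<ominus> b"
  have tc: "t \<in> carrier A" using b by (simp add: t_def)
  define s where "s = 4 \<odot> t"
  have s: "s \<in> carrier A" using tc by (simp add: s_def)
  have s4: "s = (t \<oplus> t) \<oplus> (t \<oplus> t)"
    using scale_add_left[OF tc, of 2 2] scale_add_left[OF tc, of 1 1] tc by (simp add: s_def)
  have ns: "nrm A s = 4 * nrm A t" using nrm_smult[OF tc, of 4] by (simp add: s_def)
  have "nrm A s \<le> 1 / 4" using ns t by (simp add: t_def)
  moreover have "adj A s = s" using b tc by (simp add: s_def t_def adj_smult adj_minus adj_mult)
  moreover have comm: "r \<otimes> s = s \<otimes> r" if "r \<in> carrier A" "r \<otimes> b = b \<otimes> r" for r
  proof -
    have "r \<otimes> (b \<otimes> b) = b \<otimes> b \<otimes> r" using that b by (metis m_assoc)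
    then have "r \<otimes> t = t \<otimes> r"
      using that b by (simp add: t_def a_minus_def l_distr r_distr l_minus r_minus)
    then show ?thesis using that tc by (simp add: s_def smult_mult_left smult_mult_right)
  qed
  ultimately obtain w where w: "w \<in> carrier A" "adj A w = w" "w \<otimes> b = b \<otimes> w" "w \<otimes> w \<otimes> (\<one> \<oplus> s) = \<one>"
    "nrm A (w \<ominus> \<one>) \<le> nrm A s"
    using inverse_sqrt[OF s _ _ b(1)] by metis
  define d where "d = b \<oplus> b \<ominus> \<one>"
  have d: "d \<in> carrier A" "adj A d = d" using b by (auto simp: d_def adj_minus adj_add)
  have wd: "w \<otimes> d = d \<otimes> w"
    using w(1,3) b by (simp add: d_def a_minus_def l_distr r_distr l_minus r_minus)
  have dd: "d \<otimes> d = \<one> \<oplus> s" unfolding d_def s4 t_def using b(1) by algebra simp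
  define v where "v = w \<otimes> d"
  have v: "v \<in> carrier A" "adj A v = v" using w(1,2) d wd by (auto simp: v_def adj_mult)
  have "v \<otimes> v = w \<otimes> (d \<otimes> w) \<otimes> d" unfolding v_def using w(1) d by (simp add: m_assoc)
  also have "\<dots> = w \<otimes> w \<otimes> (d \<otimes> d)" unfolding wd[symmetric] using w(1) d by (simp add: m_assoc)
  finally have vv: "v \<otimes> v = \<one>" unfolding dd w(4) .
  define p where "p = (1 / 2) \<odot> (\<one> \<oplus> v)"
  have "p \<in> carrier A" using v by (simp add: p_def)
  moreover have "adj A p = p" using v by (simp add: p_def adj_smult adj_add)
  moreover have "p \<otimes> p = p"
  proof -
    have "(\<one> \<oplus> v) \<otimes> (\<one> \<oplus> v) = \<one> \<oplus> v \<oplus> v \<oplus> v \<otimes> v" using v(1) by algebra simp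
    also have "\<dots> = (\<one> \<oplus> v) \<oplus> (\<one> \<oplus> v)" unfolding vv using v(1) by algebra
    finally have sq: "(\<one> \<oplus> v) \<otimes> (\<one> \<oplus> v) = (\<one> \<oplus> v) \<oplus> (\<one> \<oplus> v)" .
    have "p \<otimes> p = (1 / 2) \<odot> ((1 / 2) \<odot> ((\<one> \<oplus> v) \<otimes> (\<one> \<oplus> v)))"
      using v(1) by (simp add: p_def smult_mult_left smult_mult_right)
    also have "\<dots> = p" unfolding sq p_def
      using v(1) by (subst scale_add_right[of "\<one> \<oplus> v" "\<one> \<oplus> v"]) (simp_all add: scale_half_double)
    finally show ?thesis .
  qed
  moreover have "nrm A (p \<ominus> b) \<le> (2 * nrm A b + 1) * (2 * nrm A (b \<otimes> b \<ominus> b))"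
  proof -
    have "p \<ominus> b = (1 / 2) \<odot> (\<one> \<oplus> v) \<ominus> (1 / 2) \<odot> (b \<oplus> b)"
      using b by (simp add: p_def scale_add_right[of b b] scale_half_double)
    also have "\<dots> = (1 / 2) \<odot> ((\<one> \<oplus> v) \<ominus> (b \<oplus> b))" using v b by (simp add: scale_minus)
    also have "(\<one> \<oplus> v) \<ominus> (b \<oplus> b) = v \<ominus> d" unfolding d_def using b(1) v(1) by algebra
    also have "\<dots> = (w \<ominus> \<one>) \<otimes> d" unfolding v_def using d(1) w(1) by algebra
    finally have "nrm A (p \<ominus> b) = nrm A ((w \<ominus> \<one>) \<otimes> d) / 2"
      using nrm_smult[of "(w \<ominus> \<one>) \<otimes> d" "1/2"] w(1) d(1) by simp
    also have "\<dots> \<le> (nrm A (w \<ominus> \<one>) * nrm A d) / 2"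
      using nrm_mult[of "w \<ominus> \<one>" d] w(1) d(1) by simp
    also have "\<dots> \<le> (4 * nrm A t * (2 * nrm A b + 1)) / 2"
    proof -
      have "nrm A d \<le> 2 * nrm A b + 1"
        using nrm_minus[of "b \<oplus> b" \<one>] nrm_triangle[of b b] b by (simp add: d_def)
      moreover have "0 \<le> nrm A d" using d(1) by (rule nrm_nonneg)
      moreover have "0 \<le> nrm A t" using tc by (rule nrm_nonneg)
      ultimately show ?thesis using w(5) unfolding ns by (intro divide_right_mono mult_mono) auto
    qed
    finally show ?thesis by (simp add: t_def algebra_simps)
  qed
  ultimately show thesis by (rule that)
qed

text \<open>A nonzero corner of \<open>x\<close> off the diagonal is an eigenvector of the commutator with \<open>p\<close>.\<close>

lemma noncentral_projection:
  assumes p: "p \<in> carrier A" "p \<otimes> p = p" and x: "x \<in> carrier A" "p \<otimes> x \<noteq> x \<otimes> p"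
  obtains y where "y \<in> carrier A" "nrm A y = 1" "nrm A (p \<otimes> y \<ominus> y \<otimes> p) = 1"
proof -
  define y1 where "y1 = p \<otimes> x \<otimes> (\<one> \<ominus> p)"
  define y2 where "y2 = (\<one> \<ominus> p) \<otimes> x \<otimes> p"
  have c: "y1 \<in> carrier A" "y2 \<in> carrier A" using p x by (auto simp: y1_def y2_def)
  have "p \<otimes> x \<ominus> x \<otimes> p = y1 \<ominus> y2" unfolding y1_def y2_def using p(1) x(1) by algebra simp
  then have "y1 \<noteq> \<zero> \<or> y2 \<noteq> \<zero>" using x p by (metis r_right_minus_eq m_closed zero_closed)
  moreover have e1: "p \<otimes> y1 \<ominus> y1 \<otimes> p = y1"
  proof -
    have pp: "p \<otimes> (p \<otimes> z) = p \<otimes> z" if "z \<in> carrier A" for z using that p by (metis m_assoc)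
    have "(\<one> \<ominus> p) \<otimes> p = \<zero>" using p by (simp add: a_minus_def l_distr l_minus r_neg)
    then have "y1 \<otimes> p = \<zero>" using p x by (simp add: y1_def m_assoc)
    moreover have "p \<otimes> y1 = y1" using p x by (simp add: y1_def m_assoc pp)
    ultimately show ?thesis using c by (simp add: a_minus_def)
  qed
  moreover have e2: "p \<otimes> y2 \<ominus> y2 \<otimes> p = \<ominus> y2"
  proof -
    have "p \<otimes> (\<one> \<ominus> p) = \<zero>" using p by (simp add: a_minus_def r_distr r_minus r_neg)
    then have "p \<otimes> y2 = \<zero>" using p x by (simp add: y2_def m_assoc[symmetric])
    moreover have "y2 \<otimes> p = y2" using p x by (simp add: y2_def m_assoc)
    ultimately show ?thesis using c by (simp add: a_minus_def)
  qed
  ultimately obtain y0 where y0: "y0 \<in> carrier A" "y0 \<noteq> \<zero>" "nrm A (p \<otimes> y0 \<ominus> y0 \<otimes> p) = nrm A y0"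
    using c by (metis nrm_uminus)
  define k where "k = complex_of_real (1 / nrm A y0)"
  have pos: "0 < nrm A y0" using y0 nrm_eq_zero nrm_nonneg by (metis less_eq_real_def)
  have "p \<otimes> (k \<odot> y0) \<ominus> (k \<odot> y0) \<otimes> p = k \<odot> (p \<otimes> y0 \<ominus> y0 \<otimes> p)"
    using p y0(1) by (simp add: smult_mult_left smult_mult_right scale_minus)
  then have "nrm A (p \<otimes> (k \<odot> y0) \<ominus> (k \<odot> y0) \<otimes> p) = 1" "nrm A (k \<odot> y0) = 1"
    using y0 p pos by (simp_all add: nrm_smult k_def norm_divide)
  then show thesis using that[of "k \<odot> y0"] y0(1) by simp
qed

text \<open>A dense set need not approximate points of the sphere from within the ball. So
  \<open>x\<close> is shrunk by the factor \<open>1 - \<delta>\<close> and then approximated to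
  within the room \<open>\<delta> * r\<close> thus gained. Members of the dense set outside the ball
  are replaced by zero.\<close>

lemma dense_sequence_in_ball:
  assumes sep: "separable_space dist.mtopology" and r: "0 < r"
  obtains d :: "nat \<Rightarrow> 'a" where "\<And>k. d k \<in> carrier A" "\<And>k. nrm A (d k) \<le> r"
    "\<And>x \<epsilon>. x \<in> carrier A \<Longrightarrow> nrm A x \<le> r \<Longrightarrow> 0 < \<epsilon> \<Longrightarrow> \<exists>k. nrm A (d k \<ominus> x) < \<epsilon>"
proof -
  obtain C where C: "countable C" "C \<subseteq> carrier A" "dist.mtopology closure_of C = carrier A"
    using sep unfolding separable_space_def by auto
  have "C \<noteq> {}" using C(3) by auto
  then have rC: "range (from_nat_into C) = C" using C(1) by (rule range_from_nat_into)
  define d where "d k = (if nrm A (from_nat_into C k) \<le> r then from_nat_into C k else \<zero>)" for k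
  have "\<exists>k. nrm A (d k \<ominus> x) < \<epsilon>" if x: "x \<in> carrier A" "nrm A x \<le> r" and \<epsilon>: "0 < \<epsilon>" for x \<epsilon>
  proof -
    define \<delta> where "\<delta> = min (1 / 2) (\<epsilon> / (2 * r))"
    have \<delta>: "0 < \<delta>" "\<delta> \<le> 1 / 2" "\<delta> * r \<le> \<epsilon> / 2" using r \<epsilon> by (auto simp: \<delta>_def min_def field_simps)
    define x' where "x' = complex_of_real (1 - \<delta>) \<odot> x"
    have x': "x' \<in> carrier A" using x by (simp add: x'_def)
    have "nrm A x' = (1 - \<delta>) * nrm A x" 
  proof -
      have "cmod (complex_of_real (1 - \<delta>)) = 1 - \<delta>" using \<delta> by (simp only: norm_of_real)
      then show ?thesis unfolding x'_def using nrm_smult[OF x(1)] by simp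
    qed
    also have "\<dots> \<le> (1 - \<delta>) * r" using x \<delta> by (intro mult_left_mono) auto
    finally have nx': "nrm A x' \<le> r - \<delta> * r" by (simp add: algebra_simps)
    have "x' \<ominus> x = complex_of_real (- \<delta>) \<odot> x"
    proof -
      have "x' = x \<oplus> complex_of_real (- \<delta>) \<odot> x"
        unfolding x'_def using scale_add_left[of x 1 "complex_of_real (- \<delta>)"] x by simp
      moreover have "(x \<oplus> q) \<ominus> x = q" if "q \<in> carrier A" for q using x(1) that by algebra
      ultimately show ?thesis using x(1) by simp
    qed
    then have "nrm A (x' \<ominus> x) = \<delta> * nrm A x" using x \<delta> by (simp add: nrm_smult)
    also have "\<dots> \<le> \<delta> * r" using x \<delta> by (intro mult_left_mono) auto
    finally have near: "nrm A (x' \<ominus> x) \<le> \<epsilon> / 2" using \<delta> by simp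
    define \<eta> where "\<eta> = min (\<delta> * r) (\<epsilon> / 2)"
    have \<eta>: "0 < \<eta>" "\<eta> \<le> \<delta> * r" "\<eta> \<le> \<epsilon> / 2" using \<delta> r \<epsilon> by (auto simp: \<eta>_def)
    obtain c where c: "c \<in> C" "nrm A (x' \<ominus> c) < \<eta>"
      using x' C(2,3) \<eta>(1) unfolding dist.metric_closure_of by (force simp: carrier_dist_def)
    obtain k where k: "from_nat_into C k = c" using c(1) rC by (metis imageE)
    have cc: "c \<in> carrier A" using c C by auto
    have "nrm A c \<le> r"
      using nrm_le_minus[OF cc x'] nrm_minus_commute[OF cc x'] c(2) \<eta>(2) nx' by simp
    then have "d k = c" by (simp add: d_def k)
    moreover have "nrm A (c \<ominus> x) < \<epsilon>"
      using nrm_minus_triangle[OF cc x' x(1)] nrm_minus_commute[OF cc x'] c(2) \<eta>(3) near by simp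
    ultimately show ?thesis by metis
  qed
  moreover have "d k \<in> carrier A" for k using rC C(2) by (auto simp: d_def)
  moreover have "nrm A (d k) \<le> r" for k using r by (simp add: d_def)
  ultimately show thesis using that by blast
qed

end

section \<open>Reduced products\<close>

abbreviation product_algebra (\<open>\<P>\<close>)
  where "\<P> \<equiv> cstar_product"

locale cstar_sequence =
  fixes A :: "nat \<Rightarrow> 'a cstar"
  assumes alg: "unital_cstar_algebra (A n)"
begin

sublocale A: unital_cstar_algebra "A n" for n
  by (rule alg)

lemma product_simps [simp]:
  "(x \<otimes>\<^bsub>\<P> A\<^esub> y) n = x n \<otimes>\<^bsub>A n\<^esub> y n"
  "(x \<oplus>\<^bsub>\<P> A\<^esub> y) n = x n \<oplus>\<^bsub>A n\<^esub> y n"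
  "\<one>\<^bsub>\<P> A\<^esub> n = \<one>\<^bsub>A n\<^esub>" "\<zero>\<^bsub>\<P> A\<^esub> n = \<zero>\<^bsub>A n\<^esub>"
  "(c \<odot>\<^bsub>\<P> A\<^esub> x) n = c \<odot>\<^bsub>A n\<^esub> x n" "adj (\<P> A) x n = adj (A n) (x n)"
  by (simp_all add: cstar_product_def)

lemma mem_product:
  "x \<in> carrier (\<P> A) \<longleftrightarrow>
    (\<forall>n. x n \<in> carrier (A n)) \<and> (\<exists>K. \<forall>n. nrm (A n) (x n) \<le> K)"
  by (auto simp: cstar_product_def bdd_above_def)

lemma productI:
  "(\<And>n. x n \<in> carrier (A n)) \<Longrightarrow> (\<And>n. nrm (A n) (x n) \<le> K) \<Longrightarrow> x \<in> carrier (\<P> A)"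
  unfolding mem_product by blast

lemma product_coord [simp]: "x \<in> carrier (\<P> A) \<Longrightarrow> x n \<in> carrier (A n)"
  by (simp add: mem_product)

lemma product_bound:
  assumes "x \<in> carrier (\<P> A)"
  obtains K where "0 < K" "\<And>n. nrm (A n) (x n) \<le> K"
proof -
  obtain K where "\<And>n. nrm (A n) (x n) \<le> K" using assms by (auto simp: mem_product)
  then have "nrm (A n) (x n) \<le> max K 1" for n by (rule max.coboundedI1)
  then show thesis using that[of "max K 1"] by simp
qed

lemma product_add [simp, intro]:
  assumes x: "x \<in> carrier (\<P> A)" and y: "y \<in> carrier (\<P> A)"
  shows "x \<oplus>\<^bsub>\<P> A\<^esub> y \<in> carrier (\<P> A)"
proof -
  obtain K L where KL: "\<And>n. nrm (A n) (x n) \<le> K" "\<And>n. nrm (A n) (y n) \<le> L"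
    using product_bound x y by metis
  have "nrm (A n) (x n \<oplus>\<^bsub>A n\<^esub> y n) \<le> K + L" for n
    using A.nrm_triangle[of "x n" n "y n"] KL[of n] x y by simp
  then show ?thesis using x y by (intro productI[where K = "K + L"]) simp_all
qed

lemma product_mult [simp, intro]:
  assumes x: "x \<in> carrier (\<P> A)" and y: "y \<in> carrier (\<P> A)"
  shows "x \<otimes>\<^bsub>\<P> A\<^esub> y \<in> carrier (\<P> A)"
proof -
  obtain K L where KL: "0 < K" "\<And>n. nrm (A n) (x n) \<le> K" "0 < L" "\<And>n. nrm (A n) (y n) \<le> L"
    using product_bound x y by metis
  have "nrm (A n) (x n \<otimes>\<^bsub>A n\<^esub> y n) \<le> K * L" for n
  proof -
    have "nrm (A n) (x n) * nrm (A n) (y n) \<le> K * L"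
      using KL x y by (intro mult_mono A.nrm_nonneg) auto
    then show ?thesis using A.nrm_mult[of "x n" n "y n"] x y by simp
  qed
  then show ?thesis using x y by (intro productI[where K = "K * L"]) simp_all
qed

lemma product_scale [simp, intro]:
  assumes x: "x \<in> carrier (\<P> A)"
  shows "c \<odot>\<^bsub>\<P> A\<^esub> x \<in> carrier (\<P> A)"
proof -
  obtain K where K: "\<And>n. nrm (A n) (x n) \<le> K" using product_bound x by metis
  have "nrm (A n) (c \<odot>\<^bsub>A n\<^esub> x n) \<le> cmod c * K" for n
    using A.nrm_smult[of "x n" n c] mult_left_mono[OF K[of n], of "cmod c"] x by simp
  then show ?thesis using x by (intro productI[where K = "cmod c * K"]) simp_all
qed

lemma product_adj [simp, intro]:
  "x \<in> carrier (\<P> A) \<Longrightarrow> adj (\<P> A) x \<in> carrier (\<P> A)"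
  by (auto simp: mem_product)

lemma product_one [simp, intro]: "\<one>\<^bsub>\<P> A\<^esub> \<in> carrier (\<P> A)"
  by (rule productI[where K = 1]) simp_all

lemma product_zero [simp, intro]: "\<zero>\<^bsub>\<P> A\<^esub> \<in> carrier (\<P> A)"
  by (rule productI[where K = 1]) simp_all

lemma ring_product: "ring (\<P> A)"
proof (rule ringI)
  show "abelian_group (\<P> A)"
  proof (rule abelian_groupI)
    fix x assume x: "x \<in> carrier (\<P> A)"
    have "(-1) \<odot>\<^bsub>\<P> A\<^esub> x \<oplus>\<^bsub>\<P> A\<^esub> x = \<zero>\<^bsub>\<P> A\<^esub>"
      using x by (intro ext) (simp add: A.scale_uminus_one A.l_neg)
    then show "\<exists>y\<in>carrier (\<P> A). y \<oplus>\<^bsub>\<P> A\<^esub> x = \<zero>\<^bsub>\<P> A\<^esub>"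
      using x by blast
  qed (auto simp: fun_eq_iff A.a_ac)
  show "Group.monoid (\<P> A)"
    by (rule monoidI) (auto simp: fun_eq_iff A.m_assoc)
qed (auto simp: fun_eq_iff A.l_distr A.r_distr)

sublocale P: ring "\<P> A"
  by (rule ring_product)

lemma product_uminus [simp]:
  assumes "x \<in> carrier (\<P> A)"
  shows "(\<ominus>\<^bsub>\<P> A\<^esub> x) n = \<ominus>\<^bsub>A n\<^esub> x n"
proof -
  have "(-1) \<odot>\<^bsub>\<P> A\<^esub> x \<oplus>\<^bsub>\<P> A\<^esub> x = \<zero>\<^bsub>\<P> A\<^esub>"
    using assms by (intro ext) (simp add: A.scale_uminus_one A.l_neg)
  then have "\<ominus>\<^bsub>\<P> A\<^esub> x = (-1) \<odot>\<^bsub>\<P> A\<^esub> x"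
    using assms by (intro P.minus_equality) auto
  then show ?thesis using assms by (simp add: A.scale_uminus_one)
qed

lemma product_minus [simp]:
  assumes "x \<in> carrier (\<P> A)" "y \<in> carrier (\<P> A)"
  shows "(x \<ominus>\<^bsub>\<P> A\<^esub> y) n = x n \<ominus>\<^bsub>A n\<^esub> y n"
  using assms by (simp add: a_minus_def)

definition asym_eq :: "(nat \<Rightarrow> 'a) \<Rightarrow> (nat \<Rightarrow> 'a) \<Rightarrow> bool"
  where "asym_eq x y \<longleftrightarrow> (\<lambda>n. nrm (A n) (x n \<ominus>\<^bsub>A n\<^esub> y n)) \<longlonglongrightarrow> 0"

lemma asym_eq_iff:
  assumes "x \<in> carrier (\<P> A)" "y \<in> carrier (\<P> A)"
  shows "asym_eq x y \<longleftrightarrow> (\<forall>\<epsilon>>0. finite {n. \<epsilon> \<le> nrm (A n) (x n \<ominus>\<^bsub>A n\<^esub> y n)})"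
proof -
  have "asym_eq x y \<longleftrightarrow> (\<forall>\<epsilon>>0. \<forall>\<^sub>F n in sequentially. nrm (A n) (x n \<ominus>\<^bsub>A n\<^esub> y n) < \<epsilon>)"
    unfolding asym_eq_def tendsto_iff using assms by (simp add: dist_real_def)
  then show ?thesis
    by (simp add: eventually_cofinite cofinite_eq_sequentially[symmetric] not_less)
qed

lemma tendsto_zero_le:
  fixes f g :: "nat \<Rightarrow> real"
  assumes "g \<longlonglongrightarrow> 0" "\<And>n. 0 \<le> f n" "\<And>n. f n \<le> K * g n"
  shows "f \<longlonglongrightarrow> 0"
  by (rule tendsto_sandwich[of "\<lambda>_. 0" f _ "\<lambda>n. K * g n"])
    (use assms tendsto_mult_right_zero[OF assms(1), of K] in auto)

lemma ideal_sum_ideal: "ideal (sum_ideal A) (\<P> A)"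
proof (rule idealI[OF ring_product])
  have sub: "sum_ideal A \<subseteq> carrier (\<P> A)" by (auto simp: sum_ideal_def)
  show "subgroup (sum_ideal A) (add_monoid (\<P> A))"
  proof (rule group.subgroupI)
    show "group (add_monoid (\<P> A))" by (rule P.add.is_group)
    show "sum_ideal A \<subseteq> carrier (add_monoid (\<P> A))" using sub by simp
    have "\<zero>\<^bsub>\<P> A\<^esub> \<in> sum_ideal A" by (simp add: sum_ideal_def)
    then show "sum_ideal A \<noteq> {}" by blast
    fix x assume x: "x \<in> sum_ideal A"
    then show "inv\<^bsub>add_monoid (\<P> A)\<^esub> x \<in> sum_ideal A"
      using sub unfolding a_inv_def[symmetric] by (auto simp: sum_ideal_def A.nrm_uminus)
    fix y assume y: "y \<in> sum_ideal A"
    have "(\<lambda>n. nrm (A n) (x n \<oplus>\<^bsub>A n\<^esub> y n)) \<longlonglongrightarrow> 0"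
      by (rule tendsto_zero_le[where K = 1, OF tendsto_add_zero[of "\<lambda>n. nrm (A n) (x n)" _ "\<lambda>n. nrm (A n) (y n)"]])
        (use x y in \<open>auto simp: sum_ideal_def intro: A.nrm_triangle\<close>)
    then show "x \<otimes>\<^bsub>add_monoid (\<P> A)\<^esub> y \<in> sum_ideal A"
      using x y by (simp add: sum_ideal_def)
  qed
next
  fix a x assume a: "a \<in> sum_ideal A" and x: "x \<in> carrier (\<P> A)"
  then have a': "a \<in> carrier (\<P> A)" "(\<lambda>n. nrm (A n) (a n)) \<longlonglongrightarrow> 0" by (auto simp: sum_ideal_def)
  obtain K where K: "0 < K" "\<And>n. nrm (A n) (x n) \<le> K" using product_bound x by metis
  have "nrm (A n) (x n \<otimes>\<^bsub>A n\<^esub> a n) \<le> K * nrm (A n) (a n)" for n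
    using A.nrm_mult[of "x n" n "a n"] mult_right_mono[OF K(2)[of n] A.nrm_nonneg[of "a n" n]] x a'(1) by simp
  then have "(\<lambda>n. nrm (A n) (x n \<otimes>\<^bsub>A n\<^esub> a n)) \<longlonglongrightarrow> 0"
    using a' x by (intro tendsto_zero_le[OF a'(2)]) auto
  then show "x \<otimes>\<^bsub>\<P> A\<^esub> a \<in> sum_ideal A" using a' x by (simp add: sum_ideal_def)
  have "nrm (A n) (a n \<otimes>\<^bsub>A n\<^esub> x n) \<le> K * nrm (A n) (a n)" for n
    using A.nrm_mult[of "a n" n "x n"] mult_left_mono[OF K(2)[of n] A.nrm_nonneg[of "a n" n]] x a'(1) by (simp add: mult.commute)
  then have "(\<lambda>n. nrm (A n) (a n \<otimes>\<^bsub>A n\<^esub> x n)) \<longlonglongrightarrow> 0"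
    using a' x by (intro tendsto_zero_le[OF a'(2)]) auto
  then show "a \<otimes>\<^bsub>\<P> A\<^esub> x \<in> sum_ideal A" using a' x by (simp add: sum_ideal_def)
qed

sublocale I: ideal "sum_ideal A" "\<P> A"
  by (rule ideal_sum_ideal)

lemma quot_map_eq_iff:
  assumes "x \<in> carrier (\<P> A)" "y \<in> carrier (\<P> A)"
  shows "quot_map A x = quot_map A y \<longleftrightarrow> asym_eq x y"
proof -
  have "quot_map A x = quot_map A y \<longleftrightarrow> x \<ominus>\<^bsub>\<P> A\<^esub> y \<in> sum_ideal A"
    unfolding quot_map_def by (rule P.quotient_eq_iff_same_a_r_cos[OF ideal_sum_ideal assms, symmetric])
  also have "\<dots> \<longleftrightarrow> asym_eq x y"
  proof -
    have "(\<lambda>n. nrm (A n) ((x \<ominus>\<^bsub>\<P> A\<^esub> y) n)) = (\<lambda>n. nrm (A n) (x n \<ominus>\<^bsub>A n\<^esub> y n))"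
      by (rule ext) (simp only: product_minus[OF assms])
    then show ?thesis
      unfolding sum_ideal_def asym_eq_def mem_Collect_eq using P.minus_closed[OF assms] by metis
  qed
  finally show ?thesis .
qed

lemma reduced_carrier: "carrier (reduced_product A) = quot_map A ` carrier (\<P> A)"
  unfolding reduced_product_def cstar_quotient_def FactRing_def quot_map_def
  by (auto simp: A_RCOSETS_def' )

lemma quot_map_mem [simp]: "x \<in> carrier (\<P> A) \<Longrightarrow> quot_map A x \<in> carrier (reduced_product A)"
  by (simp add: reduced_carrier)

lemma quot_map_add:
  "x \<in> carrier (\<P> A) \<Longrightarrow> y \<in> carrier (\<P> A) \<Longrightarrow>
    quot_map A x \<oplus>\<^bsub>reduced_product A\<^esub> quot_map A y = quot_map A (x \<oplus>\<^bsub>\<P> A\<^esub> y)"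
  unfolding reduced_product_def cstar_quotient_def FactRing_def quot_map_def
  by (simp add: I.a_rcos_sum)

lemma quot_map_mult:
  "x \<in> carrier (\<P> A) \<Longrightarrow> y \<in> carrier (\<P> A) \<Longrightarrow>
    quot_map A x \<otimes>\<^bsub>reduced_product A\<^esub> quot_map A y = quot_map A (x \<otimes>\<^bsub>\<P> A\<^esub> y)"
  unfolding reduced_product_def cstar_quotient_def FactRing_def quot_map_def
  by (simp add: I.rcoset_mult_add)

lemma quot_map_one: "\<one>\<^bsub>reduced_product A\<^esub> = quot_map A \<one>\<^bsub>\<P> A\<^esub>"
  unfolding reduced_product_def cstar_quotient_def FactRing_def quot_map_def by simp

lemma mem_quot_map:
  assumes "x \<in> carrier (\<P> A)"
  shows "x \<in> quot_map A x"
    "z \<in> quot_map A x \<Longrightarrow> z \<in> carrier (\<P> A) \<and> asym_eq z x"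
proof -
  show "x \<in> quot_map A x" unfolding quot_map_def using assms by (rule I.a_rcos_self)
  assume z: "z \<in> quot_map A x"
  then have zc: "z \<in> carrier (\<P> A)"
    unfolding quot_map_def using P.a_r_coset_subset_G[OF I.a_subset assms] by blast
  moreover have "quot_map A z = quot_map A x"
    using P.a_repr_independence[OF _ assms I.a_subgroup, of z] z unfolding quot_map_def by simp
  ultimately show "z \<in> carrier (\<P> A) \<and> asym_eq z x" using quot_map_eq_iff[OF zc assms] by simp
qed

text \<open>The operations of \<open>cstar_quotient\<close> are unions over a coset; they collapse
  to one coset as soon as \<open>F\<close> respects \<open>asym_eq\<close>.\<close>

lemma UN_quot_map:
  assumes x: "x \<in> carrier (\<P> A)"
    and F: "\<And>z. z \<in> carrier (\<P> A) \<Longrightarrow> F z \<in> carrier (\<P> A)"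
    and cong: "\<And>z. z \<in> carrier (\<P> A) \<Longrightarrow> asym_eq z x \<Longrightarrow> asym_eq (F z) (F x)"
  shows "(\<Union>z\<in>quot_map A x. sum_ideal A +>\<^bsub>\<P> A\<^esub> F z) = quot_map A (F x)"
proof -
  have "sum_ideal A +>\<^bsub>\<P> A\<^esub> F z = quot_map A (F x)" if "z \<in> quot_map A x" for z
  proof -
    have z: "z \<in> carrier (\<P> A)" "asym_eq z x" using mem_quot_map(2)[OF x that] by auto
    then have "quot_map A (F z) = quot_map A (F x)" using quot_map_eq_iff[OF F F] x cong by simp
    then show ?thesis by (simp add: quot_map_def)
  qed
  then show ?thesis using mem_quot_map(1)[OF x] by auto
qed

lemma quot_map_scale:
  assumes "x \<in> carrier (\<P> A)"
  shows "c \<odot>\<^bsub>reduced_product A\<^esub> quot_map A x = quot_map A (c \<odot>\<^bsub>\<P> A\<^esub> x)"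
proof -
  have "asym_eq (c \<odot>\<^bsub>\<P> A\<^esub> z) (c \<odot>\<^bsub>\<P> A\<^esub> x)"
    if z: "z \<in> carrier (\<P> A)" "asym_eq z x" for z
    unfolding asym_eq_def
  proof (rule tendsto_zero_le[OF z(2)[unfolded asym_eq_def], where K = "cmod c"])
    fix n
    have "c \<odot>\<^bsub>A n\<^esub> z n \<ominus>\<^bsub>A n\<^esub> c \<odot>\<^bsub>A n\<^esub> x n = c \<odot>\<^bsub>A n\<^esub> (z n \<ominus>\<^bsub>A n\<^esub> x n)"
      using z assms by (simp add: A.scale_minus)
    then show "nrm (A n) ((c \<odot>\<^bsub>\<P> A\<^esub> z) n \<ominus>\<^bsub>A n\<^esub> (c \<odot>\<^bsub>\<P> A\<^esub> x) n)
        \<le> cmod c * nrm (A n) (z n \<ominus>\<^bsub>A n\<^esub> x n)"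
      using z assms by (simp add: A.nrm_smult)
  qed (use z assms in simp)
  then show ?thesis
    using UN_quot_map[OF assms, of "\<lambda>z. c \<odot>\<^bsub>\<P> A\<^esub> z"]
    by (simp add: reduced_product_def cstar_quotient_def)
qed

lemma quot_map_adj:
  assumes "x \<in> carrier (\<P> A)"
  shows "adj (reduced_product A) (quot_map A x) = quot_map A (adj (\<P> A) x)"
proof -
  have "asym_eq (adj (\<P> A) z) (adj (\<P> A) x)"
    if z: "z \<in> carrier (\<P> A)" "asym_eq z x" for z
  proof -
    have "nrm (A n) (adj (A n) (z n) \<ominus>\<^bsub>A n\<^esub> adj (A n) (x n)) = nrm (A n) (z n \<ominus>\<^bsub>A n\<^esub> x n)" for n
      using A.nrm_adj[of "z n \<ominus>\<^bsub>A n\<^esub> x n" n] z assms by (simp add: A.adj_minus)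
    then show ?thesis using z(2) by (simp add: asym_eq_def)
  qed
  then show ?thesis
    using UN_quot_map[OF assms, of "\<lambda>z. adj (\<P> A) z"]
    by (simp add: reduced_product_def cstar_quotient_def)
qed

end

section \<open>Characteristic functions and the correspondence of sequences\<close>

definition chi :: "(nat \<Rightarrow> 'a cstar) \<Rightarrow> nat set \<Rightarrow> nat \<Rightarrow> 'a"
  where "chi A S n = (if n \<in> S then \<one>\<^bsub>A n\<^esub> else \<zero>\<^bsub>A n\<^esub>)"

context cstar_sequence
begin

lemma minus_self [simp]: "x \<in> carrier (A n) \<Longrightarrow> x \<ominus>\<^bsub>A n\<^esub> x = \<zero>\<^bsub>A n\<^esub>"
  by (simp add: A.r_right_minus_eq)

lemma chi_mem [simp]: "chi A S \<in> carrier (\<P> A)"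
  by (rule productI[where K = 1]) (simp_all add: chi_def)

lemma chi_mult: "chi A S \<otimes>\<^bsub>\<P> A\<^esub> chi A T = chi A (S \<inter> T)"
  by (simp add: fun_eq_iff chi_def)

lemma chi_compl: "\<one>\<^bsub>\<P> A\<^esub> \<ominus>\<^bsub>\<P> A\<^esub> chi A S = chi A (- S)"
  by (simp add: fun_eq_iff chi_def) (simp add: a_minus_def)

lemma asym_eq_chi: "asym_eq (chi A S) (chi A T) \<longleftrightarrow> finite (sym_diff S T)"
proof -
  have *: "nrm (A n) (chi A S n \<ominus>\<^bsub>A n\<^esub> chi A T n) = (if n \<in> sym_diff S T then 1 else 0)" for n
    by (auto simp: chi_def a_minus_def A.nrm_uminus A.r_neg)
  have "{n. \<epsilon> \<le> nrm (A n) (chi A S n \<ominus>\<^bsub>A n\<^esub> chi A T n)} =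
      (if \<epsilon> \<le> 1 then sym_diff S T else {})" if "0 < \<epsilon>" for \<epsilon>
    unfolding * using that by auto
  then show ?thesis unfolding asym_eq_iff[OF chi_mem chi_mem]
    by (auto intro: exI[of _ 1])
qed

lemma asym_eq_refl: "x \<in> carrier (\<P> A) \<Longrightarrow> asym_eq x x"
  by (simp add: asym_eq_def)

lemma asym_eqI_finite:
  assumes "x \<in> carrier (\<P> A)" "y \<in> carrier (\<P> A)" "finite {n. x n \<noteq> y n}"
  shows "asym_eq x y"
  unfolding asym_eq_iff[OF assms(1,2)]
proof (intro allI impI)
  fix \<epsilon> :: real assume "0 < \<epsilon>"
  then have "{n. \<epsilon> \<le> nrm (A n) (x n \<ominus>\<^bsub>A n\<^esub> y n)} \<subseteq> {n. x n \<noteq> y n}"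
    using assms(1,2) by auto
  then show "finite {n. \<epsilon> \<le> nrm (A n) (x n \<ominus>\<^bsub>A n\<^esub> y n)}" using assms(3) by (rule finite_subset)
qed

end

text \<open>\<open>L\<close> is the graph of an isomorphism of reduced products, pulled back to the products.\<close>

locale product_correspondence = A: cstar_sequence A + B: cstar_sequence B
  for A :: "nat \<Rightarrow> 'a cstar" and B :: "nat \<Rightarrow> 'b cstar" +
  fixes L :: "(nat \<Rightarrow> 'a) \<Rightarrow> (nat \<Rightarrow> 'b) \<Rightarrow> bool"
  assumes mem_left: "L x y \<Longrightarrow> x \<in> carrier (\<P> A)"
    and mem_right: "L x y \<Longrightarrow> y \<in> carrier (\<P> B)"
    and total: "x \<in> carrier (\<P> A) \<Longrightarrow> \<exists>y. L x y"
    and surjective: "y \<in> carrier (\<P> B) \<Longrightarrow> \<exists>x. L x y"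
    and cong: "L x y \<Longrightarrow> L x' y' \<Longrightarrow> A.asym_eq x x' \<longleftrightarrow> B.asym_eq y y'"
    and right: "L x y \<Longrightarrow> y' \<in> carrier (\<P> B) \<Longrightarrow> B.asym_eq y y' \<Longrightarrow> L x y'"
    and add: "L x y \<Longrightarrow> L x' y' \<Longrightarrow> L (x \<oplus>\<^bsub>\<P> A\<^esub> x') (y \<oplus>\<^bsub>\<P> B\<^esub> y')"
    and mult: "L x y \<Longrightarrow> L x' y' \<Longrightarrow> L (x \<otimes>\<^bsub>\<P> A\<^esub> x') (y \<otimes>\<^bsub>\<P> B\<^esub> y')"
    and scale: "L x y \<Longrightarrow> L (c \<odot>\<^bsub>\<P> A\<^esub> x) (c \<odot>\<^bsub>\<P> B\<^esub> y)"
    and adj: "L x y \<Longrightarrow> L (adj (\<P> A) x) (adj (\<P> B) y)"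
    and one: "L \<one>\<^bsub>\<P> A\<^esub> \<one>\<^bsub>\<P> B\<^esub>"
begin

lemma uminus: "L x y \<Longrightarrow> L (\<ominus>\<^bsub>\<P> A\<^esub> x) (\<ominus>\<^bsub>\<P> B\<^esub> y)"
proof -
  assume L: "L x y"
  have "\<ominus>\<^bsub>\<P> A\<^esub> x = (-1) \<odot>\<^bsub>\<P> A\<^esub> x"
    using mem_left[OF L] by (simp add: fun_eq_iff A.A.scale_uminus_one)
  moreover have "\<ominus>\<^bsub>\<P> B\<^esub> y = (-1) \<odot>\<^bsub>\<P> B\<^esub> y"
    using mem_right[OF L] by (simp add: fun_eq_iff B.A.scale_uminus_one)
  ultimately show ?thesis using scale[OF L, of "-1"] by simp
qed

lemma minus: "L x y \<Longrightarrow> L x' y' \<Longrightarrow> L (x \<ominus>\<^bsub>\<P> A\<^esub> x') (y \<ominus>\<^bsub>\<P> B\<^esub> y')"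
  unfolding a_minus_def by (intro add uminus)

lemma zero: "L \<zero>\<^bsub>\<P> A\<^esub> \<zero>\<^bsub>\<P> B\<^esub>"
proof -
  have "0 \<odot>\<^bsub>\<P> A\<^esub> \<one>\<^bsub>\<P> A\<^esub> = \<zero>\<^bsub>\<P> A\<^esub>"
    "0 \<odot>\<^bsub>\<P> B\<^esub> \<one>\<^bsub>\<P> B\<^esub> = \<zero>\<^bsub>\<P> B\<^esub>"
    by (simp_all add: fun_eq_iff)
  then show ?thesis using scale[OF one, of 0] by simp
qed

lemma close:
  assumes "L x y" "L x y'" "0 < \<epsilon>"
  shows "finite {n. \<epsilon> \<le> nrm (B n) (y n \<ominus>\<^bsub>B n\<^esub> y' n)}"
  using cong[OF assms(1,2)] A.asym_eq_refl mem_left[OF assms(1)] mem_right[OF assms(1)]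
    mem_right[OF assms(2)] assms(3) B.asym_eq_iff by blast

text \<open>The bound is drawn from algebra: the relation u* u = 1 passes to a lift \<open>v\<close>
  of \<open>u\<close> up to a null sequence, and the norm identity then shows that, at almost all
  coordinates, the square of the norm of \<open>v\<close> is at most 2, so this norm is at most 3/2.
  There \<open>b\<close> is within 1/2 of the real part of \<open>v\<close>.\<close>

lemma selfadjoint_bound:
  assumes L: "L a b" and a: "\<And>n. adj (A n) (a n) = a n" "\<And>n. nrm (A n) (a n) \<le> 1 / 2"
  shows "finite {n. 2 < nrm (B n) (b n)}"
proof -
  note ac = mem_left[OF L] and bc = mem_right[OF L]
  have "\<forall>n. \<exists>u. u \<in> carrier (A n) \<and> adj (A n) u \<otimes>\<^bsub>A n\<^esub> u = \<one>\<^bsub>A n\<^esub> \<and>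
      a n = (1 / 2) \<odot>\<^bsub>A n\<^esub> (u \<oplus>\<^bsub>A n\<^esub> adj (A n) u)"
    using A.A.selfadjoint_eq_real_part_of_unitary[OF A.product_coord[OF ac] a] by metis
  then obtain u where u: "\<And>n. u n \<in> carrier (A n)" "\<And>n. adj (A n) (u n) \<otimes>\<^bsub>A n\<^esub> u n = \<one>\<^bsub>A n\<^esub>"
      "\<And>n. a n = (1 / 2) \<odot>\<^bsub>A n\<^esub> (u n \<oplus>\<^bsub>A n\<^esub> adj (A n) (u n))"
    by metis
  have uc: "u \<in> carrier (\<P> A)"
    using u by (intro A.productI[where K = 1]) (simp_all add: A.A.nrm_unitary)
  obtain v where Lv: "L u v" using total[OF uc] by blast
  note vc = mem_right[OF Lv]
  have "adj (\<P> A) u \<otimes>\<^bsub>\<P> A\<^esub> u = \<one>\<^bsub>\<P> A\<^esub>"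
    using u by (simp add: fun_eq_iff)
  note L1 = mult[OF adj[OF Lv] Lv, unfolded this]
  have 1: "finite {n. 1 \<le> nrm (B n) ((adj (\<P> B) v \<otimes>\<^bsub>\<P> B\<^esub> v) n
      \<ominus>\<^bsub>B n\<^esub> \<one>\<^bsub>\<P> B\<^esub> n)}"
    by (rule close[OF L1 one zero_less_one])
  have "(1 / 2) \<odot>\<^bsub>\<P> A\<^esub> (u \<oplus>\<^bsub>\<P> A\<^esub> adj (\<P> A) u) = a"
    using u(3) by (simp add: fun_eq_iff)
  note L2 = scale[OF add[OF Lv adj[OF Lv]], of "1 / 2", unfolded this]
  have 2: "finite {n. 1 / 2 \<le> nrm (B n) (b n \<ominus>\<^bsub>B n\<^esub>
      ((1 / 2) \<odot>\<^bsub>\<P> B\<^esub> (v \<oplus>\<^bsub>\<P> B\<^esub> adj (\<P> B) v)) n)}"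
    by (rule close[OF L L2]) simp
  have "{n. 2 < nrm (B n) (b n)} \<subseteq>
      {n. 1 \<le> nrm (B n) ((adj (\<P> B) v \<otimes>\<^bsub>\<P> B\<^esub> v) n \<ominus>\<^bsub>B n\<^esub> \<one>\<^bsub>\<P> B\<^esub> n)} \<union>
      {n. 1 / 2 \<le> nrm (B n) (b n \<ominus>\<^bsub>B n\<^esub>
        ((1 / 2) \<odot>\<^bsub>\<P> B\<^esub> (v \<oplus>\<^bsub>\<P> B\<^esub> adj (\<P> B) v)) n)}"
  proof (rule subsetI, rule ccontr)
    fix n
    define w where "w = v n"
    define r where "r = (1 / 2) \<odot>\<^bsub>B n\<^esub> (w \<oplus>\<^bsub>B n\<^esub> adj (B n) w)"
    have wc: "w \<in> carrier (B n)" "r \<in> carrier (B n)" "b n \<in> carrier (B n)" using vc bc by (simp_all add: w_def r_def)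
    assume "n \<in> {n. 2 < nrm (B n) (b n)}"
      and not: "n \<notin> {n. 1 \<le> nrm (B n) ((adj (\<P> B) v \<otimes>\<^bsub>\<P> B\<^esub> v) n \<ominus>\<^bsub>B n\<^esub> \<one>\<^bsub>\<P> B\<^esub> n)} \<union>
      {n. 1 / 2 \<le> nrm (B n) (b n \<ominus>\<^bsub>B n\<^esub>
        ((1 / 2) \<odot>\<^bsub>\<P> B\<^esub> (v \<oplus>\<^bsub>\<P> B\<^esub> adj (\<P> B) v)) n)}"
    then have big: "2 < nrm (B n) (b n)" by simp
    have s1: "nrm (B n) (adj (B n) w \<otimes>\<^bsub>B n\<^esub> w \<ominus>\<^bsub>B n\<^esub> \<one>\<^bsub>B n\<^esub>) < 1"
      and s2: "nrm (B n) (b n \<ominus>\<^bsub>B n\<^esub> r) < 1 / 2"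
      using not by (simp_all add: w_def r_def)
    have "(nrm (B n) w)\<^sup>2 \<le> 2"
      using B.A.cstar_identity[OF wc(1)] B.A.nrm_le_minus[of "adj (B n) w \<otimes>\<^bsub>B n\<^esub> w" n "\<one>\<^bsub>B n\<^esub>"] wc(1) s1 by simp
    then have "(nrm (B n) w)\<^sup>2 \<le> (3 / 2)\<^sup>2" by (simp add: power2_eq_square)
    then have "nrm (B n) w \<le> 3 / 2" by (rule power2_le_imp_le) simp
    moreover have "nrm (B n) r \<le> nrm (B n) w"
      using B.A.nrm_triangle[of w n "adj (B n) w"] wc(1) by (simp add: r_def B.A.nrm_smult)
    ultimately have "nrm (B n) (b n) \<le> 2" using B.A.nrm_le_minus[OF wc(3,2)] s2 by simp
    then show False using big by simp
  qed
  then show ?thesis using 1 2 by (meson finite_UnI finite_subset)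
qed

text \<open>The bound 4 = 2 + 2 is the sum of the bounds for the real and the imaginary part, which
  are lifted separately.\<close>

lemma half_ball_bound:
  assumes L: "L x y" and x: "\<And>n. nrm (A n) (x n) \<le> 1 / 2"
  shows "finite {n. 4 < nrm (B n) (y n)}"
proof -
  note xc = mem_left[OF L] and yc = mem_right[OF L]
  define a where "a = (1 / 2) \<odot>\<^bsub>\<P> A\<^esub> (x \<oplus>\<^bsub>\<P> A\<^esub> adj (\<P> A) x)"
  define c where "c = (- \<i> / 2) \<odot>\<^bsub>\<P> A\<^esub> (x \<ominus>\<^bsub>\<P> A\<^esub> adj (\<P> A) x)"
  define a' where "a' = (1 / 2) \<odot>\<^bsub>\<P> B\<^esub> (y \<oplus>\<^bsub>\<P> B\<^esub> adj (\<P> B) y)"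
  define c' where "c' = (- \<i> / 2) \<odot>\<^bsub>\<P> B\<^esub> (y \<ominus>\<^bsub>\<P> B\<^esub> adj (\<P> B) y)"
  have La: "L a a'" and Lc: "L c c'" unfolding a_def a'_def c_def c'_def
    by (intro scale add minus adj L)+
  have xn: "x n \<in> carrier (A n)" for n using xc by simp
  have an: "a n = (1 / 2) \<odot>\<^bsub>A n\<^esub> (x n \<oplus>\<^bsub>A n\<^esub> adj (A n) (x n))"
    and cn: "c n = (- \<i> / 2) \<odot>\<^bsub>A n\<^esub> (x n \<ominus>\<^bsub>A n\<^esub> adj (A n) (x n))" for n
    using xc by (simp_all add: a_def c_def)
  have "adj (A n) (a n) = a n" for n
    using xn[of n] by (simp add: an A.A.adj_smult A.A.adj_add A.A.adj_adj A.A.a_comm)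
  moreover have "nrm (A n) (a n) \<le> 1 / 2" for n
    using xn[of n] x[of n] A.A.nrm_triangle[of "x n" n "adj (A n) (x n)"] by (simp add: an A.A.nrm_smult)
  ultimately have fa: "finite {n. 2 < nrm (B n) (a' n)}" by (rule selfadjoint_bound[OF La])
  have "adj (A n) (c n) = c n" for n
  proof -
    have "\<ominus>\<^bsub>A n\<^esub> (x n \<ominus>\<^bsub>A n\<^esub> adj (A n) (x n)) = adj (A n) (x n) \<ominus>\<^bsub>A n\<^esub> x n"
      using xn[of n] by (simp add: a_minus_def A.A.minus_add A.A.a_comm)
    then have "adj (A n) (x n) \<ominus>\<^bsub>A n\<^esub> x n = (-1) \<odot>\<^bsub>A n\<^esub> (x n \<ominus>\<^bsub>A n\<^esub> adj (A n) (x n))"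
      using xn[of n] by (simp add: A.A.scale_uminus_one)
    then show ?thesis
      using xn[of n] by (simp add: cn A.A.adj_smult A.A.adj_minus A.A.adj_adj A.A.scale_scale)
  qed
  moreover have "nrm (A n) (c n) \<le> 1 / 2" for n
    using xn[of n] x[of n] A.A.nrm_minus[of "x n" n "adj (A n) (x n)"] by (simp add: cn A.A.nrm_smult norm_divide)
  ultimately have fc: "finite {n. 2 < nrm (B n) (c' n)}" by (rule selfadjoint_bound[OF Lc])
  have "{n. 4 < nrm (B n) (y n)} \<subseteq> {n. 2 < nrm (B n) (a' n)} \<union> {n. 2 < nrm (B n) (c' n)}"
  proof
    fix n assume n: "n \<in> {n. 4 < nrm (B n) (y n)}"
    define w where "w = y n"
    have w: "w \<in> carrier (B n)" "a' n \<in> carrier (B n)" "c' n \<in> carrier (B n)"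
      using yc mem_right[OF La] mem_right[OF Lc] by (simp_all add: w_def)
    have an: "a' n = (1 / 2) \<odot>\<^bsub>B n\<^esub> (w \<oplus>\<^bsub>B n\<^esub> adj (B n) w)"
      and cn: "c' n = (- \<i> / 2) \<odot>\<^bsub>B n\<^esub> (w \<ominus>\<^bsub>B n\<^esub> adj (B n) w)"
      using yc by (simp_all add: a'_def c'_def w_def)
    have "a' n \<oplus>\<^bsub>B n\<^esub> \<i> \<odot>\<^bsub>B n\<^esub> c' n = (1 / 2) \<odot>\<^bsub>B n\<^esub> (w \<oplus>\<^bsub>B n\<^esub> adj (B n) w \<oplus>\<^bsub>B n\<^esub> (w \<ominus>\<^bsub>B n\<^esub> adj (B n) w))"
      using w(1) by (simp add: an cn B.A.scale_scale B.A.scale_add_right[of "w \<oplus>\<^bsub>B n\<^esub> adj (B n) w" n "w \<ominus>\<^bsub>B n\<^esub> adj (B n) w"])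
    also have "w \<oplus>\<^bsub>B n\<^esub> adj (B n) w \<oplus>\<^bsub>B n\<^esub> (w \<ominus>\<^bsub>B n\<^esub> adj (B n) w) = w \<oplus>\<^bsub>B n\<^esub> w"
      using w(1) by (simp add: a_minus_def B.A.a_assoc B.A.a_lcomm B.A.r_neg)
    also have "(1 / 2) \<odot>\<^bsub>B n\<^esub> (w \<oplus>\<^bsub>B n\<^esub> w) = w"
      using w(1) by (simp add: B.A.scale_add_right B.A.scale_half_double)
    finally have "nrm (B n) w \<le> nrm (B n) (a' n) + nrm (B n) (c' n)"
      using B.A.nrm_triangle[of "a' n" n "\<i> \<odot>\<^bsub>B n\<^esub> c' n"] w by (simp add: B.A.nrm_smult)
    then show "n \<in> {n. 2 < nrm (B n) (a' n)} \<union> {n. 2 < nrm (B n) (c' n)}"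
      using n by (auto simp: w_def)
  qed
  then show ?thesis using fa fc by (meson finite_UnI finite_subset)
qed

text \<open>The radius 1/8 comes from \<open>half_ball_bound\<close> applied to 4x, whose lift 4y is
  bounded by 4 at almost all coordinates. The finitely many exceptional values of \<open>y\<close>
  are replaced by zero, which does not change the class.\<close>

lemma small_ball_lift:
  assumes x: "x \<in> carrier (\<P> A)" "\<And>n. nrm (A n) (x n) \<le> 1 / 8"
  obtains y where "L x y" "\<And>n. nrm (B n) (y n) \<le> 1"
proof -
  obtain y where Ly: "L x y" using total[OF x(1)] by blast
  note yc = mem_right[OF Ly]
  have "nrm (A n) ((4 \<odot>\<^bsub>\<P> A\<^esub> x) n) \<le> 1 / 2" for n
    using x(1) x(2)[of n] by (simp add: A.A.nrm_smult)
  then have "finite {n. 4 < nrm (B n) ((4 \<odot>\<^bsub>\<P> B\<^esub> y) n)}"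
    by (rule half_ball_bound[OF scale[OF Ly]])
  then have fin: "finite {n. 1 < nrm (B n) (y n)}" using yc by (simp add: B.A.nrm_smult)
  define y' where "y' n = (if nrm (B n) (y n) \<le> 1 then y n else \<zero>\<^bsub>B n\<^esub>)" for n
  have y': "nrm (B n) (y' n) \<le> 1" "y' n \<in> carrier (B n)" for n using yc by (simp_all add: y'_def)
  then have y'c: "y' \<in> carrier (\<P> B)" by (intro B.productI) auto
  have "{n. y n \<noteq> y' n} \<subseteq> {n. 1 < nrm (B n) (y n)}" by (auto simp: y'_def)
  then have "B.asym_eq y y'" using fin by (intro B.asym_eqI_finite yc y'c) (rule finite_subset)
  then have "L x y'" by (rule right[OF Ly y'c])
  then show thesis using y'(1) that by blast
qed

text \<open>On \<open>S = {i. x i = y i}\<close> the product of \<open>x \<ominus> y\<close> with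
  \<open>chi A S\<close> is exactly zero, so its lift is null; this lift is
  \<open>u \<ominus> v\<close> cut down to the indices \<open>m\<close> with
  \<open>g m \<in> S\<close>. Here the exceptional indices still depend on the two
  sequences.\<close>

lemma coordinatewise_close:
  assumes g: "\<And>S. L (chi A S) (chi B (g -` S))" and xy: "L x u" "L y v" and \<epsilon>: "0 < \<epsilon>"
  shows "finite {m. x (g m) = y (g m) \<and> \<epsilon> < nrm (B m) (u m \<ominus>\<^bsub>B m\<^esub> v m)}"
proof -
  define S where "S = {i. x i = y i}"
  have c: "x \<in> carrier (\<P> A)" "y \<in> carrier (\<P> A)"
    "u \<in> carrier (\<P> B)" "v \<in> carrier (\<P> B)"
    using xy mem_left mem_right by blast+
  have "(x \<ominus>\<^bsub>\<P> A\<^esub> y) \<otimes>\<^bsub>\<P> A\<^esub> chi A S = \<zero>\<^bsub>\<P> A\<^esub>"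
    using c by (auto simp: fun_eq_iff chi_def S_def)
  then have "L \<zero>\<^bsub>\<P> A\<^esub> ((u \<ominus>\<^bsub>\<P> B\<^esub> v) \<otimes>\<^bsub>\<P> B\<^esub> chi B (g -` S))"
    using mult[OF minus[OF xy] g[of S]] by simp
  from close[OF this zero \<epsilon>]
  have "finite {m. \<epsilon> \<le> nrm (B m) (((u \<ominus>\<^bsub>\<P> B\<^esub> v) \<otimes>\<^bsub>\<P> B\<^esub> chi B (g -` S)) m \<ominus>\<^bsub>B m\<^esub> \<zero>\<^bsub>\<P> B\<^esub> m)}" .
  moreover have "{m. x (g m) = y (g m) \<and> \<epsilon> < nrm (B m) (u m \<ominus>\<^bsub>B m\<^esub> v m)} \<subseteq> \<dots>"
    using c by (auto simp: chi_def S_def) (simp add: a_minus_def)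
  ultimately show ?thesis by (rule finite_subset[rotated])
qed

text \<open>
  A lift of \<open>chi A S\<close> is asymptotically a projection that commutes with everything, uniformly
  on the unit balls; hence it is close to a sequence of projections that are eventually central.
\<close>

lemma chi_lift:
  assumes nc: "\<And>n. no_nontrivial_central_projections (B n)"
  obtains T where "L (chi A S) (chi B T)"
proof -
  obtain b0 where b0: "L (chi A S) b0" using total[OF A.chi_mem] by blast
  \<comment> \<open>Passing to the real part makes the lift exactly selfadjoint, as
    \<open>nearby_projection\<close> demands.\<close>
  define b where "b = (1 / 2) \<odot>\<^bsub>\<P> B\<^esub> (b0 \<oplus>\<^bsub>\<P> B\<^esub> adj (\<P> B) b0)"
  have adj_chi: "adj (\<P> A) (chi A S) = chi A S"
  proof -
    have "adj (A n) \<zero>\<^bsub>A n\<^esub> = \<zero>\<^bsub>A n\<^esub>" for n using A.A.adj_minus[of "\<one>\<^bsub>A n\<^esub>" n "\<one>\<^bsub>A n\<^esub>"] by (simp add: a_minus_def A.A.r_neg)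
    then show ?thesis by (simp add: fun_eq_iff chi_def)
  qed
  have "(1 / 2) \<odot>\<^bsub>\<P> A\<^esub> (chi A S \<oplus>\<^bsub>\<P> A\<^esub> chi A S) = chi A S"
    by (simp add: fun_eq_iff A.A.scale_add_right A.A.scale_half_double)
  then have Lb: "L (chi A S) b"
    using scale[OF add[OF b0 adj[OF b0]], of "1 / 2"] by (simp add: b_def adj_chi)
  note bc = mem_right[OF Lb]
  have bn: "b n \<in> carrier (B n)" for n using bc by simp
  have b_adj: "adj (B n) (b n) = b n" for n
    using mem_right[OF b0] by (simp add: b_def B.A.adj_smult B.A.adj_add B.A.adj_adj B.A.a_comm)
  obtain K where K: "0 < K" "\<And>n. nrm (B n) (b n) \<le> K" using B.product_bound[OF bc] by metis
  define t where "t n = nrm (B n) (b n \<otimes>\<^bsub>B n\<^esub> b n \<ominus>\<^bsub>B n\<^esub> b n)" for n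
  have "L (chi A S) (b \<otimes>\<^bsub>\<P> B\<^esub> b)" using mult[OF Lb Lb] by (simp add: A.chi_mult)
  from close[OF this Lb] have ft: "finite {n. \<epsilon> \<le> t n}" if "0 < \<epsilon>" for \<epsilon>
    using that by (simp add: t_def)
  have "\<exists>p. p \<in> carrier (B n) \<and> adj (B n) p = p \<and> p \<otimes>\<^bsub>B n\<^esub> p = p \<and>
      (t n \<le> 1 / 16 \<longrightarrow> nrm (B n) (p \<ominus>\<^bsub>B n\<^esub> b n) \<le> (2 * K + 1) * (2 * t n))" for n
  proof (cases "t n \<le> 1 / 16")
    case True
    obtain p where p: "p \<in> carrier (B n)" "adj (B n) p = p" "p \<otimes>\<^bsub>B n\<^esub> p = p"
      "nrm (B n) (p \<ominus>\<^bsub>B n\<^esub> b n) \<le> (2 * nrm (B n) (b n) + 1) * (2 * t n)"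
      using B.A.nearby_projection[OF bn b_adj True[unfolded t_def]] unfolding t_def by metis
    have "0 \<le> t n" using bn[of n] by (simp add: t_def)
    then have "(2 * nrm (B n) (b n) + 1) * (2 * t n) \<le> (2 * K + 1) * (2 * t n)"
      using K(2)[of n] by (intro mult_right_mono) auto
    then show ?thesis using p by auto
  next
    case False
    \<comment> \<open>Only finitely many indices are of this kind; any projection serves.\<close>
    then show ?thesis by (intro exI[of _ "\<one>\<^bsub>B n\<^esub>"]) simp
  qed
  then obtain p where p: "\<And>n. p n \<in> carrier (B n)" "\<And>n. adj (B n) (p n) = p n" "\<And>n. p n \<otimes>\<^bsub>B n\<^esub> p n = p n"
    "\<And>n. t n \<le> 1 / 16 \<Longrightarrow> nrm (B n) (p n \<ominus>\<^bsub>B n\<^esub> b n) \<le> (2 * K + 1) * (2 * t n)"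
    by metis
  have "nrm (B n) (p n) \<le> 1" for n
  proof -
    have "nrm (B n) (p n) * nrm (B n) (p n) = nrm (B n) (p n)"
      using B.A.cstar_identity[OF p(1)[of n]] p by (simp add: power2_eq_square)
    then show ?thesis by (metis mult_cancel_right2 order_refl zero_le_one)
  qed
  then have pc: "p \<in> carrier (\<P> B)" using p(1) by (intro B.productI)
  have "B.asym_eq b p"
    unfolding B.asym_eq_iff[OF bc pc]
  proof (intro allI impI)
    fix \<epsilon> :: real assume \<epsilon>: "0 < \<epsilon>"
    \<comment> \<open>\<open>1 / 16\<close> is the range of \<open>nearby_projection\<close>; the
      second bound makes its estimate at most \<open>\<epsilon> / 2\<close>.\<close>
    define \<eta> where "\<eta> = min (1 / 16) (\<epsilon> / (4 * (2 * K + 1)))"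
    have \<eta>: "0 < \<eta>" using \<epsilon> K by (simp add: \<eta>_def)
    have "{n. \<epsilon> \<le> nrm (B n) (b n \<ominus>\<^bsub>B n\<^esub> p n)} \<subseteq> {n. \<eta> \<le> t n}"
    proof (rule subsetI, rule ccontr)
      fix n assume n: "n \<in> {n. \<epsilon> \<le> nrm (B n) (b n \<ominus>\<^bsub>B n\<^esub> p n)}" "n \<notin> {n. \<eta> \<le> t n}"
      then have "t n < \<eta>" by simp
      then have tn: "t n \<le> 1 / 16" "t n < \<epsilon> / (4 * (2 * K + 1))" by (simp_all add: \<eta>_def)
      have "(2 * K + 1) * (2 * t n) \<le> \<epsilon> / 2" using tn(2) K by (simp add: field_simps)
      then have "nrm (B n) (p n \<ominus>\<^bsub>B n\<^esub> b n) \<le> \<epsilon> / 2" using p(4)[OF tn(1)] by simp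
      moreover have "nrm (B n) (p n \<ominus>\<^bsub>B n\<^esub> b n) = nrm (B n) (b n \<ominus>\<^bsub>B n\<^esub> p n)"
        by (rule B.A.nrm_minus_commute[OF p(1) bn])
      ultimately show False using n \<epsilon> by simp
    qed
    then show "finite {n. \<epsilon> \<le> nrm (B n) (b n \<ominus>\<^bsub>B n\<^esub> p n)}" using ft[OF \<eta>] by (rule finite_subset)
  qed
  then have Lp: "L (chi A S) p" by (rule right[OF Lb pc])
  define N where "N = {n. \<exists>x\<in>carrier (B n). p n \<otimes>\<^bsub>B n\<^esub> x \<noteq> x \<otimes>\<^bsub>B n\<^esub> p n}"
  \<comment> \<open>At each index where \<open>p n\<close> is not central an element of norm one is
    chosen whose commutator with \<open>p n\<close> has norm one. They form a bounded sequence, and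
    a sequence corresponding to it on the side of \<open>A\<close> commutes with
    \<open>chi A S\<close>; so there are finitely many such indices.\<close>
  have "\<exists>y. y \<in> carrier (B n) \<and> nrm (B n) y \<le> 1 \<and>
      (n \<in> N \<longrightarrow> nrm (B n) (p n \<otimes>\<^bsub>B n\<^esub> y \<ominus>\<^bsub>B n\<^esub> y \<otimes>\<^bsub>B n\<^esub> p n) = 1)" for n
  proof (cases "n \<in> N")
    case True
    then obtain x where "x \<in> carrier (B n)" "p n \<otimes>\<^bsub>B n\<^esub> x \<noteq> x \<otimes>\<^bsub>B n\<^esub> p n" unfolding N_def by blast
    then obtain y where "y \<in> carrier (B n)" "nrm (B n) y = 1" "nrm (B n) (p n \<otimes>\<^bsub>B n\<^esub> y \<ominus>\<^bsub>B n\<^esub> y \<otimes>\<^bsub>B n\<^esub> p n) = 1"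
      using B.A.noncentral_projection[OF p(1) p(3)] by metis
    then show ?thesis by auto
  next
    case False
    then show ?thesis by (intro exI[of _ "\<one>\<^bsub>B n\<^esub>"]) simp
  qed
  then obtain y where y: "\<And>n. y n \<in> carrier (B n)" "\<And>n. nrm (B n) (y n) \<le> 1"
    "\<And>n. n \<in> N \<Longrightarrow> nrm (B n) (p n \<otimes>\<^bsub>B n\<^esub> y n \<ominus>\<^bsub>B n\<^esub> y n \<otimes>\<^bsub>B n\<^esub> p n) = 1"
    by metis
  have yc: "y \<in> carrier (\<P> B)" using y by (intro B.productI)
  obtain x where Lx: "L x y" using surjective[OF yc] by blast
  have comm: "x \<otimes>\<^bsub>\<P> A\<^esub> chi A S = chi A S \<otimes>\<^bsub>\<P> A\<^esub> x"
    using mem_left[OF Lx] by (simp add: fun_eq_iff chi_def)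
  have "finite {n. 1 \<le> nrm (B n) ((p \<otimes>\<^bsub>\<P> B\<^esub> y) n \<ominus>\<^bsub>B n\<^esub> (y \<otimes>\<^bsub>\<P> B\<^esub> p) n)}"
    by (rule close[OF mult[OF Lp Lx] mult[OF Lx Lp, unfolded comm] zero_less_one])
  moreover have "N \<subseteq> \<dots>" using y(3) by auto
  ultimately have fN: "finite N" by (rule finite_subset[rotated])
  define T where "T = {n. p n = \<one>\<^bsub>B n\<^esub>}"
  have "p n = chi B T n" if "n \<notin> N" for n
  proof -
    have "central_projection (B n) (p n)"
      using that p unfolding central_projection_def N_def by auto
    then have "p n = \<zero>\<^bsub>B n\<^esub> \<or> p n = \<one>\<^bsub>B n\<^esub>" using nc[of n] unfolding no_nontrivial_central_projections_def by blast
    then show ?thesis using B.A.one_neq_zero[of n] by (auto simp: chi_def T_def)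
  qed
  then have "{n. p n \<noteq> chi B T n} \<subseteq> N" by blast
  then have "B.asym_eq p (chi B T)" using fN by (intro B.asym_eqI_finite pc B.chi_mem) (rule finite_subset)
  then have "L (chi A S) (chi B T)" by (rule right[OF Lp B.chi_mem])
  then show thesis by (rule that)
qed

lemma chi_iff: "L (chi A S) (chi B T) \<Longrightarrow> L (chi A S') (chi B T') \<Longrightarrow>
    finite (sym_diff S S') \<longleftrightarrow> finite (sym_diff T T')"
  using cong[of "chi A S" "chi B T" "chi A S'" "chi B T'"] by (simp add: A.asym_eq_chi B.asym_eq_chi)

end

section \<open>Borel sets of codes\<close>

lemma borel_in_vimage:
  assumes f: "continuous_map euclidean T f" and S: "borel_in T S"
  shows "f -` S \<in> sigma_sets UNIV {U. open U}"
  using S unfolding borel_in_def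
proof induction
  case (Basic a)
  then have "openin euclidean {x \<in> topspace euclidean. f x \<in> a}"
    using openin_continuous_map_preimage[OF f] by blast
  then show ?case by (auto simp: vimage_def intro: sigma_sets.Basic)
next
  case Empty
  show ?case by (simp add: sigma_sets.Empty)
next
  case (Compl a)
  have "f x \<in> topspace T" for x using f by (auto simp: continuous_map_def)
  then have "f -` (topspace T - a) = UNIV - f -` a" by auto
  then show ?case using sigma_sets.Compl[OF Compl.IH] by simp
next
  case (Union a)
  then show ?case by (simp add: vimage_UN sigma_sets.Union)
qed

text \<open>A bound \<open>s < \<epsilon>\<close> expresses that the supremum of the
  \<open>F n (v n)\<close> is less than \<epsilon>. The tail is below \<open>\<epsilon> / 2\<close>
  for every \<open>v\<close>, so finitely many coordinates decide.\<close>

lemma open_uniform_less: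
  fixes F :: "nat \<Rightarrow> nat \<Rightarrow> real"
  assumes le: "\<And>n k. F n k \<le> c n" and c: "c \<longlonglongrightarrow> 0" and \<epsilon>: "0 < \<epsilon>"
  shows "open {v. \<exists>s<\<epsilon>. \<forall>n. F n (v n) \<le> s}"
  unfolding open_iff_cyl
proof (intro ballI)
  fix v assume "v \<in> {v. \<exists>s<\<epsilon>. \<forall>n. F n (v n) \<le> s}"
  then obtain s where s: "s < \<epsilon>" "\<And>n. F n (v n) \<le> s" by blast
  have "\<forall>\<^sub>F n in sequentially. c n < \<epsilon> / 2" using order_tendstoD(2)[OF c, of "\<epsilon> / 2"] \<epsilon> by simp
  then obtain N where N: "\<And>n. N \<le> n \<Longrightarrow> c n < \<epsilon> / 2" unfolding eventually_sequentially by blast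
  have "w \<in> {v. \<exists>s<\<epsilon>. \<forall>n. F n (v n) \<le> s}" if w: "w \<in> cyl N v" for w
  proof -
    have "F n (w n) \<le> max s (\<epsilon> / 2)" for n
    proof (cases "n < N")
      case True
      then show ?thesis using w s(2)[of n] by simp
    next
      case False
      then show ?thesis using N[of n] le[of n "w n"] by simp
    qed
    moreover have "max s (\<epsilon> / 2) < \<epsilon>" using s(1) \<epsilon> by simp
    ultimately show ?thesis by blast
  qed
  then have "cyl N v \<subseteq> {v. \<exists>s<\<epsilon>. \<forall>n. F n (v n) \<le> s}" by (rule subsetI)
  then show "\<exists>n. cyl n v \<subseteq> {v. \<exists>s<\<epsilon>. \<forall>n. F n (v n) \<le> s}" by (rule exI)
qed

lemma nrm_cstar_product: "nrm (\<P> A) x = (SUP n. nrm (A n) (x n))"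
  by (simp add: cstar_product_def)

context cstar_sequence
begin

lemma nrm_product_le_iff:
  assumes "x \<in> carrier (\<P> A)"
  shows "nrm (\<P> A) x \<le> s \<longleftrightarrow> (\<forall>n. nrm (A n) (x n) \<le> s)"
proof -
  obtain K where "\<And>n. nrm (A n) (x n) \<le> K" using product_bound[OF assms] by metis
  then have bdd: "bdd_above (range (\<lambda>n. nrm (A n) (x n)))" by (rule bdd_aboveI2)
  show ?thesis
    unfolding nrm_cstar_product using cSUP_le_iff[OF UNIV_not_empty bdd, of s] by (simp only: ball_UNIV)
qed

lemma mem_unit_ball: "x \<in> unit_ball A \<longleftrightarrow> (\<forall>n. x n \<in> carrier (A n) \<and> nrm (A n) (x n) \<le> 1)"
proof -
  have "x \<in> unit_ball A \<longleftrightarrow> x \<in> carrier (\<P> A) \<and> (\<forall>n. nrm (A n) (x n) \<le> 1)"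
    using nrm_product_le_iff[of x 1] unfolding unit_ball_def mem_Collect_eq by metis
  then show ?thesis using productI[of x 1] product_coord[of x] by metis
qed

text \<open>Multiplication by a null sequence \<open>a\<close> makes the tails of the strict
  seminorms uniformly small on bounded sequences, which is what \<open>open_uniform_less\<close>
  needs.\<close>

lemma continuous_strict_decode:
  fixes d :: "nat \<Rightarrow> nat \<Rightarrow> 'a"
  assumes d: "\<And>n k. d n k \<in> carrier (A n)" "\<And>n k. nrm (A n) (d n k) \<le> 1"
  shows "continuous_map euclidean (subtopology (strict_topology A) (unit_ball A)) (\<lambda>v n. d n (v n))"
proof -
  have dP: "(\<lambda>n. d n (v n)) \<in> carrier (\<P> A)" for v
    using d by (intro productI)
  have less_iff: "nrm (\<P> A) z < \<epsilon> \<longleftrightarrow> (\<exists>s<\<epsilon>. \<forall>n. nrm (A n) (z n) \<le> s)"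
    if "z \<in> carrier (\<P> A)" for z \<epsilon>
    using nrm_product_le_iff[OF that] by (metis order_refl order_le_less_trans)
  have bound: "\<exists>K. \<forall>n k. nrm (A n) (d n k \<ominus>\<^bsub>A n\<^esub> x n) \<le> K" if x: "x \<in> carrier (\<P> A)" for x
  proof -
    obtain K where "\<And>n. nrm (A n) (x n) \<le> K" using product_bound[OF x] by metis
    moreover have "nrm (A n) (d n k \<ominus>\<^bsub>A n\<^esub> x n) \<le> nrm (A n) (d n k) + nrm (A n) (x n)" for n k
      by (rule A.nrm_minus[OF d(1) product_coord[OF x]])
    ultimately have "nrm (A n) (d n k \<ominus>\<^bsub>A n\<^esub> x n) \<le> 1 + K" for n k
      using d(2)[of n k] by (smt (verit))
    then show ?thesis by blast
  qed
  define \<L> where "\<L> = {{y \<in> carrier (\<P> A). nrm (\<P> A)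
          ((y \<ominus>\<^bsub>\<P> A\<^esub> x) \<otimes>\<^bsub>\<P> A\<^esub> a) < \<epsilon>} | x a \<epsilon>.
        x \<in> carrier (\<P> A) \<and> a \<in> sum_ideal A \<and> 0 < \<epsilon>}"
  define \<R> where "\<R> = {{y \<in> carrier (\<P> A). nrm (\<P> A)
          (a \<otimes>\<^bsub>\<P> A\<^esub> (y \<ominus>\<^bsub>\<P> A\<^esub> x)) < \<epsilon>} | x a \<epsilon>.
        x \<in> carrier (\<P> A) \<and> a \<in> sum_ideal A \<and> 0 < \<epsilon>}"
  have strict: "strict_topology A = topology_generated_by (\<L> \<union> \<R>)"
    unfolding strict_topology_def Let_def \<L>_def \<R>_def by (rule refl)
  have "continuous_map euclidean (strict_topology A) (\<lambda>v n. d n (v n))"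
    unfolding strict
  proof (rule continuous_on_generated_topo)
    fix U
    assume "U \<in> \<L> \<union> \<R>"
    then obtain x a \<epsilon> where xa: "x \<in> carrier (\<P> A)" "a \<in> sum_ideal A" "0 < \<epsilon>" and
      U: "U = {y \<in> carrier (\<P> A). nrm (\<P> A)
          ((y \<ominus>\<^bsub>\<P> A\<^esub> x) \<otimes>\<^bsub>\<P> A\<^esub> a) < \<epsilon>} \<or>
        U = {y \<in> carrier (\<P> A). nrm (\<P> A)
          (a \<otimes>\<^bsub>\<P> A\<^esub> (y \<ominus>\<^bsub>\<P> A\<^esub> x)) < \<epsilon>}" unfolding \<L>_def \<R>_def by blast
    have a: "a \<in> carrier (\<P> A)" "(\<lambda>n. nrm (A n) (a n)) \<longlonglongrightarrow> 0"
      using xa(2) unfolding sum_ideal_def mem_Collect_eq by blast+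
    obtain K where K: "\<And>n k. nrm (A n) (d n k \<ominus>\<^bsub>A n\<^esub> x n) \<le> K" using bound[OF xa(1)] by blast
    have c0: "(\<lambda>n. K * nrm (A n) (a n)) \<longlonglongrightarrow> 0" using tendsto_mult_right_zero[OF a(2)] by simp
    have xn: "x n \<in> carrier (A n)" and an: "a n \<in> carrier (A n)" for n using xa(1) a(1) by auto
    have "nrm (A n) ((d n k \<ominus>\<^bsub>A n\<^esub> x n) \<otimes>\<^bsub>A n\<^esub> a n) \<le> K * nrm (A n) (a n)" for n k
      using A.nrm_mult[of "d n k \<ominus>\<^bsub>A n\<^esub> x n" n "a n"] mult_right_mono[OF K A.nrm_nonneg[OF an[of n]], of n k] d xn an
      by (meson A.minus_closed order_trans)
    then have 1: "open {v. \<exists>s<\<epsilon>. \<forall>n. nrm (A n) ((d n (v n) \<ominus>\<^bsub>A n\<^esub> x n) \<otimes>\<^bsub>A n\<^esub> a n) \<le> s}"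
      by (rule open_uniform_less[where F = "\<lambda>n k. nrm (A n) ((d n k \<ominus>\<^bsub>A n\<^esub> x n) \<otimes>\<^bsub>A n\<^esub> a n)", OF _ c0 xa(3)])
    have "nrm (A n) (a n \<otimes>\<^bsub>A n\<^esub> (d n k \<ominus>\<^bsub>A n\<^esub> x n)) \<le> K * nrm (A n) (a n)" for n k
      using A.nrm_mult[of "a n" n "d n k \<ominus>\<^bsub>A n\<^esub> x n"] mult_right_mono[OF K A.nrm_nonneg[OF an[of n]], of n k] d xn an
      by (metis A.minus_closed mult.commute order_trans)
    then have 2: "open {v. \<exists>s<\<epsilon>. \<forall>n. nrm (A n) (a n \<otimes>\<^bsub>A n\<^esub> (d n (v n) \<ominus>\<^bsub>A n\<^esub> x n)) \<le> s}"
      by (rule open_uniform_less[where F = "\<lambda>n k. nrm (A n) (a n \<otimes>\<^bsub>A n\<^esub> (d n k \<ominus>\<^bsub>A n\<^esub> x n))", OF _ c0 xa(3)])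
    have c: "((\<lambda>n. d n (v n)) \<ominus>\<^bsub>\<P> A\<^esub> x) \<in> carrier (\<P> A)" for v
      using dP xa(1) by (rule P.minus_closed)
    have "nrm (\<P> A) (((\<lambda>n. d n (v n)) \<ominus>\<^bsub>\<P> A\<^esub> x) \<otimes>\<^bsub>\<P> A\<^esub> a) < \<epsilon> \<longleftrightarrow>
        (\<exists>s<\<epsilon>. \<forall>n. nrm (A n) ((d n (v n) \<ominus>\<^bsub>A n\<^esub> x n) \<otimes>\<^bsub>A n\<^esub> a n) \<le> s)" for v
      unfolding less_iff[OF product_mult[OF c a(1)]] product_simps product_minus[OF dP xa(1)] by (rule refl)
    moreover have "nrm (\<P> A) (a \<otimes>\<^bsub>\<P> A\<^esub> ((\<lambda>n. d n (v n)) \<ominus>\<^bsub>\<P> A\<^esub> x)) < \<epsilon> \<longleftrightarrow>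
        (\<exists>s<\<epsilon>. \<forall>n. nrm (A n) (a n \<otimes>\<^bsub>A n\<^esub> (d n (v n) \<ominus>\<^bsub>A n\<^esub> x n)) \<le> s)" for v
      unfolding less_iff[OF product_mult[OF a(1) c]] product_simps product_minus[OF dP xa(1)] by (rule refl)
    ultimately have "(\<lambda>v n. d n (v n)) -` U = {v. \<exists>s<\<epsilon>. \<forall>n. nrm (A n) ((d n (v n) \<ominus>\<^bsub>A n\<^esub> x n) \<otimes>\<^bsub>A n\<^esub> a n) \<le> s} \<or>
        (\<lambda>v n. d n (v n)) -` U = {v. \<exists>s<\<epsilon>. \<forall>n. nrm (A n) (a n \<otimes>\<^bsub>A n\<^esub> (d n (v n) \<ominus>\<^bsub>A n\<^esub> x n)) \<le> s}"
      using U by (elim disjE) (simp_all add: vimage_def dP)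
    then have "open ((\<lambda>v n. d n (v n)) -` U)" using 1 2 by (elim disjE) (simp_all only:)
    then show "openin euclidean ((\<lambda>v n. d n (v n)) -` U \<inter> topspace euclidean)" by simp
  next
    \<comment> \<open>\<open>continuous_on_generated_topo\<close> also asks that the generating sets
      cover the range. With \<open>a\<close> zero the seminorm vanishes, so one such set contains
      the whole product.\<close>
    have z: "\<zero>\<^bsub>\<P> A\<^esub> \<in> sum_ideal A"
      by (rule additive_subgroup.zero_closed[OF I.additive_subgroup_axioms])
    have n0: "nrm (\<P> A) \<zero>\<^bsub>\<P> A\<^esub> < 1"
    proof -
      have "nrm (\<P> A) \<zero>\<^bsub>\<P> A\<^esub> \<le> 0" by (subst nrm_product_le_iff) simp_all
      then show ?thesis by simp
    qed
    show "(\<lambda>v n. d n (v n)) ` topspace euclidean \<subseteq> \<Union> (\<L> \<union> \<R>)"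
    proof (rule image_subsetI)
      fix v :: "nat \<Rightarrow> nat"
      define y where "y = (\<lambda>n. d n (v n))"
      have y: "y \<in> carrier (\<P> A)" unfolding y_def by (rule dP)
      have "(y \<ominus>\<^bsub>\<P> A\<^esub> \<one>\<^bsub>\<P> A\<^esub>) \<otimes>\<^bsub>\<P> A\<^esub> \<zero>\<^bsub>\<P> A\<^esub> = \<zero>\<^bsub>\<P> A\<^esub>"
        using y by (intro P.r_null P.minus_closed) auto
      then have "y \<in> {y \<in> carrier (\<P> A). nrm (\<P> A)
          ((y \<ominus>\<^bsub>\<P> A\<^esub> \<one>\<^bsub>\<P> A\<^esub>) \<otimes>\<^bsub>\<P> A\<^esub> \<zero>\<^bsub>\<P> A\<^esub>) < 1}"
        using y n0 by simp
      moreover have "{y \<in> carrier (\<P> A). nrm (\<P> A)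
          ((y \<ominus>\<^bsub>\<P> A\<^esub> \<one>\<^bsub>\<P> A\<^esub>) \<otimes>\<^bsub>\<P> A\<^esub> \<zero>\<^bsub>\<P> A\<^esub>) < 1} \<in> \<L>"
        unfolding \<L>_def using z product_one zero_less_one by blast
      ultimately show "(\<lambda>n. d n (v n)) \<in> \<Union> (\<L> \<union> \<R>)"
        unfolding y_def[symmetric] by (intro UnionI[OF UnI1])
    qed
  qed
  moreover have "(\<lambda>n. d n (v n)) \<in> unit_ball A" for v using d by (simp add: mem_unit_ball)
  ultimately show ?thesis by (simp add: continuous_map_in_subtopology image_subset_iff)
qed

end

lemma borel_codes:
  fixes d :: "nat \<Rightarrow> nat \<Rightarrow> 'a" and e :: "nat \<Rightarrow> nat \<Rightarrow> 'b"
  assumes "cstar_sequence A" "cstar_sequence B" and triv: "topologically_trivial A B \<Lambda>"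
    and d: "\<And>n k. d n k \<in> carrier (A n)" "\<And>n k. nrm (A n) (d n k) \<le> 1"
    and e: "\<And>n k. e n k \<in> carrier (B n)" "\<And>n k. nrm (B n) (e n k) \<le> 1"
  shows "{(v, w). \<Lambda> (quot_map A (\<lambda>n. d n (v n))) = quot_map B (\<lambda>n. e n (w n))}
    \<in> sigma_sets UNIV {U. open U}"
proof -
  interpret A: cstar_sequence A by fact
  interpret B: cstar_sequence B by fact
  let ?f = "\<lambda>p. (\<lambda>n. d n (fst p n), \<lambda>n. e n (snd p n))"
  have "continuous_map euclidean (subtopology (strict_topology A) (unit_ball A)) ((\<lambda>v n. d n (v n)) \<circ> fst)"
    by (rule continuous_map_compose[OF _ A.continuous_strict_decode[OF d]])
      (simp add: continuous_map_iff_continuous2 continuous_on_fst)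
  moreover have "continuous_map euclidean (subtopology (strict_topology B) (unit_ball B)) ((\<lambda>v n. e n (v n)) \<circ> snd)"
    by (rule continuous_map_compose[OF _ B.continuous_strict_decode[OF e]])
      (simp add: continuous_map_iff_continuous2 continuous_on_snd)
  ultimately have "continuous_map euclidean (prod_topology (subtopology (strict_topology A) (unit_ball A))
      (subtopology (strict_topology B) (unit_ball B))) ?f"
    by (simp add: continuous_map_pairwise comp_def)
  from borel_in_vimage[OF this triv[unfolded topologically_trivial_def]]
  have "?f -` {(a, b). a \<in> unit_ball A \<and> b \<in> unit_ball B \<and> \<Lambda> (quot_map A a) = quot_map B b}
      \<in> sigma_sets UNIV {U. open U}" .
  moreover have "?f -` {(a, b). a \<in> unit_ball A \<and> b \<in> unit_ball B \<and> \<Lambda> (quot_map A a) = quot_map B b} =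
      {(v, w). \<Lambda> (quot_map A (\<lambda>n. d n (v n))) = quot_map B (\<lambda>n. e n (w n))}"
    using d e by (auto simp: A.mem_unit_ball B.mem_unit_ball)
  ultimately show ?thesis by (simp only:)
qed

section \<open>The theorem\<close>

lemma (in cstar_sequence) asym_eq_sym:
  assumes "x \<in> carrier (\<P> A)" "y \<in> carrier (\<P> A)" "asym_eq x y"
  shows "asym_eq y x"
proof -
  have "nrm (A n) (y n \<ominus>\<^bsub>A n\<^esub> x n) = nrm (A n) (x n \<ominus>\<^bsub>A n\<^esub> y n)" for n
    by (rule A.nrm_minus_commute[OF product_coord[OF assms(2)] product_coord[OF assms(1)]])
  then show ?thesis using assms(3) unfolding asym_eq_def by presburger
qed

lemma (in cstar_sequence) asym_eqI_le:
  assumes c: "\<And>n. x n \<in> carrier (A n)" "\<And>n. y n \<in> carrier (A n)"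
    and le: "\<And>n. nrm (A n) (x n \<ominus>\<^bsub>A n\<^esub> y n) \<le> 1 / real (Suc n)"
  shows "asym_eq x y"
  unfolding asym_eq_def
  by (rule tendsto_zero_le[where K = 1 and g = "\<lambda>n. 1 / real (Suc n)"])
    (use LIMSEQ_Suc[OF lim_1_over_n] le in \<open>auto intro!: A.nrm_nonneg A.minus_closed c\<close>)

context product_correspondence
begin

text \<open>The only axiom without a mirror image is \<open>right\<close>; its counterpart on the
  left follows from \<open>total\<close>, \<open>cong\<close> and \<open>right\<close>. The converse
  serves to apply \<open>chi_lift\<close> from \<open>B\<close> to \<open>A\<close>.\<close>

lemma converse: "product_correspondence B A (\<lambda>y x. L x y)"
proof (unfold_locales, goal_cases)
  case (6 y x x')
  obtain y' where L': "L x' y'" using total[OF 6(2)] by blast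
  have "B.asym_eq y' y"
    using cong[OF L' 6(1)] A.asym_eq_sym[OF mem_left[OF 6(1)] 6(2,3)] by blast
  then show ?case by (rule right[OF L' mem_right[OF 6(1)]])
qed (auto simp: cong mem_left mem_right total surjective add mult scale adj one)

lemma almost_homomorphism_chi:
  assumes nA: "\<And>n. no_nontrivial_central_projections (A n)"
    and nB: "\<And>n. no_nontrivial_central_projections (B n)"
  shows "almost_homomorphism (\<lambda>S T. L (chi A S) (chi B T))"
proof
  interpret conv: product_correspondence B A "\<lambda>y x. L x y" by (rule converse)
  show "\<exists>T. L (chi A S) (chi B T)" for S using chi_lift[OF nB] by metis
  show "\<exists>S. L (chi A S) (chi B T)" for T using conv.chi_lift[OF nA] by metis
  show "finite (sym_diff S S') \<longleftrightarrow> finite (sym_diff T T')"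
    if "L (chi A S) (chi B T)" "L (chi A S') (chi B T')" for S T S' T'
    using that by (rule chi_iff)
  show "L (chi A S) (chi B T')" if "L (chi A S) (chi B T)" "finite (sym_diff T T')" for S T T'
    using right[OF that(1) B.chi_mem] that(2) by (simp add: B.asym_eq_chi)
  show "L (chi A (S \<inter> S')) (chi B (T \<inter> T'))"
    if "L (chi A S) (chi B T)" "L (chi A S') (chi B T')" for S T S' T'
    using mult[OF that] by (simp add: A.chi_mult B.chi_mult)
  show "L (chi A (- S)) (chi B (- T))" if "L (chi A S) (chi B T)" for S T
    using minus[OF one that] by (simp add: A.chi_compl B.chi_compl)
qed

text \<open>
  A bounded sequence is rescaled, coordinate by coordinate, into the ball in which the codes live.
  The scaling factors are integers, so that only finitely many of them occur in one sequence.
\<close>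

lemma lift_from_unit_ball:
  fixes x :: "nat \<Rightarrow> 'a" and k :: "nat \<Rightarrow> nat"
  assumes g: "\<And>S. L (chi A S) (chi B (g -` S))" and L: "L x y" "L x' y'"
    and k: "\<And>n. k n \<le> J" "\<And>n. x n = of_nat (k n) \<odot>\<^bsub>A n\<^esub> x' n"
    and w: "\<And>m. w m \<in> carrier (B m)" and close_w: "\<And>\<epsilon>. 0 < \<epsilon> \<Longrightarrow> finite {m. \<epsilon> < nrm (B m) (y' m \<ominus>\<^bsub>B m\<^esub> w m)}"
    and \<epsilon>: "0 < \<epsilon>"
  shows "finite {m. \<epsilon> < nrm (B m) (y m \<ominus>\<^bsub>B m\<^esub> of_nat (k (g m)) \<odot>\<^bsub>B m\<^esub> w m)}"
proof -
  define \<eta> where "\<eta> = \<epsilon> / (2 * (real J + 1))"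
  have \<eta>: "0 < \<eta>" "real J * \<eta> \<le> \<epsilon> / 2" using \<epsilon> by (simp_all add: \<eta>_def field_simps)
  note xc = mem_left[OF L(1)] and x'c = mem_left[OF L(2)] and yc = mem_right[OF L(1)] and y'c = mem_right[OF L(2)]
  \<comment> \<open>Each scaling factor \<open>j \<le> J\<close> is treated by its own constant
    multiple of \<open>x'\<close>, and the finitely many exceptional sets are united.\<close>
  define M where "M j = {m. x (g m) = (of_nat j \<odot>\<^bsub>\<P> A\<^esub> x') (g m) \<and>
    \<epsilon> / 2 < nrm (B m) (y m \<ominus>\<^bsub>B m\<^esub> (of_nat j \<odot>\<^bsub>\<P> B\<^esub> y') m)}" for j
  have "finite (M j)" for j
    unfolding M_def using \<epsilon> by (intro coordinatewise_close[OF g L(1) scale[OF L(2)]]) simp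
  then have fin: "finite ((\<Union>j\<le>J. M j) \<union> {m. \<eta> < nrm (B m) (y' m \<ominus>\<^bsub>B m\<^esub> w m)})"
    using close_w[OF \<eta>(1)] by blast
  have "{m. \<epsilon> < nrm (B m) (y m \<ominus>\<^bsub>B m\<^esub> of_nat (k (g m)) \<odot>\<^bsub>B m\<^esub> w m)} \<subseteq>
      (\<Union>j\<le>J. M j) \<union> {m. \<eta> < nrm (B m) (y' m \<ominus>\<^bsub>B m\<^esub> w m)}"
  proof (rule subsetI, rule ccontr)
    fix m
    assume m: "m \<in> {m. \<epsilon> < nrm (B m) (y m \<ominus>\<^bsub>B m\<^esub> of_nat (k (g m)) \<odot>\<^bsub>B m\<^esub> w m)}"
      and not: "m \<notin> (\<Union>j\<le>J. M j) \<union> {m. \<eta> < nrm (B m) (y' m \<ominus>\<^bsub>B m\<^esub> w m)}"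
    define j where "j = k (g m)"
    have j: "j \<le> J" using k(1) by (simp add: j_def)
    have ym: "y m \<in> carrier (B m)" "y' m \<in> carrier (B m)" using yc y'c by simp_all
    have "m \<notin> M j" using not j by blast
    moreover have "x (g m) = (of_nat j \<odot>\<^bsub>\<P> A\<^esub> x') (g m)" using k(2)[of "g m"] by (simp add: j_def)
    ultimately have 1: "nrm (B m) (y m \<ominus>\<^bsub>B m\<^esub> of_nat j \<odot>\<^bsub>B m\<^esub> y' m) \<le> \<epsilon> / 2" by (simp add: M_def)
    have "of_nat j \<odot>\<^bsub>B m\<^esub> y' m \<ominus>\<^bsub>B m\<^esub> of_nat j \<odot>\<^bsub>B m\<^esub> w m = of_nat j \<odot>\<^bsub>B m\<^esub> (y' m \<ominus>\<^bsub>B m\<^esub> w m)"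
      by (rule B.A.scale_minus[OF ym(2) w, symmetric])
    then have "nrm (B m) (of_nat j \<odot>\<^bsub>B m\<^esub> y' m \<ominus>\<^bsub>B m\<^esub> of_nat j \<odot>\<^bsub>B m\<^esub> w m) = real j * nrm (B m) (y' m \<ominus>\<^bsub>B m\<^esub> w m)"
      using B.A.nrm_smult[of "y' m \<ominus>\<^bsub>B m\<^esub> w m" m "of_nat j"] ym w by simp
    also have "\<dots> \<le> real J * \<eta>" using not j ym w by (intro mult_mono) auto
    finally have 2: "nrm (B m) (of_nat j \<odot>\<^bsub>B m\<^esub> y' m \<ominus>\<^bsub>B m\<^esub> of_nat j \<odot>\<^bsub>B m\<^esub> w m) \<le> \<epsilon> / 2"
      using \<eta>(2) by simp
    have "nrm (B m) (y m \<ominus>\<^bsub>B m\<^esub> of_nat j \<odot>\<^bsub>B m\<^esub> w m) \<le> \<epsilon>"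
      using B.A.nrm_minus_triangle[of "y m" m "of_nat j \<odot>\<^bsub>B m\<^esub> y' m" "of_nat j \<odot>\<^bsub>B m\<^esub> w m"] 1 2 ym w by simp
    then show False using m by (simp add: j_def)
  qed
  then show ?thesis using fin by (rule finite_subset)
qed

end

lemma product_correspondence_of_iso:
  assumes A: "cstar_sequence A" and B: "cstar_sequence B"
    and iso: "\<Lambda> \<in> cstar_iso (reduced_product A) (reduced_product B)"
  shows "product_correspondence A B (\<lambda>x y. x \<in> carrier (\<P> A) \<and>
    y \<in> carrier (\<P> B) \<and> \<Lambda> (quot_map A x) = quot_map B y)"
proof -
  interpret A: cstar_sequence A by fact
  interpret B: cstar_sequence B by fact
  have hom: "\<Lambda> \<in> ring_hom (reduced_product A) (reduced_product B)"
    and bij: "bij_betw \<Lambda> (carrier (reduced_product A)) (carrier (reduced_product B))"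
    and sc: "\<And>c K. K \<in> carrier (reduced_product A) \<Longrightarrow>
      \<Lambda> (c \<odot>\<^bsub>reduced_product A\<^esub> K) = c \<odot>\<^bsub>reduced_product B\<^esub> \<Lambda> K"
    and ad: "\<And>K. K \<in> carrier (reduced_product A) \<Longrightarrow>
      \<Lambda> (adj (reduced_product A) K) = adj (reduced_product B) (\<Lambda> K)"
    using iso unfolding cstar_iso_def ring_iso_def by blast+
  show ?thesis
  proof (unfold_locales, goal_cases)
    case (3 x)
    then have "\<Lambda> (quot_map A x) \<in> carrier (reduced_product B)"
      using bij A.quot_map_mem by (blast dest: bij_betwE)
    then show ?case using 3 unfolding B.reduced_carrier by blast
  next
    case (4 y)
    then obtain K where "K \<in> carrier (reduced_product A)" "\<Lambda> K = quot_map B y"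
      using bij B.quot_map_mem by (metis bij_betw_imp_surj_on imageE)
    then show ?case using 4 unfolding A.reduced_carrier by blast
  next
    case (5 x y x' y')
    have "A.asym_eq x x' \<longleftrightarrow> quot_map A x = quot_map A x'" using A.quot_map_eq_iff 5 by blast
    also have "\<dots> \<longleftrightarrow> \<Lambda> (quot_map A x) = \<Lambda> (quot_map A x')"
      using bij 5 A.quot_map_mem by (metis bij_betw_def inj_onD)
    also have "\<dots> \<longleftrightarrow> B.asym_eq y y'" using B.quot_map_eq_iff 5 by metis
    finally show ?case .
  next
    case (6 x y y')
    then show ?case using B.quot_map_eq_iff[of y y'] by simp
  next
    case (7 x y x' y')
    then show ?case
      using ring_hom_add[OF hom A.quot_map_mem A.quot_map_mem, of x x']
      by (simp add: A.quot_map_add B.quot_map_add)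
  next
    case (8 x y x' y')
    then show ?case
      using ring_hom_mult[OF hom A.quot_map_mem A.quot_map_mem, of x x']
      by (simp add: A.quot_map_mult B.quot_map_mult)
  next
    case (9 x y c)
    then show ?case
      using sc[OF A.quot_map_mem, of x c] by (simp add: A.quot_map_scale B.quot_map_scale)
  next
    case (10 x y)
    then show ?case
      using ad[OF A.quot_map_mem, of x] by (simp add: A.quot_map_adj B.quot_map_adj)
  next
    case 11
    show ?case using ring_hom_one[OF hom] by (simp add: A.quot_map_one B.quot_map_one)
  qed blast+
qed

lemma separable_dense_ball:
  assumes "\<And>n. unital_cstar_algebra (A n)" and "\<And>n. separable_cstar (A n)" and r: "0 < r"
  obtains d :: "nat \<Rightarrow> nat \<Rightarrow> 'a" where "\<And>n k. d n k \<in> carrier (A n)" "\<And>n k. nrm (A n) (d n k) \<le> r"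
    "\<And>n x \<epsilon>. x \<in> carrier (A n) \<Longrightarrow> nrm (A n) x \<le> r \<Longrightarrow> 0 < \<epsilon> \<Longrightarrow>
      \<exists>k. nrm (A n) (d n k \<ominus>\<^bsub>A n\<^esub> x) < \<epsilon>"
proof -
  have "\<exists>d :: nat \<Rightarrow> 'a. (\<forall>k. d k \<in> carrier (A n)) \<and> (\<forall>k. nrm (A n) (d k) \<le> r) \<and>
    (\<forall>x \<epsilon>. x \<in> carrier (A n) \<longrightarrow> nrm (A n) x \<le> r \<longrightarrow> 0 < \<epsilon> \<longrightarrow> (\<exists>k. nrm (A n) (d k \<ominus>\<^bsub>A n\<^esub> x) < \<epsilon>))" for n
    using unital_cstar_algebra.dense_sequence_in_ball[OF assms(1) assms(2)[unfolded separable_cstar_def] r, of n]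
    by metis
  then have "\<exists>d :: nat \<Rightarrow> nat \<Rightarrow> 'a. \<forall>n. (\<forall>k. d n k \<in> carrier (A n)) \<and> (\<forall>k. nrm (A n) (d n k) \<le> r) \<and>
    (\<forall>x \<epsilon>. x \<in> carrier (A n) \<longrightarrow> nrm (A n) x \<le> r \<longrightarrow> 0 < \<epsilon> \<longrightarrow> (\<exists>k. nrm (A n) (d n k \<ominus>\<^bsub>A n\<^esub> x) < \<epsilon>))"
    by (intro choice allI)
  then show thesis using that by blast
qed

theorem theorem5:
  fixes A :: "nat \<Rightarrow> 'a cstar"
    and B :: "nat \<Rightarrow> 'b cstar"
    and \<Lambda> :: "(nat \<Rightarrow> 'a) set \<Rightarrow> (nat \<Rightarrow> 'b) set"
  assumes "\<And>n. unital_cstar_algebra (A n)"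
    and "\<And>n. unital_cstar_algebra (B n)"
    and "\<And>n. separable_cstar (A n)"
    and "\<And>n. separable_cstar (B n)"
    and "\<And>n. no_nontrivial_central_projections (A n)"
    and "\<And>n. no_nontrivial_central_projections (B n)"
    and "\<And>n. metric_approximation_property TYPE('h) (A n)"
    and "\<Lambda> \<in> cstar_iso (reduced_product A) (reduced_product B)"
    and "topologically_trivial A B \<Lambda>"
  shows "asymptotically_algebraic A B \<Lambda>"
proof -
  have sA: "cstar_sequence A" and sB: "cstar_sequence B"
    using assms(1,2) by (simp_all add: cstar_sequence_def)
  interpret A: cstar_sequence A by (rule sA)
  interpret B: cstar_sequence B by (rule sB)
  define L where "L = (\<lambda>x y. x \<in> carrier (\<P> A) \<and>
    y \<in> carrier (\<P> B) \<and> \<Lambda> (quot_map A x) = quot_map B y)"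
  interpret L: product_correspondence A B L
    unfolding L_def by (rule product_correspondence_of_iso[OF sA sB assms(8)])
  interpret T: almost_homomorphism "\<lambda>S T. L (chi A S) (chi B T)"
    by (rule L.almost_homomorphism_chi[OF assms(5,6)])
  note borel = borel_codes[OF sA sB assms(9)]

  text \<open>Parities of codes stand for subsets of the index set.\<close>

  define Q :: "((nat \<Rightarrow> nat) \<times> (nat \<Rightarrow> nat)) set" where "Q = {(v, w). L (chi A {i. odd (v i)}) (chi B {m. odd (w m)})}"
  have code_chi: "chi C {i. odd (v i)} = (\<lambda>n. if odd (v n) then \<one>\<^bsub>C n\<^esub> else \<zero>\<^bsub>C n\<^esub>)"
    for C :: "nat \<Rightarrow> 'c cstar" and v :: "nat \<Rightarrow> nat" by (simp add: fun_eq_iff chi_def)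
  have "Q = {(v, w). \<Lambda> (quot_map A (chi A {i. odd (v i)})) = quot_map B (chi B {m. odd (w m)})}"
    by (simp add: Q_def L_def)
  also have "\<dots> \<in> sigma_sets UNIV {U. open U}"
    unfolding code_chi
    by (rule borel[of "\<lambda>n k. if odd k then \<one>\<^bsub>A n\<^esub> else \<zero>\<^bsub>A n\<^esub>" "\<lambda>n k. if odd k then \<one>\<^bsub>B n\<^esub> else \<zero>\<^bsub>B n\<^esub>"])
      simp_all
  finally have Q_borel: "Q \<in> sigma_sets UNIV {U. open U}" .
  have Q_total: "\<exists>w. (v, w) \<in> Q" for v
  proof -
    obtain T where "L (chi A {i. odd (v i)}) (chi B T)" using T.total by blast
    moreover have "T = {i. odd ((\<lambda>i. if i \<in> T then 1 else 0 :: nat) i)}" by auto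
    ultimately show ?thesis unfolding Q_def by (intro exI[of _ "\<lambda>i. if i \<in> T then 1 else 0"]) simp
  qed
  obtain D f where D: "comeagre D" "locally_determined D f" "\<forall>v\<in>D. (v, f v) \<in> Q"
    using borel_uniformization[OF Q_borel Q_total] by blast
  have "L (chi A {i. odd (v i)}) (chi B {m. odd (f v m)})" if "v \<in> D" for v
    using D(3) that by (simp add: Q_def)
  then obtain g where g: "\<And>S. L (chi A S) (chi B (g -` S))"
    using T.induced_by_function[OF D(1,2)] by metis
  obtain F1 F2 q where F: "finite F1" "finite F2" "bij_betw q (UNIV - F1) (UNIV - F2)"
    and gq: "\<And>n. n \<notin> F1 \<Longrightarrow> g (q n) = n"
    using T.induced_almost_bijective[OF g] by metis
  have ftone: "finite (g -` {i})" for i using T.finite_iff[OF g[of "{i}"]] by simp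

  \<comment> \<open>The radius \<open>1 / 8\<close> is that of \<open>small_ball_lift\<close>, so
    that lifts of decoded sequences can be taken in the unit ball, where the \<open>e n\<close> are
    dense.\<close>
  obtain d :: "nat \<Rightarrow> nat \<Rightarrow> 'a" where d: "\<And>n k. d n k \<in> carrier (A n)" "\<And>n k. nrm (A n) (d n k) \<le> 1 / 8"
    "\<And>n x \<epsilon>. x \<in> carrier (A n) \<Longrightarrow> nrm (A n) x \<le> 1 / 8 \<Longrightarrow> 0 < \<epsilon> \<Longrightarrow>
      \<exists>k. nrm (A n) (d n k \<ominus>\<^bsub>A n\<^esub> x) < \<epsilon>"
    using separable_dense_ball[of A "1 / 8"] assms(1,3) by auto
  obtain e :: "nat \<Rightarrow> nat \<Rightarrow> 'b" where e: "\<And>n k. e n k \<in> carrier (B n)" "\<And>n k. nrm (B n) (e n k) \<le> 1"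
    "\<And>n x \<epsilon>. x \<in> carrier (B n) \<Longrightarrow> nrm (B n) x \<le> 1 \<Longrightarrow> 0 < \<epsilon> \<Longrightarrow>
      \<exists>k. nrm (B n) (e n k \<ominus>\<^bsub>B n\<^esub> x) < \<epsilon>"
    using separable_dense_ball[of B 1] assms(2,4) by auto
  have dP: "(\<lambda>n. d n (v n)) \<in> carrier (\<P> A)" for v
    using d(1,2) by (intro A.productI)
  have eP: "(\<lambda>n. e n (w n)) \<in> carrier (\<P> B)" for w
    using e(1,2) by (intro B.productI)
  define R :: "((nat \<Rightarrow> nat) \<times> (nat \<Rightarrow> nat)) set" where "R = {(v, w). L (\<lambda>n. d n (v n)) (\<lambda>n. e n (w n))}"
  have "R = {(v, w). \<Lambda> (quot_map A (\<lambda>n. d n (v n))) = quot_map B (\<lambda>n. e n (w n))}"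
    using dP eP by (simp add: R_def L_def)
  also have "\<dots> \<in> sigma_sets UNIV {U. open U}"
  proof (rule borel[OF d(1) _ e(1,2)])
    show "nrm (A n) (d n k) \<le> 1" for n k using d(2)[of n k] by simp
  qed
  finally have R_borel: "R \<in> sigma_sets UNIV {U. open U}" .
  have R_total: "\<exists>w. (v, w) \<in> R" for v
  proof -
    obtain y where y: "L (\<lambda>n. d n (v n)) y" "\<And>n. nrm (B n) (y n) \<le> 1"
      using L.small_ball_lift[OF dP d(2)] by metis
    note yc = L.mem_right[OF y(1)]
    have "\<exists>k. nrm (B n) (e n k \<ominus>\<^bsub>B n\<^esub> y n) < 1 / real (Suc n)" for n
      by (rule e(3)[OF B.product_coord[OF yc] y(2)]) simp
    then obtain w where w: "\<And>n. nrm (B n) (e n (w n) \<ominus>\<^bsub>B n\<^esub> y n) < 1 / real (Suc n)" by metis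
    have "B.asym_eq (\<lambda>n. e n (w n)) y"
      using w by (intro B.asym_eqI_le e(1) B.product_coord[OF yc]) (rule less_imp_le)
    then have "L (\<lambda>n. d n (v n)) (\<lambda>n. e n (w n))"
      using L.right[OF y(1) eP] B.asym_eq_sym[OF eP yc] by blast
    then show ?thesis unfolding R_def by blast
  qed
  obtain E h where E: "comeagre E" "locally_determined E h" "\<forall>v\<in>E. (v, h v) \<in> R"
    using borel_uniformization[OF R_borel R_total] by blast
  have Lh: "L (\<lambda>n. d n (v n)) (\<lambda>m. e m (h v m))" if "v \<in> E" for v
    using E(3) that by (simp add: R_def)
  define \<delta> where "\<delta> m a b = nrm (B m) (e m a \<ominus>\<^bsub>B m\<^esub> e m b)" for m a b
  have \<delta>_sym: "\<delta> m a b = \<delta> m b a" for m a b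
    unfolding \<delta>_def by (rule B.A.nrm_minus_commute[OF e(1) e(1)])
  have \<delta>_tri: "\<delta> m a c \<le> \<delta> m a b + \<delta> m b c" for m a b c
    unfolding \<delta>_def by (rule B.A.nrm_minus_triangle[OF e(1) e(1) e(1)])
  have coord: "finite {m. v (g m) = w (g m) \<and> \<epsilon> < \<delta> m (h v m) (h w m)}"
    if "v \<in> E" "w \<in> E" "0 < \<epsilon>" for v w and \<epsilon> :: real
    by (rule finite_subset[OF _ L.coordinatewise_close[OF g Lh[OF that(1)] Lh[OF that(2)] that(3)]])
      (auto simp: \<delta>_def)
  have "\<exists>\<phi>. \<forall>z \<epsilon>. 0 < \<epsilon> \<longrightarrow> (\<exists>v\<in>E. \<exists>w\<in>E. \<exists>N. \<forall>m\<ge>N.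
    (v (g m) = z (g m) \<and> \<delta> m (h v m) (\<phi> m (z (g m))) \<le> \<epsilon>) \<or>
    (w (g m) = z (g m) \<and> \<delta> m (h w m) (\<phi> m (z (g m))) \<le> \<epsilon>))"
    by (rule coordinate_maps[OF E(1,2)]) (fact \<delta>_sym \<delta>_tri ftone coord)+
  then obtain \<phi> where \<phi>: "\<forall>z \<epsilon>. 0 < \<epsilon> \<longrightarrow> (\<exists>v\<in>E. \<exists>w\<in>E. \<exists>N. \<forall>m\<ge>N.
    (v (g m) = z (g m) \<and> \<delta> m (h v m) (\<phi> m (z (g m))) \<le> \<epsilon>) \<or>
    (w (g m) = z (g m) \<and> \<delta> m (h w m) (\<phi> m (z (g m))) \<le> \<epsilon>))"
    by (rule exE)
  have code_lift: "finite {m. \<epsilon> < nrm (B m) (y m \<ominus>\<^bsub>B m\<^esub> e m (\<phi> m (z (g m))))}"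
    if Ly: "L (\<lambda>n. d n (z n)) y" and \<epsilon>: "0 < \<epsilon>" for z y and \<epsilon> :: real
  proof -
    obtain v w N where vw: "v \<in> E" "w \<in> E" "\<And>m. N \<le> m \<Longrightarrow>
      (v (g m) = z (g m) \<and> \<delta> m (h v m) (\<phi> m (z (g m))) \<le> \<epsilon> / 2) \<or>
      (w (g m) = z (g m) \<and> \<delta> m (h w m) (\<phi> m (z (g m))) \<le> \<epsilon> / 2)"
      using \<phi>[rule_format, of "\<epsilon> / 2" z] \<epsilon> by (metis half_gt_zero)
    \<comment> \<open>\<open>z\<close> need not lie in \<open>E\<close>, but where it agrees with
      \<open>u\<close> the decoded elements agree, and \<open>coordinatewise_close\<close> compares
      the lifts.\<close>
    define M where "M u = {m. d (g m) (z (g m)) = d (g m) (u (g m)) \<and>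
      \<epsilon> / 2 < nrm (B m) (y m \<ominus>\<^bsub>B m\<^esub> e m (h u m))}" for u
    have fM: "finite (M u)" if "u \<in> E" for u
      unfolding M_def using \<epsilon> by (intro L.coordinatewise_close[OF g Ly Lh[OF that]]) simp
    have ym: "y m \<in> carrier (B m)" for m using L.mem_right[OF Ly] by simp
    have near: "nrm (B m) (y m \<ominus>\<^bsub>B m\<^esub> e m (\<phi> m (z (g m)))) \<le> \<epsilon>"
      if "m \<notin> M u" "u (g m) = z (g m)" "\<delta> m (h u m) (\<phi> m (z (g m))) \<le> \<epsilon> / 2" for m u
    proof -
      have "nrm (B m) (y m \<ominus>\<^bsub>B m\<^esub> e m (h u m)) \<le> \<epsilon> / 2"
        using that(1,2) unfolding M_def by simp
      then show ?thesis
        using B.A.nrm_minus_triangle[of "y m" m "e m (h u m)" "e m (\<phi> m (z (g m)))"] that(3) ym e(1)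
        by (simp add: \<delta>_def)
    qed
    have "{m. \<epsilon> < nrm (B m) (y m \<ominus>\<^bsub>B m\<^esub> e m (\<phi> m (z (g m))))} \<subseteq> {..<N} \<union> M v \<union> M w"
    proof (rule subsetI, rule ccontr)
      fix m assume m: "m \<in> {m. \<epsilon> < nrm (B m) (y m \<ominus>\<^bsub>B m\<^esub> e m (\<phi> m (z (g m))))}"
        "m \<notin> {..<N} \<union> M v \<union> M w"
      then have "N \<le> m" "m \<notin> M v" "m \<notin> M w" by auto
      then have "nrm (B m) (y m \<ominus>\<^bsub>B m\<^esub> e m (\<phi> m (z (g m)))) \<le> \<epsilon>"
        using vw(3)[of m] near by blast
      then show False using m(1) by simp
    qed
    then show ?thesis using fM[OF vw(1)] fM[OF vw(2)] by (meson finite_Un finite_lessThan finite_subset)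
  qed

  \<comment> \<open>An integer at least \<open>8 * nrm (A n) a\<close>, so that dividing by it leads
    into the ball of radius \<open>1 / 8\<close>; \<open>Suc\<close> keeps it positive.\<close>
  define \<kappa> where "\<kappa> n a = Suc (nat \<lceil>8 * nrm (A n) a\<rceil>)" for n a
  define code where "code n a = (SOME k. nrm (A n) (d n k \<ominus>\<^bsub>A n\<^esub> complex_of_real (1 / real (\<kappa> n a)) \<odot>\<^bsub>A n\<^esub> a)
    < 1 / real (Suc n))" for n a
  have \<kappa>_pos: "0 < \<kappa> n a" for n a by (simp add: \<kappa>_def)
  have \<kappa>_ball: "nrm (A n) (complex_of_real (1 / real (\<kappa> n a)) \<odot>\<^bsub>A n\<^esub> a) \<le> 1 / 8"
    if "a \<in> carrier (A n)" for n a
  proof -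
    have "nrm (A n) (complex_of_real (1 / real (\<kappa> n a)) \<odot>\<^bsub>A n\<^esub> a) = nrm (A n) a / real (\<kappa> n a)"
      using A.A.nrm_smult[OF that, of "complex_of_real (1 / real (\<kappa> n a))"] by (simp add: norm_divide)
    also have "8 * nrm (A n) a \<le> real (\<kappa> n a)" unfolding \<kappa>_def by linarith
    then have "nrm (A n) a / real (\<kappa> n a) \<le> 1 / 8" using \<kappa>_pos[of n a] by (simp add: divide_le_eq)
    finally show ?thesis .
  qed
  have code: "nrm (A n) (d n (code n a) \<ominus>\<^bsub>A n\<^esub> complex_of_real (1 / real (\<kappa> n a)) \<odot>\<^bsub>A n\<^esub> a) < 1 / real (Suc n)"
    if "a \<in> carrier (A n)" for n a
    unfolding code_def
    by (rule someI_ex[OF d(3)[OF A.A.scale_closed[OF that] \<kappa>_ball[OF that]]]) simp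
  \<comment> \<open>The coordinate map sought, on elements instead of codes: rescale, encode, apply
    \<open>\<phi>\<close>, decode and undo the scaling.\<close>
  define out where "out m a = of_nat (\<kappa> (g m) a) \<odot>\<^bsub>B m\<^esub> e m (\<phi> m (code (g m) a))" for m a
  have outc: "out m a \<in> carrier (B m)" for m a unfolding out_def by (rule B.A.scale_closed[OF e(1)])
  have out_le: "nrm (B m) (out m a) \<le> real (\<kappa> (g m) a)" for m a
    using B.A.nrm_smult[OF e(1), of m "of_nat (\<kappa> (g m) a)"] mult_left_mono[OF e(2), of "real (\<kappa> (g m) a)" m]
    by (simp add: out_def)
  define \<Phi> where "\<Phi> x m = (if m \<in> F2 then \<zero>\<^bsub>B m\<^esub> else out m (x (g m)))" for x m
  have \<kappa>_bdd: "\<exists>J. \<forall>n. \<kappa> n (x n) \<le> J" if x: "x \<in> carrier (\<P> A)" for x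
  proof -
    obtain K where K: "\<And>n. nrm (A n) (x n) \<le> K" using A.product_bound[OF x] by metis
    have "8 * nrm (A n) (x n) \<le> 8 * K" for n using K[of n] by simp
    then have "\<kappa> n (x n) \<le> Suc (nat \<lceil>8 * K\<rceil>)" for n
      unfolding \<kappa>_def Suc_le_mono by (intro nat_mono ceiling_mono)
    then show ?thesis by blast
  qed
  have \<Phi>c: "\<Phi> x \<in> carrier (\<P> B)" if x: "x \<in> carrier (\<P> A)" for x
  proof -
    obtain J where J: "\<And>n. \<kappa> n (x n) \<le> J" using \<kappa>_bdd[OF x] by blast
    show ?thesis
    proof (rule B.productI[where K = "real J"])
      show "\<Phi> x m \<in> carrier (B m)" for m by (simp add: \<Phi>_def outc)
      show "nrm (B m) (\<Phi> x m) \<le> real J" for m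
        using out_le[of m "x (g m)"] J[of "g m"] by (simp add: \<Phi>_def)
    qed
  qed
  have lift: "quot_map B (\<Phi> x) = \<Lambda> (quot_map A x)" if x: "x \<in> carrier (\<P> A)" for x
  proof -
    obtain y where Ly: "L x y" using L.total[OF x] by blast
    note yc = L.mem_right[OF Ly]
    obtain J where J: "\<And>n. \<kappa> n (x n) \<le> J" using \<kappa>_bdd[OF x] by blast
    define x' where "x' n = complex_of_real (1 / real (\<kappa> n (x n))) \<odot>\<^bsub>A n\<^esub> x n" for n
    have xn: "x n \<in> carrier (A n)" for n using x by simp
    have x'n: "x' n \<in> carrier (A n)" for n unfolding x'_def by (rule A.A.scale_closed[OF xn])
    have x'c: "x' \<in> carrier (\<P> A)"
      using \<kappa>_ball[OF xn] by (intro A.productI x'n) (simp only: x'_def)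
    define z where "z n = code n (x n)" for n
    have x'z: "A.asym_eq (\<lambda>n. d n (z n)) x'"
      using code[OF xn] by (intro A.asym_eqI_le d(1) x'n) (simp only: x'_def z_def less_imp_le)
    obtain y' where Ly': "L (\<lambda>n. d n (z n)) y'" using L.total[OF dP] by blast
    obtain y'' where Ly'': "L x' y''" using L.total[OF x'c] by blast
    \<comment> \<open>\<open>x'\<close> and its decoded code are only asymptotically equal; a lift
      of one is then a lift of the other.\<close>
    have "B.asym_eq y'' y'"
      using L.cong[OF Ly' Ly''] x'z B.asym_eq_sym[OF L.mem_right[OF Ly'] L.mem_right[OF Ly'']] by blast
    then have Lx': "L x' y'" by (rule L.right[OF Ly'' L.mem_right[OF Ly']])
    have xk: "x n = of_nat (\<kappa> n (x n)) \<odot>\<^bsub>A n\<^esub> x' n" for n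
    proof -
      have "of_nat (\<kappa> n (x n)) * complex_of_real (1 / real (\<kappa> n (x n))) = 1"
        using \<kappa>_pos[of n "x n"] by simp
      then show ?thesis unfolding x'_def A.A.scale_scale[OF xn] using xn by simp
    qed
    have fin: "finite {m. \<epsilon> < nrm (B m) (y m \<ominus>\<^bsub>B m\<^esub> out m (x (g m)))}" if "0 < \<epsilon>" for \<epsilon>
      using L.lift_from_unit_ball[OF g Ly Lx', of "\<lambda>n. \<kappa> n (x n)" J "\<lambda>m. e m (\<phi> m (z (g m)))" \<epsilon>]
        J xk e(1) code_lift[OF Ly'] that unfolding out_def z_def by blast
    have "B.asym_eq y (\<Phi> x)"
      unfolding B.asym_eq_iff[OF yc \<Phi>c[OF x]]
    proof (intro allI impI)
      fix \<epsilon> :: real assume \<epsilon>: "0 < \<epsilon>"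
      have "{m. \<epsilon> \<le> nrm (B m) (y m \<ominus>\<^bsub>B m\<^esub> \<Phi> x m)} \<subseteq>
          F2 \<union> {m. \<epsilon> / 2 < nrm (B m) (y m \<ominus>\<^bsub>B m\<^esub> out m (x (g m)))}"
        using \<epsilon> by (auto simp: \<Phi>_def)
      then show "finite {m. \<epsilon> \<le> nrm (B m) (y m \<ominus>\<^bsub>B m\<^esub> \<Phi> x m)}"
        using F(2) fin[of "\<epsilon> / 2"] \<epsilon> by (meson finite_Un finite_subset half_gt_zero)
    qed
    then have "L x (\<Phi> x)" by (rule L.right[OF Ly \<Phi>c[OF x]])
    then show ?thesis unfolding L_def by simp
  qed
  have qF: "q n \<notin> F2" if "n \<notin> F1" for n using F(3) that by (auto dest: bij_betwE)
  show ?thesis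
    unfolding asymptotically_algebraic_def
  proof (intro exI conjI ballI)
    show "finite F1" "finite F2" "bij_betw q (UNIV - F1) (UNIV - F2)" by (rule F)+
    show "(\<lambda>a. out (q n) a) \<in> carrier (A n) \<rightarrow> carrier (B (q n))" for n using outc by blast
    show "\<Phi> \<in> carrier (\<P> A) \<rightarrow> carrier (\<P> B)" using \<Phi>c by blast
    fix x assume x: "x \<in> carrier (\<P> A)"
    show "quot_map B (\<Phi> x) = \<Lambda> (quot_map A x)" by (rule lift[OF x])
    show "\<Phi> x m = \<zero>\<^bsub>B m\<^esub>" if "m \<in> F2" for m using that by (simp add: \<Phi>_def)
    \<comment> \<open>\<open>g\<close> inverts \<open>q\<close> off \<open>F1\<close>, so the value
      at \<open>q n\<close> is determined by \<open>x n\<close>.\<close>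
    show "\<Phi> x (q n) = out (q n) (x n)" if "n \<in> UNIV - F1" for n
      using that qF[of n] gq[of n] by (simp add: \<Phi>_def)
  qed
qed

end
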